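(* Let $q>0$ be a constant with $q\neq1$. Let $\Omega=B_{R_0}(x_0)\subset\mathbb{R}^2$ be the open disk of radius $R_0>0$ centered at a point $x_0\neq 0$. Suppose that $$\frac{|x_0|}{R_0}<\begin{cases}\dfrac{\sqrt{q}}{1+\sqrt{q}} & \text{if } \sqrt{q}<1 \text{ or } 1<\sqrt{q}\le \dfrac{1}{\sqrt{3}-1},\\[2mm] \sqrt{1-\dfrac{2(1+\sqrt{q})}{3\sqrt{3q}}} & \text{if } \sqrt{q}>\dfrac{1}{\sqrt{3}-1}.\end{cases}$$ Let $\phi$ be a $C^1$ function on $\mathbb{S}^1$ which is not identically zero. Then there are at most finitely many wave numbers $k>0$ such that $\Omega$ is non-scattering in the presence of the incident wave $v=\mathbf{H}[k,\phi]$.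
   Context: We identify $\mathbb{S}^1$ with $[0,2\pi)$ (and with $\mathbb{R}/(2\pi\mathbb{Z})$) via $\theta\mapsto(\cos\theta,\sin\theta)^T$; for $\xi\in\mathbb{S}^1$, $\theta_\xi$ denotes its angular coordinate. For $k>0$ and $\phi\in L^2(\mathbb{S}^1)$ the Herglotz wave is $\mathbf{H}[k,\phi](x)=\int_{-\pi}^{\pi}\phi(\xi)e^{\mathrm{i}k\xi\cdot x}\,d\theta_\xi$, $x\in\mathbb{R}^2$. For a bounded domain $\Omega$ with index of refraction the constant $q$, $\Omega$ is called non-scattering in the presence of the incident wave $\mathbf{H}[k,\phi]$ (at wave number $k$) if there exists $u\in H^1(\Omega)$ with $\Delta u+k^2qu=0$ in $\Omega$ and $u=\mathbf{H}[k,\phi]$, $\partial_\nu u=\partial_\nu\mathbf{H}[k,\phi]$ on $\partial\Omega$ ($\nu$ the outward unit normal). *)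

theory Defs
  imports "HOL-Analysis.Analysis"
begin

type_synonym pt = "real \<times> real"

definition unitvec :: "real \<Rightarrow> pt" where
  "unitvec t = (cos t, sin t)"

text \<open>Herglotz wave H[k,phi](x) = int_{-pi}^{pi} phi(theta) e^{i k xi.x} dtheta,
  phi given as a 2pi-periodic function of the angle.\<close>
definition herglotz :: "real \<Rightarrow> (real \<Rightarrow> complex) \<Rightarrow> pt \<Rightarrow> complex" where
  "herglotz k \<phi> x = integral {-pi..pi} (\<lambda>\<theta>. \<phi> \<theta> * exp (\<i> * of_real (k * (unitvec \<theta> \<bullet> x))))"

definition dirderiv :: "(pt \<Rightarrow> complex) \<Rightarrow> pt \<Rightarrow> pt \<Rightarrow> complex" where
  "dirderiv f x e = vector_derivative (\<lambda>s::real. f (x + s *\<^sub>R e)) (at 0)"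

definition C1_with_partials :: "(pt \<Rightarrow> complex) \<Rightarrow> (pt \<Rightarrow> complex) \<Rightarrow> (pt \<Rightarrow> complex) \<Rightarrow> bool" where
  "C1_with_partials f d1 d2 \<longleftrightarrow>
     (\<forall>x. (f has_derivative (\<lambda>h. of_real (fst h) * d1 x + of_real (snd h) * d2 x)) (at x))
     \<and> continuous_on UNIV d1 \<and> continuous_on UNIV d2"

definition test_fun :: "pt set \<Rightarrow> (pt \<Rightarrow> complex) \<Rightarrow> (pt \<Rightarrow> complex) \<Rightarrow> (pt \<Rightarrow> complex) \<Rightarrow> bool" where
  "test_fun \<Omega> f d1 d2 \<longleftrightarrow> C1_with_partials f d1 d2
     \<and> compact (closure {x. f x \<noteq> 0}) \<and> closure {x. f x \<noteq> 0} \<subseteq> \<Omega>"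

definition L2_on :: "pt set \<Rightarrow> (pt \<Rightarrow> complex) \<Rightarrow> bool" where
  "L2_on \<Omega> f \<longleftrightarrow> set_borel_measurable lebesgue \<Omega> f
     \<and> set_integrable lebesgue \<Omega> (\<lambda>x. (cmod (f x))\<^sup>2)"

definition L2_dist2 :: "pt set \<Rightarrow> (pt \<Rightarrow> complex) \<Rightarrow> (pt \<Rightarrow> complex) \<Rightarrow> real" where
  "L2_dist2 \<Omega> f g = set_lebesgue_integral lebesgue \<Omega> (\<lambda>x. (cmod (f x - g x))\<^sup>2)"

definition H1_with_grad :: "pt set \<Rightarrow> (pt \<Rightarrow> complex) \<Rightarrow> (pt \<Rightarrow> complex) \<Rightarrow> (pt \<Rightarrow> complex) \<Rightarrow> bool" where
  "H1_with_grad \<Omega> u g1 g2 \<longleftrightarrow> L2_on \<Omega> u \<and> L2_on \<Omega> g1 \<and> L2_on \<Omega> g2 \<and>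
     (\<forall>\<psi> d1 d2. test_fun \<Omega> \<psi> d1 d2 \<longrightarrow>
        set_lebesgue_integral lebesgue \<Omega> (\<lambda>x. u x * d1 x) = - set_lebesgue_integral lebesgue \<Omega> (\<lambda>x. g1 x * \<psi> x)
      \<and> set_lebesgue_integral lebesgue \<Omega> (\<lambda>x. u x * d2 x) = - set_lebesgue_integral lebesgue \<Omega> (\<lambda>x. g2 x * \<psi> x))"

text \<open>Non-scattering for the disk Omega = ball x0 R0, constant index q, wave number k,
  incident Herglotz wave v = H[k,phi]:
  there is u in H^1(Omega) (weak gradient g1,g2) such that
  (i) u - v in H^1_0(Omega) (i.e. u = v on the boundary in the trace sense), and
  (ii) for all C^1 test functions psi on R^2 (Green's identity / weak form)
       int_Omega grad u . grad psi - k^2 q u psi dx = int_{boundary} d_nu v psi ds,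
  which encodes both Delta u + k^2 q u = 0 in Omega and d_nu u = d_nu v on the boundary.\<close>
definition nonscattering_disk :: "pt \<Rightarrow> real \<Rightarrow> real \<Rightarrow> real \<Rightarrow> (real \<Rightarrow> complex) \<Rightarrow> bool" where
  "nonscattering_disk x0 R0 q k \<phi> \<longleftrightarrow>
    (let \<Omega> = ball x0 R0; v = herglotz k \<phi> in
     \<exists>u g1 g2. H1_with_grad \<Omega> u g1 g2
       \<and> (\<exists>\<psi> d1 d2. (\<forall>n. test_fun \<Omega> (\<psi> n) (d1 n) (d2 n))
            \<and> (\<lambda>n. L2_dist2 \<Omega> (\<psi> n) (\<lambda>x. u x - v x)
                  + L2_dist2 \<Omega> (d1 n) (\<lambda>x. g1 x - dirderiv v x (1,0))
                  + L2_dist2 \<Omega> (d2 n) (\<lambda>x. g2 x - dirderiv v x (0,1))) \<longlonglongrightarrow> 0)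
       \<and> (\<forall>\<psi> d1 d2. C1_with_partials \<psi> d1 d2 \<longrightarrow>
            set_lebesgue_integral lebesgue \<Omega>
              (\<lambda>x. g1 x * d1 x + g2 x * d2 x - of_real (k\<^sup>2 * q) * u x * \<psi> x)
            = integral {-pi..pi} (\<lambda>t. dirderiv v (x0 + R0 *\<^sub>R unitvec t) (unitvec t)
                                      * \<psi> (x0 + R0 *\<^sub>R unitvec t) * of_real R0)))"

end

theory Submission
  imports Defs "HOL-Complex_Analysis.Complex_Analysis"
begin

text \<open>
  Pairing the interior problem with the solutions \<open>J\<^sub>n(k \<surd>q r) exp(- \<i> n t)\<close> of the
  Helmholtz equation and using Green's formula on the disk shows that non-scattering at \<open>k\<close> means
  \<open>c\<^sub>n D\<^sub>n = 0\<close> for all \<open>n\<close>. Here \<open>c\<^sub>n\<close> are the Fourier coefficients of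
  \<open>\<phi>(\<xi>) exp(\<i> k \<xi> \<cdot> x\<^sub>0)\<close>, and \<open>D\<^sub>n\<close> is the Wronskian-like
  determinant of the Bessel functions \<open>J\<^sub>n\<close> at \<open>k R\<close> and \<open>k \<surd>q R\<close>. The Bessel recurrences
  show that \<open>D\<^sub>n\<close> cannot vanish for six consecutive \<open>n\<close>, so the zeros of \<open>c\<^sub>n\<close> have bounded gaps.

  Rotate so that the phase is \<open>\<lambda> cos \<theta>\<close> with \<open>\<lambda> = k |x\<^sub>0| > 0\<close>. Suppose first that the exceptional
  \<open>k\<close> are unbounded. Integration by parts shows that multiplication by \<open>sin \<theta>\<close> acts on the Fourier
  side as multiplication by \<open>-n/\<lambda>\<close>, up to an error of order \<open>1/\<lambda>\<close> in \<open>\<ell>\<^sup>2\<close>. Since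
  \<open>exp(- \<i> m \<theta>)\<close> is a linear polynomial in \<open>exp(- \<i> \<theta>)\<close> with coefficients in \<open>\<complex>[sin \<theta>]\<close>, two zeros
  \<open>c\<^sub>n = c\<^sub>n\<^sub>+\<^sub>m = 0\<close> make the coefficients of \<open>W \<phi>\<close> near \<open>n\<close> small, with a fixed multiplier \<open>W\<close>
  that has isolated zeros. Parseval's identity then gives \<open>W \<phi> = 0\<close> in the limit \<open>\<lambda> \<rightarrow> \<infinity>\<close>.

  If the exceptional \<open>k\<close> are infinite in number but bounded, then two of the \<open>c\<^sub>n\<close>, which are entire in
  \<open>k\<close>, vanish identically. Taking moments, \<open>\<phi> exp(- \<i> n \<theta>)\<close> is odd for two different \<open>n\<close>, so \<open>\<phi> = 0\<close>.
\<close>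

section \<open>Fourier series\<close>

named_theorems cper_intros

definition cper :: "(real \<Rightarrow> complex) \<Rightarrow> bool" where
  "cper f \<longleftrightarrow> continuous_on UNIV f \<and> (\<forall>\<theta>. f (\<theta> + 2 * pi) = f \<theta>)"

lemma cper_cont: "cper f \<Longrightarrow> continuous_on S f"
  unfolding cper_def using continuous_on_subset by blast

lemma cper_const [cper_intros]: "cper (\<lambda>_. c)"
  by (simp add: cper_def)

lemma cper_add [cper_intros]: "cper f \<Longrightarrow> cper g \<Longrightarrow> cper (\<lambda>x. f x + g x)"
  unfolding cper_def by (auto intro: continuous_intros)

lemma cper_diff [cper_intros]: "cper f \<Longrightarrow> cper g \<Longrightarrow> cper (\<lambda>x. f x - g x)"
  unfolding cper_def by (auto intro: continuous_intros)

lemma cper_minus [cper_intros]: "cper f \<Longrightarrow> cper (\<lambda>x. - f x)"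
  unfolding cper_def by (auto intro: continuous_intros)

lemma cper_mult [cper_intros]: "cper f \<Longrightarrow> cper g \<Longrightarrow> cper (\<lambda>x. f x * g x)"
  unfolding cper_def by (auto intro: continuous_intros)

lemma cper_sum [cper_intros]: "(\<And>i. i \<in> A \<Longrightarrow> cper (f i)) \<Longrightarrow> cper (\<lambda>x. \<Sum>i\<in>A. f i x)"
  unfolding cper_def by (auto intro: continuous_intros)

lemma cis_2pi_int: "cis (of_int n * (\<theta> + 2 * pi)) = cis (of_int n * \<theta>)"
proof -
  have "cis (of_int n * (\<theta> + 2 * pi)) = cis (of_int n * \<theta>) * cis (2 * pi * of_int n)"
    by (simp add: cis_mult algebra_simps)
  then show ?thesis by (simp add: cis_multiple_2pi)
qed

lemma cper_cis [cper_intros]: "cper (\<lambda>\<theta>. cis (of_int n * \<theta>))"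
  unfolding cper_def using cis_2pi_int by (intro conjI continuous_intros) auto

lemma cper_cis_minus [cper_intros]: "cper (\<lambda>\<theta>. cis (- (of_int n * \<theta>)))"
  using cper_cis[of "-n"] by simp

lemma cper_sin [cper_intros]: "cper (\<lambda>\<theta>. of_real (sin \<theta>))"
  unfolding cper_def by (auto intro!: continuous_intros)

lemma cper_cos [cper_intros]: "cper (\<lambda>\<theta>. of_real (cos \<theta>))"
  unfolding cper_def by (auto intro!: continuous_intros)

lemma cper_cis_cos [cper_intros]: "cper (\<lambda>\<theta>. cis (z * cos \<theta>))"
  unfolding cper_def by (intro conjI continuous_intros) auto

lemma cper_cnj [cper_intros]: "cper f \<Longrightarrow> cper (\<lambda>\<theta>. cnj (f \<theta>))"
  unfolding cper_def by (auto intro: continuous_intros)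

lemma cper_shift:
  assumes "cper f"
  shows "cper (\<lambda>\<theta>. f (\<theta> + c))"
proof -
  have "f (\<theta> + c + 2 * pi) = f (\<theta> + c)" for \<theta> using assms unfolding cper_def by blast
  moreover have "continuous_on UNIV (\<lambda>\<theta>. f (\<theta> + c))"
    by (intro continuous_on_compose2[OF cper_cont[OF assms, of UNIV]] continuous_intros) auto
  ultimately show ?thesis unfolding cper_def by (simp add: add_ac)
qed

lemma cper_reflect:
  assumes "cper f"
  shows "cper (\<lambda>\<theta>. f (- \<theta>))"
proof -
  have "f (- \<theta> - 2 * pi + 2 * pi) = f (- \<theta> - 2 * pi)" for \<theta> using assms unfolding cper_def by blast
  moreover have "continuous_on UNIV (\<lambda>\<theta>. f (- \<theta>))"
    by (intro continuous_on_compose2[OF cper_cont[OF assms, of UNIV]] continuous_intros) auto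
  ultimately show ?thesis unfolding cper_def by simp
qed

lemma cper_integrable: "cper f \<Longrightarrow> f integrable_on {a..b}"
  by (intro integrable_continuous_real cper_cont)

lemma integral_cper_shift:
  assumes "cper f"
  shows "integral {-pi..pi} (\<lambda>x. f (x + c)) = integral {-pi..pi} f"
proof -
  \<comment> \<open>\<open>M\<close> exceeds \<open>\<bar>c\<bar> + pi\<close>, so for
    \<open>\<bar>x\<bar> \<le> \<bar>c\<bar>\<close> both \<open>x + pi\<close> and
    \<open>x - pi\<close> lie in the open interval, where the antiderivative \<open>A\<close> is
    differentiable from both sides.\<close>
  define M where "M = \<bar>c\<bar> + 10"
  have M: "\<bar>c\<bar> + pi < M" "pi < M" using pi_less_4 by (auto simp: M_def)
  obtain A where A: "\<And>x. x \<in> {-M..M} \<Longrightarrow> (A has_vector_derivative f x) (at x within {-M..M})"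
    using antiderivative_continuous[of "-M" M f] cper_cont[OF assms] by blast
  have A': "(A has_vector_derivative f x) (at x)" if "x \<in> {-M<..<M}" for x
    using A[of x] that at_within_Icc_at[of "-M" x M] by simp
  have I: "integral {a..b} f = A b - A a" if "-M \<le> a" "a \<le> b" "b \<le> M" for a b
    by (intro integral_unique fundamental_theorem_of_calculus that has_vector_derivative_within_subset[OF A]) (use that in auto)
  \<comment> \<open>\<open>A (x + pi) - A (x - pi)\<close> is the integral over the period centred
    at \<open>x\<close>. Its derivative \<open>f (x + pi) - f (x - pi)\<close> vanishes by
    periodicity; comparing \<open>x = c\<close> with \<open>x = 0\<close> gives the claim.\<close>
  have "((\<lambda>x. A (x + pi) - A (x - pi)) has_vector_derivative 0) (at x within {-\<bar>c\<bar>..\<bar>c\<bar>})" if "x \<in> {-\<bar>c\<bar>..\<bar>c\<bar>}" for x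
  proof -
    have "((\<lambda>x. x + pi) has_vector_derivative 1) (at x)"
      by (auto intro!: derivative_eq_intros)
    moreover have "x + pi \<in> {-M<..<M}"
      using that M pi_gt_zero unfolding atLeastAtMost_iff greaterThanLessThan_iff by linarith
    ultimately have "(A \<circ> (\<lambda>x. x + pi) has_vector_derivative 1 *\<^sub>R f (x + pi)) (at x)"
      by (intro vector_diff_chain_at A')
    then
    have 1: "((\<lambda>x. A (x + pi)) has_vector_derivative f (x + pi)) (at x)"
      by (simp add: o_def)
    have "((\<lambda>x. x - pi) has_vector_derivative 1) (at x)"
      by (auto intro!: derivative_eq_intros)
    moreover have "x - pi \<in> {-M<..<M}"
      using that M pi_gt_zero unfolding atLeastAtMost_iff greaterThanLessThan_iff by linarith
    ultimately have "(A \<circ> (\<lambda>x. x - pi) has_vector_derivative 1 *\<^sub>R f (x - pi)) (at x)"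
      by (intro vector_diff_chain_at A')
    then
    have 2: "((\<lambda>x. A (x - pi)) has_vector_derivative f (x - pi)) (at x)"
      by (simp add: o_def)
    have "f (x - pi + 2*pi) = f (x - pi)" using assms unfolding cper_def by blast
    then have "f (x + pi) = f (x - pi)" by (simp add: algebra_simps)
    then show ?thesis using has_vector_derivative_diff[OF 1 2] by (auto intro: has_vector_derivative_at_within)
  qed
  then obtain k where k: "\<And>x. x \<in> {-\<bar>c\<bar>..\<bar>c\<bar>} \<Longrightarrow> A (x + pi) - A (x - pi) = k"
    by (rule has_vector_derivative_zero_constant[rotated]) auto
  have "integral {-pi..pi} (\<lambda>x. f (x + c)) = integral {-pi + c..pi + c} f"
    using integral_shift[of "-pi" c pi f] cper_cont[OF assms] by (simp add: o_def)
  also have "\<dots> = A (c + pi) - A (c - pi)" by (subst I) (use M in \<open>auto simp: algebra_simps\<close>)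
  also have "\<dots> = A (0 + pi) - A (0 - pi)" by (subst (1 2) k) auto
  also have "\<dots> = integral {-pi..pi} f" by (subst I) (use M in auto)
  finally show ?thesis .
qed

lemma integral_reflect_pi: "integral {-pi..pi} (\<lambda>x. f (- x)) = integral {-pi..pi} (f :: real \<Rightarrow> complex)"
  using Henstock_Kurzweil_Integration.integral_reflect_real[of pi "-pi" f] by (simp only: minus_minus)

section \<open>Fourier coefficients and the mean-square error\<close>

definition fc :: "(real \<Rightarrow> complex) \<Rightarrow> int \<Rightarrow> complex" where
  "fc f n = integral {-pi..pi} (\<lambda>\<theta>. f \<theta> * cis (- (of_int n * \<theta>)))"

lemma integral_cis: "integral {-pi..pi} (\<lambda>\<theta>. cis (of_int n * \<theta>)) = (if n = 0 then 2 * of_real pi else 0)"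
proof (cases "n = 0")
  case False
  have "((\<lambda>\<theta>. cis (of_int n * \<theta>)) has_integral (cis (of_int n * pi) / (\<i> * of_int n) - cis (of_int n * (-pi)) / (\<i> * of_int n))) {-pi..pi}"
  proof (rule fundamental_theorem_of_calculus)
    fix x :: real
    have "((\<lambda>\<theta>. cis (of_int n * \<theta>)) has_vector_derivative of_int n *\<^sub>R (\<i> * cis (of_int n * x))) (at x within {-pi..pi})"
      unfolding has_vector_derivative_def by (auto intro!: derivative_eq_intros ext)
    from has_vector_derivative_divide[OF this, of "\<i> * of_int n"]
    show "((\<lambda>\<theta>. cis (of_int n * \<theta>) / (\<i> * of_int n)) has_vector_derivative cis (of_int n * x)) (at x within {-pi..pi})"
      using False by (simp add: scaleR_conv_of_real)
  qed auto
  moreover have "cis (of_int n * pi) = cis (of_int n * (-pi))"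
    using cis_2pi_int[of n "-pi"] by simp
  ultimately show ?thesis using False by (simp add: integral_unique)
qed (auto simp: scaleR_conv_of_real)

lemma fc_add: "cper f \<Longrightarrow> cper g \<Longrightarrow> fc (\<lambda>\<theta>. f \<theta> + g \<theta>) n = fc f n + fc g n"
  unfolding fc_def ring_distribs by (intro Henstock_Kurzweil_Integration.integral_add cper_integrable cper_intros)

lemma fc_cmult: "fc (\<lambda>\<theta>. c * f \<theta>) n = c * fc f n"
  unfolding fc_def mult.assoc by (rule integral_mult_right)

lemma fc_cis: "fc (\<lambda>\<theta>. f \<theta> * cis (- (of_int m * \<theta>))) n = fc f (n + m)"
  unfolding fc_def by (simp add: mult.assoc cis_mult algebra_simps)

lemma integral_real_of_complex:
  assumes "cper f" "\<And>x. f x = of_real (g x)"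
  shows "integral {-pi..pi} f = of_real (integral {-pi..pi} g)"
proof -
  have fe: "f = (\<lambda>x. of_real (g x))" using assms(2) by blast
  have "g = (\<lambda>x. Re (f x))" by (simp add: assms)
  then have "continuous_on {-pi..pi} g" using cper_cont[OF assms(1)] by (auto intro: continuous_intros)
  then have "(g has_integral integral {-pi..pi} g) {-pi..pi}" by (simp add: integrable_continuous_real integrable_integral)
  then have "(f has_integral of_real (integral {-pi..pi} g)) {-pi..pi}"
    unfolding fe by (rule has_integral_of_real)
  then show ?thesis by (rule integral_unique)
qed

lemma cper_norm2: "cper f \<Longrightarrow> (\<lambda>x. (cmod (f x))\<^sup>2) integrable_on {a..b}"
  by (intro integrable_continuous_real continuous_intros cper_cont)

text \<open>Expand the square, use orthogonality of the exponentials, and complete the square. As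
  \<open>fc\<close> carries no factor 1/(2 pi), the best coefficients are
  \<open>fc f n / (2 * pi)\<close>. The \<open>a n\<close> stay arbitrary: the best ones give
  Bessel's inequality, those of a uniform approximation give Parseval.\<close>

lemma fourier_error:
  fixes a :: "int \<Rightarrow> complex"
  assumes f: "cper f" and A: "finite A"
  defines "p \<equiv> \<lambda>\<theta>. \<Sum>n\<in>A. a n * cis (of_int n * \<theta>)"
  shows "integral {-pi..pi} (\<lambda>\<theta>. (cmod (f \<theta> - p \<theta>))\<^sup>2) =
     integral {-pi..pi} (\<lambda>\<theta>. (cmod (f \<theta>))\<^sup>2) - (\<Sum>n\<in>A. (cmod (fc f n))\<^sup>2) / (2*pi)
       + 2 * pi * (\<Sum>n\<in>A. (cmod (a n - fc f n / (2 * pi)))\<^sup>2)" (is "?L = ?R")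
proof -
  have p: "cper p" unfolding p_def by (intro cper_intros)
  have c: "integral {-pi..pi} (\<lambda>\<theta>. of_real ((cmod (g \<theta>))\<^sup>2)) = complex_of_real (integral {-pi..pi} (\<lambda>\<theta>. (cmod (g \<theta>))\<^sup>2))"
    if "cper g" for g
    by (intro integral_real_of_complex) (auto simp: complex_norm_square simp del: of_real_power intro!: that cper_intros)
  have fp: "integral {-pi..pi} (\<lambda>\<theta>. f \<theta> * cnj (p \<theta>)) = (\<Sum>n\<in>A. cnj (a n) * fc f n)"
  proof -
    have "integral {-pi..pi} (\<lambda>\<theta>. f \<theta> * cnj (p \<theta>)) = integral {-pi..pi} (\<lambda>\<theta>. \<Sum>n\<in>A. cnj (a n) * (f \<theta> * cis (- (of_int n * \<theta>))))"
      by (rule integral_cong) (simp add: p_def sum_distrib_left cis_cnj algebra_simps)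
    also have "\<dots> = (\<Sum>n\<in>A. integral {-pi..pi} (\<lambda>\<theta>. cnj (a n) * (f \<theta> * cis (- (of_int n * \<theta>)))))"
      by (intro integral_sum A cper_integrable cper_intros f)
    finally show ?thesis by (simp add: fc_def)
  qed
  have pp: "integral {-pi..pi} (\<lambda>\<theta>. p \<theta> * cnj (p \<theta>)) = (\<Sum>n\<in>A. a n * cnj (a n) * (2 * pi))"
  proof -
    have "integral {-pi..pi} (\<lambda>\<theta>. p \<theta> * cnj (p \<theta>)) = 
       integral {-pi..pi} (\<lambda>\<theta>. \<Sum>n\<in>A. \<Sum>m\<in>A. a n * cnj (a m) * cis (of_int (n - m) * \<theta>))"
    proof (rule integral_cong)
      fix \<theta> :: real
      have e: "cis (of_int (n - m) * \<theta>) = cis (of_int n * \<theta>) * cis (- (of_int m * \<theta>))" for n m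
        by (simp add: cis_mult left_diff_distrib)
      show "p \<theta> * cnj (p \<theta>) = (\<Sum>n\<in>A. \<Sum>m\<in>A. a n * cnj (a m) * cis (of_int (n - m) * \<theta>))"
        unfolding p_def e cnj_sum sum_product complex_cnj_mult cis_cnj by (simp only: mult_ac)
    qed
    also have "\<dots> = (\<Sum>n\<in>A. \<Sum>m\<in>A. integral {-pi..pi} (\<lambda>\<theta>. a n * cnj (a m) * cis (of_int (n - m) * \<theta>)))"
      by (subst integral_sum[OF A], (rule sum.cong integral_sum[OF A] refl cper_integrable cper_intros)+)
    also have "\<dots> = (\<Sum>n\<in>A. \<Sum>m\<in>A. a n * cnj (a m) * (if n = m then 2 * pi else 0))"
      by (simp only: integral_mult_right integral_cis) (auto intro!: sum.cong)
    also have "\<dots> = (\<Sum>n\<in>A. a n * cnj (a n) * (2 * pi))"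
      using A by (simp add: if_distrib cong: if_cong)
    finally show ?thesis .
  qed
  have pf: "integral {-pi..pi} (\<lambda>\<theta>. cnj (f \<theta>) * p \<theta>) = (\<Sum>n\<in>A. a n * cnj (fc f n))"
  proof -
    have "integral {-pi..pi} (\<lambda>\<theta>. cnj (f \<theta>) * p \<theta>) = integral {-pi..pi} (\<lambda>\<theta>. cnj (f \<theta> * cnj (p \<theta>)))" by simp
    also have "\<dots> = cnj (integral {-pi..pi} (\<lambda>\<theta>. f \<theta> * cnj (p \<theta>)))"
      by (rule integral_cnj[symmetric])
    finally show ?thesis by (simp add: fp)
  qed
  have "complex_of_real ?L = integral {-pi..pi} (\<lambda>\<theta>. f \<theta> * cnj (f \<theta>) - f \<theta> * cnj (p \<theta>) - cnj (f \<theta>) * p \<theta> + p \<theta> * cnj (p \<theta>))"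
    by (subst c[symmetric]) (auto simp: complex_norm_square algebra_simps simp del: of_real_power intro!: cper_intros f p)
  also have "\<dots> = integral {-pi..pi} (\<lambda>\<theta>. f \<theta> * cnj (f \<theta>)) - integral {-pi..pi} (\<lambda>\<theta>. f \<theta> * cnj (p \<theta>))
       - integral {-pi..pi} (\<lambda>\<theta>. cnj (f \<theta>) * p \<theta>) + integral {-pi..pi} (\<lambda>\<theta>. p \<theta> * cnj (p \<theta>))"
    apply (subst Henstock_Kurzweil_Integration.integral_add)
      apply (intro cper_integrable cper_intros f p)+
    apply (subst Henstock_Kurzweil_Integration.integral_diff)
      apply (intro cper_integrable cper_intros f p)+
    apply (subst Henstock_Kurzweil_Integration.integral_diff)
      apply (intro cper_integrable cper_intros f p)+
    by simp
  also have "integral {-pi..pi} (\<lambda>\<theta>. f \<theta> * cnj (f \<theta>)) = of_real (integral {-pi..pi} (\<lambda>\<theta>. (cmod (f \<theta>))\<^sup>2))"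
    by (subst c[symmetric]) (auto simp: complex_norm_square simp del: of_real_power intro: f)
  finally have "complex_of_real ?L = of_real (integral {-pi..pi} (\<lambda>\<theta>. (cmod (f \<theta>))\<^sup>2)) 
     + (\<Sum>n\<in>A. a n * cnj (a n) * (2 * pi) - cnj (a n) * fc f n - a n * cnj (fc f n))"
    unfolding fp pp pf by (simp add: sum_subtractf)
  \<comment> \<open>Completing the square, separately for each frequency.\<close>
  also have "(\<Sum>n\<in>A. a n * cnj (a n) * (2 * pi) - cnj (a n) * fc f n - a n * cnj (fc f n)) =
     (\<Sum>n\<in>A. complex_of_real (2 * pi * (cmod (a n - fc f n / (2 * pi)))\<^sup>2 - (cmod (fc f n))\<^sup>2 / (2 * pi)))"
    by (rule sum.cong) (auto simp: complex_norm_square field_simps simp del: of_real_power)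
  finally have "complex_of_real ?L = of_real ?R"
    by (simp add: sum_subtractf sum_distrib_left sum_divide_distrib)
  then show ?thesis using of_real_eq_iff by blast
qed

lemma bessel_inequality:
  assumes f: "cper f" and A: "finite A"
  shows "(\<Sum>n\<in>A. (cmod (fc f n))\<^sup>2) \<le> 2 * pi * integral {-pi..pi} (\<lambda>\<theta>. (cmod (f \<theta>))\<^sup>2)"
proof -
  have "0 \<le> integral {-pi..pi} (\<lambda>\<theta>. (cmod (f \<theta> - (\<Sum>n\<in>A. (fc f n / (2 * pi)) * cis (of_int n * \<theta>))))\<^sup>2)"
    by (intro integral_nonneg cper_norm2 cper_intros f) auto
  then show ?thesis unfolding fourier_error[OF f A] by (simp add: field_simps)
qed

section \<open>Trigonometric polynomials, Parseval and uniqueness\<close>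

definition trigpoly :: "(real \<Rightarrow> complex) \<Rightarrow> bool" where
  "trigpoly p \<longleftrightarrow> (\<exists>A a. finite A \<and> p = (\<lambda>\<theta>. \<Sum>n\<in>A. a n * cis (of_int n * \<theta>)))"

lemma trigpoly_cis: "trigpoly (\<lambda>\<theta>. c * cis (of_int n * \<theta>))"
  unfolding trigpoly_def by (intro exI[of _ "{n}"] exI[of _ "\<lambda>_. c"]) auto

lemma trigpoly_const: "trigpoly (\<lambda>\<theta>. c)"
  using trigpoly_cis[of c 0] by simp

lemma trigpoly_add:
  assumes "trigpoly f" "trigpoly g" shows "trigpoly (\<lambda>\<theta>. f \<theta> + g \<theta>)"
proof -
  obtain A a B b where *: "finite A" "f = (\<lambda>\<theta>. \<Sum>n\<in>A. a n * cis (of_int n * \<theta>))"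
    "finite B" "g = (\<lambda>\<theta>. \<Sum>n\<in>B. b n * cis (of_int n * \<theta>))" using assms unfolding trigpoly_def by blast
  define c where "c n = (if n \<in> A then a n else 0) + (if n \<in> B then b n else 0)" for n
  have "f \<theta> + g \<theta> = (\<Sum>n\<in>A \<union> B. c n * cis (of_int n * \<theta>))" for \<theta>
  proof -
    have "(\<Sum>n\<in>A \<union> B. c n * cis (of_int n * \<theta>)) = 
      (\<Sum>n\<in>A \<union> B. (if n \<in> A then a n * cis (of_int n * \<theta>) else 0)) + (\<Sum>n\<in>A \<union> B. (if n \<in> B then b n * cis (of_int n * \<theta>) else 0))"
      unfolding sum.distrib[symmetric] by (rule sum.cong) (auto simp: c_def algebra_simps)
    moreover have "(\<Sum>n\<in>A \<union> B. (if n \<in> A then a n * cis (of_int n * \<theta>) else 0)) = f \<theta>"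
      unfolding * by (intro sum.mono_neutral_cong_right) (use * in auto)
    moreover have "(\<Sum>n\<in>A \<union> B. (if n \<in> B then b n * cis (of_int n * \<theta>) else 0)) = g \<theta>"
      unfolding * by (intro sum.mono_neutral_cong_right) (use * in auto)
    ultimately show ?thesis by simp
  qed
  then show ?thesis unfolding trigpoly_def using *(1,3) by blast
qed

lemma trigpoly_sum: "finite I \<Longrightarrow> (\<And>i. i \<in> I \<Longrightarrow> trigpoly (f i)) \<Longrightarrow> trigpoly (\<lambda>\<theta>. \<Sum>i\<in>I. f i \<theta>)"
  by (induction I rule: finite_induct) (auto intro: trigpoly_add trigpoly_const)

lemma trigpoly_mult:
  assumes "trigpoly f" "trigpoly g" shows "trigpoly (\<lambda>\<theta>. f \<theta> * g \<theta>)"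
proof -
  obtain A a B b where *: "finite A" "f = (\<lambda>\<theta>. \<Sum>n\<in>A. a n * cis (of_int n * \<theta>))"
    "finite B" "g = (\<lambda>\<theta>. \<Sum>n\<in>B. b n * cis (of_int n * \<theta>))" using assms unfolding trigpoly_def by blast
  have "(\<lambda>\<theta>. f \<theta> * g \<theta>) = (\<lambda>\<theta>. \<Sum>n\<in>A. \<Sum>m\<in>B. (a n * b m) * cis (of_int (n + m) * \<theta>))"
    unfolding * by (simp add: sum_product algebra_simps flip: cis_mult)
  then show ?thesis by (simp only:) (intro trigpoly_sum trigpoly_cis *)
qed

lemma trigpoly_cos: "trigpoly (\<lambda>\<theta>. of_real (cos \<theta>))"
proof -
  have "(\<lambda>\<theta>. complex_of_real (cos \<theta>)) = (\<lambda>\<theta>. (1/2) * cis (of_int 1 * \<theta>) + (1/2) * cis (of_int (-1) * \<theta>))"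
    by (auto simp: complex_eq_iff)
  then show ?thesis by (metis trigpoly_add trigpoly_cis)
qed

lemma trigpoly_sin: "trigpoly (\<lambda>\<theta>. of_real (sin \<theta>))"
proof -
  have "(\<lambda>\<theta>. complex_of_real (sin \<theta>)) = (\<lambda>\<theta>. (-\<i>/2) * cis (of_int 1 * \<theta>) + (\<i>/2) * cis (of_int (-1) * \<theta>))"
    by (auto simp: complex_eq_iff)
  then show ?thesis by (metis trigpoly_add trigpoly_cis)
qed

text \<open>These are polynomials in the real coordinates of the plane. On the unit circle the
  coordinates are \<open>cos \<theta>\<close> and \<open>sin \<theta>\<close>, and trigonometric
  polynomials form an algebra.\<close>

lemma trigpoly_real_polynomial:
  assumes "real_polynomial_function p"
  shows "trigpoly (\<lambda>\<theta>. of_real (p (cis \<theta>)))"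
  using assms
proof induction
  case (linear f)
  have "f (cis \<theta>) = cos \<theta> * f 1 + sin \<theta> * f \<i>" for \<theta>
  proof -
    have "cis \<theta> = cos \<theta> *\<^sub>R 1 + sin \<theta> *\<^sub>R \<i>" by (simp add: complex_eq_iff)
    moreover have "f (cos \<theta> *\<^sub>R 1 + sin \<theta> *\<^sub>R \<i>) = cos \<theta> *\<^sub>R f 1 + sin \<theta> *\<^sub>R f \<i>"
      using bounded_linear.linear[OF linear] by (simp only: linear_add linear_scale)
    ultimately show ?thesis by simp
  qed
  then show ?case by (auto intro!: trigpoly_add trigpoly_mult trigpoly_const trigpoly_sin trigpoly_cos)
qed (auto intro: trigpoly_add trigpoly_mult trigpoly_const)

lemma trigpoly_polynomial:
  assumes "polynomial_function (p :: complex \<Rightarrow> complex)"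
  shows "trigpoly (\<lambda>\<theta>. p (cis \<theta>))"
proof -
  have "real_polynomial_function (Re \<circ> p)" "real_polynomial_function (Im \<circ> p)"
    using assms bounded_linear_Re bounded_linear_Im unfolding polynomial_function_def by auto
  note this[THEN trigpoly_real_polynomial]
  then have "trigpoly (\<lambda>\<theta>. of_real (Re (p (cis \<theta>))) + \<i> * of_real (Im (p (cis \<theta>))))"
    by (auto intro!: trigpoly_add trigpoly_mult trigpoly_const)
  then show ?thesis by (simp flip: complex_eq)
qed

text \<open>Stone-Weierstrass on the unit circle: carry \<open>f\<close> over to the circle,
  approximate it by a polynomial, and compose with \<open>cis\<close>.\<close>

lemma trigpoly_approx:
  assumes f: "cper f" and e: "e > 0"
  shows "\<exists>p. trigpoly p \<and> (\<forall>\<theta>\<in>{-pi..pi}. cmod (f \<theta> - p \<theta>) < e)"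
proof -
  \<comment> \<open>\<open>g\<close> is \<open>f\<close> composed with the angle, taken as
    \<open>arccos (Re z)\<close> on the closed upper half circle and its negative below. The pieces
    agree at 1, where both angles are 0, and at -1 because \<open>f (-pi) = f pi\<close>.\<close>
  define g where "g z = (if 0 \<le> Im z then f (arccos (Re z)) else f (- arccos (Re z)))" for z
  define S where "S = {z \<in> sphere (0::complex) 1. 0 \<le> Im z}"
  define T where "T = {z \<in> sphere (0::complex) 1. Im z \<le> 0}"
  have cl: "closed S" "closed T" unfolding S_def T_def
    by (auto intro!: closed_Collect_conj closed_Collect_le closed_Collect_eq continuous_intros)
  have re: "\<bar>Re z\<bar> \<le> 1" if "z \<in> sphere 0 1" for z using abs_Re_le_cmod[of z] that by simp
  have re1: "Re z = 1 \<or> Re z = -1" if "z \<in> sphere 0 1" "Im z = 0" for z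
    using that by (auto simp: cmod_def)
  have ST: "S \<union> T = sphere 0 1" by (auto simp: S_def T_def)
  have fc: "continuous_on UNIV f" and fper: "\<And>\<theta>. f (\<theta> + 2 * pi) = f \<theta>" using f by (auto simp: cper_def)
  have "f (-pi + 2*pi) = f (-pi)" by (rule fper)
  then have fpi: "f (-pi) = f pi" by simp
  have cg: "continuous_on (S \<union> T) (\<lambda>z. if 0 \<le> Im z then f (arccos (Re z)) else f (- arccos (Re z)))"
  proof (rule continuous_on_cases[OF cl])
    show "continuous_on S (\<lambda>z. f (arccos (Re z)))" 
      by (intro continuous_on_compose2[OF fc] continuous_intros) (use re in \<open>force simp: S_def abs_le_iff\<close>)+
    show "continuous_on T (\<lambda>z. f (- arccos (Re z)))" 
      by (intro continuous_on_compose2[OF fc] continuous_intros) (use re in \<open>force simp: T_def abs_le_iff\<close>)+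
    show "\<forall>z. z \<in> S \<and> \<not> 0 \<le> Im z \<or> z \<in> T \<and> 0 \<le> Im z \<longrightarrow> f (arccos (Re z)) = f (- arccos (Re z))"
    proof (intro allI impI)
      fix z assume "z \<in> S \<and> \<not> 0 \<le> Im z \<or> z \<in> T \<and> 0 \<le> Im z"
      then have "z \<in> sphere 0 1" "Im z = 0" by (auto simp: S_def T_def)
      then show "f (arccos (Re z)) = f (- arccos (Re z))" using re1[of z] fpi by auto
    qed
  qed
  then have "continuous_on (sphere 0 1) g" unfolding g_def ST .
  then obtain p where p: "polynomial_function p" "\<And>z. z \<in> sphere 0 1 \<Longrightarrow> cmod (g z - p z) < e"
    using Stone_Weierstrass_polynomial_function[OF compact_sphere _ e] by metis
  have "g (cis \<theta>) = f \<theta>" if \<theta>: "\<theta> \<in> {-pi..pi}" for \<theta>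
  proof (cases "0 \<le> \<theta>")
    case True
    then show ?thesis using \<theta> sin_ge_zero[of \<theta>] by (auto simp: g_def arccos_cos)
  next
    case False
    then have a: "arccos (cos \<theta>) = - \<theta>" using arccos_cos[of "-\<theta>"] \<theta> by simp
    show ?thesis
    proof (cases "\<theta> = -pi")
      case True
      then show ?thesis using fpi by (auto simp: g_def)
    next
      case F2: False
      then have "sin \<theta> < 0" using sin_gt_zero[of "-\<theta>"] \<theta> False by auto
      then show ?thesis by (auto simp: g_def a)
    qed
  qed
  then have "cmod (f \<theta> - p (cis \<theta>)) < e" if "\<theta> \<in> {-pi..pi}" for \<theta>
    using p(2)[of "cis \<theta>"] that by simp
  then show ?thesis using trigpoly_polynomial[OF p(1)] by blast
qed

text \<open>Approximate \<open>f\<close> uniformly by a trigonometric polynomial with frequencies in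
  \<open>A\<close>. By \<open>fourier_error\<close> its mean-square error is at least that of the
  Fourier sum over \<open>A\<close>, so the norm of \<open>f\<close> is controlled by finitely many
  coefficients; any finite \<open>A\<close> lies in some \<open>{-int N..int N}\<close>.\<close>

lemma parseval_le:
  assumes f: "cper f" and C: "\<And>N::nat. (\<Sum>n\<in>{-int N..int N}. (cmod (fc f n))\<^sup>2) \<le> C"
  shows "2 * pi * integral {-pi..pi} (\<lambda>\<theta>. (cmod (f \<theta>))\<^sup>2) \<le> C"
proof (rule field_le_epsilon)
  fix e :: real assume "e > 0"
  \<comment> \<open>Chosen so that \<open>2 * pi * (2 * pi * d\<^sup>2) = e\<close>.\<close>
  define d where "d = sqrt e / (2 * pi)"
  have d: "d > 0" using \<open>e > 0\<close> by (simp add: d_def)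
  obtain A a where A: "finite A" and p: "\<And>\<theta>. \<theta> \<in> {-pi..pi} \<Longrightarrow> cmod (f \<theta> - (\<Sum>n\<in>A. a n * cis (of_int n * \<theta>))) < d"
    using trigpoly_approx[OF f d] unfolding trigpoly_def by blast
  have "integral {-pi..pi} (\<lambda>\<theta>. (cmod (f \<theta> - (\<Sum>n\<in>A. a n * cis (of_int n * \<theta>))))\<^sup>2) \<le> integral {-pi..pi} (\<lambda>\<theta>. d\<^sup>2)"
    by (intro integral_le cper_norm2 power_mono) (auto intro!: f cper_intros less_imp_le p)
  also have "\<dots> = 2 * pi * d\<^sup>2" by simp
  finally have "integral {-pi..pi} (\<lambda>\<theta>. (cmod (f \<theta>))\<^sup>2) - (\<Sum>n\<in>A. (cmod (fc f n))\<^sup>2) / (2*pi)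
       + 2 * pi * (\<Sum>n\<in>A. (cmod (a n - fc f n / (2 * pi)))\<^sup>2) \<le> 2 * pi * d\<^sup>2"
    unfolding fourier_error[OF f A] .
  moreover have "0 \<le> 2 * pi * (\<Sum>n\<in>A. (cmod (a n - fc f n / (2 * pi)))\<^sup>2)" by (intro mult_nonneg_nonneg sum_nonneg) auto
  moreover have "(\<Sum>n\<in>A. (cmod (fc f n))\<^sup>2) \<le> C"
  proof -
    define N where "N = nat (Max (insert 0 (abs ` A)))"
    have "A \<subseteq> {-int N..int N}"
    proof
      fix n assume "n \<in> A"
      then have "\<bar>n\<bar> \<le> Max (insert 0 (abs ` A))" using A by (intro Max_ge) auto
      then show "n \<in> {-int N..int N}" by (auto simp: N_def)
    qed
    then have "(\<Sum>n\<in>A. (cmod (fc f n))\<^sup>2) \<le> (\<Sum>n\<in>{-int N..int N}. (cmod (fc f n))\<^sup>2)" by (intro sum_mono2) auto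
    then show ?thesis using C[of N] by simp
  qed
  moreover have "2 * pi * (2 * pi * d\<^sup>2) = e" using \<open>e > 0\<close> by (simp add: d_def power2_eq_square field_simps)
  ultimately have X: "integral {-pi..pi} (\<lambda>\<theta>. (cmod (f \<theta>))\<^sup>2) \<le> (\<Sum>n\<in>A. (cmod (fc f n))\<^sup>2) / (2*pi) + 2 * pi * d\<^sup>2"
    and Y: "(\<Sum>n\<in>A. (cmod (fc f n))\<^sup>2) \<le> C" and e: "2 * pi * (2 * pi * d\<^sup>2) = e" by linarith+
  have "2 * pi * integral {-pi..pi} (\<lambda>\<theta>. (cmod (f \<theta>))\<^sup>2) \<le> 2 * pi * ((\<Sum>n\<in>A. (cmod (fc f n))\<^sup>2) / (2*pi) + 2 * pi * d\<^sup>2)"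
    by (intro mult_left_mono X) auto
  also have "\<dots> = (\<Sum>n\<in>A. (cmod (fc f n))\<^sup>2) + 2 * pi * (2 * pi * d\<^sup>2)" by (simp add: distrib_left)
  also have "\<dots> \<le> C + e" using Y e by simp
  finally show "2 * pi * integral {-pi..pi} (\<lambda>\<theta>. (cmod (f \<theta>))\<^sup>2) \<le> C + e" .
qed

lemma cper_zero_UNIV:
  assumes "cper f" "\<And>\<theta>. \<theta> \<in> {-pi..pi} \<Longrightarrow> f \<theta> = 0"
  shows "f \<theta> = 0"
proof -
  obtain n where n: "-pi \<le> \<theta> - 2 * pi * of_int n" "\<theta> - 2 * pi * of_int n \<le> pi"
  proof
    define k where "k = \<lfloor>(\<theta> + pi) / (2 * pi)\<rfloor>"
    have "of_int k \<le> (\<theta> + pi) / (2 * pi)" "(\<theta> + pi) / (2 * pi) < of_int k + 1" unfolding k_def by linarith+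
    then have "of_int k * (2 * pi) \<le> \<theta> + pi" "\<theta> + pi < (of_int k + 1) * (2 * pi)"
      using pi_gt_zero by (simp_all add: pos_le_divide_eq pos_divide_less_eq del: pi_gt_zero)
    then show "-pi \<le> \<theta> - 2 * pi * of_int k" "\<theta> - 2 * pi * of_int k \<le> pi"
      by (simp_all add: algebra_simps)
  qed
  have P: "f (x + 2 * pi * of_int k) = f x" for x k
  proof (induction k rule: int_induct[where k=0])
    case (step1 i)
    have "f (x + 2 * pi * of_int i + 2 * pi) = f (x + 2 * pi * of_int i)" using assms(1) unfolding cper_def by blast
    then show ?case using step1 by (simp add: algebra_simps)
  next
    case (step2 i)
    have "f (x + 2 * pi * of_int (i - 1) + 2 * pi) = f (x + 2 * pi * of_int (i - 1))" using assms(1) unfolding cper_def by blast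
    then show ?case using step2 by (simp add: algebra_simps)
  qed auto
  have "f \<theta> = f (\<theta> - 2 * pi * of_int n)" using P[of "\<theta> - 2 * pi * of_int n" n] by simp
  then show ?thesis using assms(2) n by simp
qed

lemma integral_norm2_zero:
  assumes f: "cper f" and "integral {-pi..pi} (\<lambda>\<theta>. (cmod (f \<theta>))\<^sup>2) \<le> 0"
  shows "f \<theta> = 0"
proof (rule cper_zero_UNIV[OF f])
  fix x assume x: "x \<in> {-pi..pi}"
  have "integral {-pi..pi} (\<lambda>\<theta>. (cmod (f \<theta>))\<^sup>2) = 0"
    using assms(2) integral_nonneg[OF cper_norm2[OF f], of "-pi" pi] by (simp add: order_antisym)
  then have "\<forall>x\<in>cbox (-pi) pi. (cmod (f x))\<^sup>2 = 0"
    by (subst (asm) integral_eq_0_iff) (auto intro!: continuous_intros cper_cont f)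
  then show "f x = 0" using x by auto
qed

lemma fc_all_zero:
  assumes f: "cper f" and "\<And>n. fc f n = 0"
  shows "f \<theta> = 0"
proof (rule integral_norm2_zero[OF f])
  have "2 * pi * integral {-pi..pi} (\<lambda>\<theta>. (cmod (f \<theta>))\<^sup>2) \<le> 0"
    by (rule parseval_le[OF f]) (simp add: assms(2))
  then show "integral {-pi..pi} (\<lambda>\<theta>. (cmod (f \<theta>))\<^sup>2) \<le> 0"
    using pi_gt_zero by (simp add: mult_le_0_iff del: pi_gt_zero)
qed

section \<open>Oscillating Fourier coefficients\<close>

definition C1per :: "(real \<Rightarrow> complex) \<Rightarrow> (real \<Rightarrow> complex) \<Rightarrow> bool" where
  "C1per g g' \<longleftrightarrow> cper g \<and> cper g' \<and> (\<forall>x. (g has_vector_derivative g' x) (at x))"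

lemma C1perD: "C1per g g' \<Longrightarrow> cper g" "C1per g g' \<Longrightarrow> cper g'"
  "C1per g g' \<Longrightarrow> (g has_vector_derivative g' x) (at x)"
  by (auto simp: C1per_def)

lemma C1per_const: "C1per (\<lambda>_. c) (\<lambda>_. 0)"
  by (auto simp: C1per_def intro: cper_intros)

lemma C1per_add: "C1per f f' \<Longrightarrow> C1per g g' \<Longrightarrow> C1per (\<lambda>x. f x + g x) (\<lambda>x. f' x + g' x)"
  by (auto simp: C1per_def intro!: cper_intros derivative_intros)

lemma C1per_mult: "C1per f f' \<Longrightarrow> C1per g g' \<Longrightarrow> C1per (\<lambda>x. f x * g x) (\<lambda>x. f x * g' x + f' x * g x)"
  by (auto simp: C1per_def intro!: cper_intros derivative_intros)

lemma C1per_sin: "C1per (\<lambda>x. of_real (sin x)) (\<lambda>x. of_real (cos x))"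
  by (auto simp: C1per_def intro!: cper_intros derivative_eq_intros)

lemma C1per_cis: "C1per (\<lambda>x. cis (of_int n * x)) (\<lambda>x. \<i> * of_int n * cis (of_int n * x))"
  unfolding C1per_def
  by (auto simp: has_vector_derivative_def scaleR_conv_of_real intro!: cper_intros derivative_eq_intros ext)

lemma C1per_cis_minus: "C1per (\<lambda>x. cis (- (of_int n * x))) (\<lambda>x. - \<i> * of_int n * cis (- (of_int n * x)))"
  using C1per_cis[of "-n"] by simp

lemma C1per_cis_cos: "C1per (\<lambda>x. cis (z * cos x)) (\<lambda>x. - \<i> * of_real z * of_real (sin x) * cis (z * cos x))"
  unfolding C1per_def
  by (auto simp: has_vector_derivative_def scaleR_conv_of_real intro!: cper_intros derivative_eq_intros ext)

text \<open>The product of \<open>g\<close> with the exponential takes equal values at -pi and pi,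
  so its derivative integrates to zero.\<close>

lemma fc_deriv:
  assumes "C1per g g'"
  shows "fc g' n = \<i> * of_int n * fc g n"
proof -
  note g = C1perD[OF assms]
  let ?e = "\<lambda>x. cis (- (of_int n * x))"
  have "C1per (\<lambda>x. g x * ?e x) (\<lambda>x. g x * (- \<i> * of_int n * ?e x) + g' x * ?e x)" (is "C1per ?h ?h'")
    by (intro C1per_mult assms C1per_cis_minus)
  note h = C1perD[OF this]
  have "(?h' has_integral ?h pi - ?h (-pi)) {-pi..pi}"
    by (intro fundamental_theorem_of_calculus has_vector_derivative_at_within[OF h(3)]) auto
  moreover have "?h (-pi + 2 * pi) = ?h (-pi)" using h(1) unfolding cper_def by blast
  ultimately have "integral {-pi..pi} ?h' = 0" by (simp add: integral_unique)
  also have "integral {-pi..pi} ?h' = integral {-pi..pi} (\<lambda>x. (- \<i> * of_int n) * (g x * ?e x)) + integral {-pi..pi} (\<lambda>x. g' x * ?e x)"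
    by (subst Henstock_Kurzweil_Integration.integral_add[symmetric])
      (auto intro!: cper_integrable cper_intros g integral_cong)
  also have "\<dots> = - \<i> * of_int n * fc g n + fc g' n"
    unfolding integral_mult_right fc_def ..
  finally show ?thesis by (simp add: algebra_simps)
qed

text \<open>These become the numbers \<open>c\<^sub>n\<close> once \<open>x0\<close> is rotated onto
  the positive first axis; then \<open>l\<close> is the wave number times
  \<open>norm x0\<close>.\<close>

definition osc_fc :: "real \<Rightarrow> (real \<Rightarrow> complex) \<Rightarrow> int \<Rightarrow> complex" where
  "osc_fc l g n = fc (\<lambda>\<theta>. g \<theta> * cis (l * cos \<theta>)) n"

lemma osc_fc_add: "cper g \<Longrightarrow> cper h \<Longrightarrow> osc_fc l (\<lambda>x. g x + h x) n = osc_fc l g n + osc_fc l h n"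
  unfolding osc_fc_def ring_distribs by (intro fc_add cper_intros)

lemma osc_fc_cmult: "osc_fc l (\<lambda>x. c * g x) n = c * osc_fc l g n"
  unfolding osc_fc_def mult.assoc by (rule fc_cmult)

lemma osc_fc_cis: "osc_fc l (\<lambda>x. g x * cis (- (of_int m * x))) n = osc_fc l g (n + m)"
  unfolding osc_fc_def fc_cis[symmetric] by (simp add: mult_ac)

text \<open>\<open>fc_deriv\<close> for the product of \<open>g\<close> and the phase;
  differentiating the phase produces the factor \<open>sin x\<close>. Read as a formula for the
  \<open>sin\<close> term, this says that multiplication by \<open>sin\<close> acts as
  \<open>-n / l\<close> up to \<open>g'\<close> divided by \<open>l\<close>.\<close>

lemma osc_fc_deriv:
  assumes "C1per g g'"
  shows "osc_fc l g' n - \<i> * of_real l * osc_fc l (\<lambda>x. of_real (sin x) * g x) n = \<i> * of_int n * osc_fc l g n"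
proof -
  note g = C1perD[OF assms]
  have "fc (\<lambda>x. g x * (- \<i> * of_real l * of_real (sin x) * cis (l * cos x)) + g' x * cis (l * cos x)) n = \<i> * of_int n * osc_fc l g n"
    unfolding osc_fc_def by (intro fc_deriv C1per_mult assms C1per_cis_cos)
  also have "(\<lambda>x. g x * (- \<i> * of_real l * of_real (sin x) * cis (l * cos x)) + g' x * cis (l * cos x)) =
     (\<lambda>x. (g' x + (- \<i> * of_real l) * (of_real (sin x) * g x)) * cis (l * cos x))"
    by (auto simp: algebra_simps)
  finally show ?thesis
    using osc_fc_add[of g' "\<lambda>x. (- \<i> * of_real l) * (of_real (sin x) * g x)" l n]
    unfolding osc_fc_cmult osc_fc_def[symmetric] using g(1,2) by (simp add: cper_intros)
qed

lemma osc_fc_bessel: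
  assumes "cper g" "finite A"
  shows "(\<Sum>n\<in>A. (cmod (osc_fc l g n))\<^sup>2) \<le> 2 * pi * integral {-pi..pi} (\<lambda>x. (cmod (g x))\<^sup>2)"
  using bessel_inequality[of "\<lambda>x. g x * cis (l * cos x)" A] assms
  by (simp add: osc_fc_def[symmetric] norm_mult cper_intros)

lemma osc_fc_parseval_le:
  assumes "cper g" "\<And>N::nat. (\<Sum>n\<in>{-int N..int N}. (cmod (osc_fc l g n))\<^sup>2) \<le> C"
  shows "2 * pi * integral {-pi..pi} (\<lambda>x. (cmod (g x))\<^sup>2) \<le> C"
  using parseval_le[of "\<lambda>x. g x * cis (l * cos x)" C] assms
  by (simp add: osc_fc_def[symmetric] norm_mult cper_intros)

section \<open>Coefficients of order \<open>1 / l\<close> on sets of indices\<close>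

lemma norm_add_squared_le: "(cmod (x + y))\<^sup>2 \<le> 2 * (cmod x)\<^sup>2 + 2 * (cmod y)\<^sup>2"
proof -
  have "(cmod (x + y))\<^sup>2 \<le> (cmod x + cmod y)\<^sup>2" by (intro power_mono norm_triangle_ineq) auto
  also have "\<dots> \<le> 2 * (cmod x)\<^sup>2 + 2 * (cmod y)\<^sup>2"
    using sum_squares_bound[of "cmod x" "cmod y"] by (simp add: power2_sum)
  finally show ?thesis .
qed

text \<open>The index set may vary with \<open>l\<close>, since the zeros of the coefficients do,
  but \<open>C\<close> is uniform in \<open>l\<close>. Differentiability is part of the notion so
  that multiplication by \<open>sin\<close> can be iterated.\<close>

definition negl :: "(real \<Rightarrow> int set) \<Rightarrow> (real \<Rightarrow> complex) \<Rightarrow> bool" where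
  "negl S g \<longleftrightarrow> (\<exists>g'. C1per g g') \<and> (\<exists>C. \<forall>l\<ge>1. (\<Sum>n\<in>S l. (cmod (osc_fc l g n))\<^sup>2) \<le> C / l\<^sup>2)"

lemma negl_C1per: "negl S g \<Longrightarrow> \<exists>g'. C1per g g'"
  by (simp add: negl_def)

lemma negl_cper: "negl S g \<Longrightarrow> cper g"
  using negl_C1per C1perD by blast

lemma negl_add:
  assumes "negl S g" "negl S h"
  shows "negl S (\<lambda>x. g x + h x)"
proof -
  obtain C D where C: "\<And>l. l \<ge> 1 \<Longrightarrow> (\<Sum>n\<in>S l. (cmod (osc_fc l g n))\<^sup>2) \<le> C / l\<^sup>2"
    and D: "\<And>l. l \<ge> 1 \<Longrightarrow> (\<Sum>n\<in>S l. (cmod (osc_fc l h n))\<^sup>2) \<le> D / l\<^sup>2"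
    using assms unfolding negl_def by blast
  have "(\<Sum>n\<in>S l. (cmod (osc_fc l (\<lambda>x. g x + h x) n))\<^sup>2) \<le> (2 * C + 2 * D) / l\<^sup>2" if "l \<ge> 1" for l
  proof -
    have "(\<Sum>n\<in>S l. (cmod (osc_fc l (\<lambda>x. g x + h x) n))\<^sup>2) \<le> (\<Sum>n\<in>S l. 2 * (cmod (osc_fc l g n))\<^sup>2 + 2 * (cmod (osc_fc l h n))\<^sup>2)"
      by (intro sum_mono) (simp add: osc_fc_add negl_cper[OF assms(1)] negl_cper[OF assms(2)] norm_add_squared_le)
    also have "\<dots> \<le> 2 * (C / l\<^sup>2) + 2 * (D / l\<^sup>2)"
      unfolding sum.distrib sum_distrib_left[symmetric] by (intro add_mono mult_left_mono C D that) auto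
    finally show ?thesis by (simp add: add_divide_distrib)
  qed
  moreover have "\<exists>g'. C1per (\<lambda>x. g x + h x) g'" using assms[THEN negl_C1per] C1per_add by blast
  ultimately show ?thesis unfolding negl_def by blast
qed

lemma negl_cmult:
  assumes "negl S g"
  shows "negl S (\<lambda>x. c * g x)"
proof -
  obtain C where C: "\<And>l. l \<ge> 1 \<Longrightarrow> (\<Sum>n\<in>S l. (cmod (osc_fc l g n))\<^sup>2) \<le> C / l\<^sup>2"
    using assms unfolding negl_def by blast
  have "(\<Sum>n\<in>S l. (cmod (osc_fc l (\<lambda>x. c * g x) n))\<^sup>2) \<le> ((cmod c)\<^sup>2 * C) / l\<^sup>2" if "l \<ge> 1" for l
    using mult_left_mono[OF C[OF that], of "(cmod c)\<^sup>2"]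
    by (simp add: osc_fc_cmult norm_mult power_mult_distrib sum_distrib_left)
  moreover have "\<exists>g'. C1per (\<lambda>x. c * g x) g'" using negl_C1per[OF assms] C1per_mult C1per_const by blast
  ultimately show ?thesis unfolding negl_def by blast
qed

text \<open>By \<open>osc_fc_deriv\<close> the new coefficient is \<open>-n / l\<close> times the
  old one plus \<open>- \<i> / l\<close> times that of \<open>g'\<close>. The first factor is at
  most \<open>L\<close> in modulus on \<open>S l\<close>, and Bessel's inequality bounds the second
  contribution.\<close>

lemma negl_sin:
  assumes "negl S g" and fin: "\<And>l. finite (S l)" and bd: "\<And>l n. n \<in> S l \<Longrightarrow> \<bar>of_int n\<bar> \<le> L * l"
  shows "negl S (\<lambda>x. of_real (sin x) * g x)"
proof -
  obtain C g' where C: "\<And>l. l \<ge> 1 \<Longrightarrow> (\<Sum>n\<in>S l. (cmod (osc_fc l g n))\<^sup>2) \<le> C / l\<^sup>2"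
    and g': "C1per g g'"
    using assms unfolding negl_def by blast
  define K where "K = 2 * pi * integral {-pi..pi} (\<lambda>x. (cmod (g' x))\<^sup>2)"
  have "(\<Sum>n\<in>S l. (cmod (osc_fc l (\<lambda>x. of_real (sin x) * g x) n))\<^sup>2) \<le> (2 * L\<^sup>2 * C + 2 * K) / l\<^sup>2" if l: "l \<ge> 1" for l
  proof -
    have "(cmod (osc_fc l (\<lambda>x. of_real (sin x) * g x) n))\<^sup>2 \<le> 2 * L\<^sup>2 * (cmod (osc_fc l g n))\<^sup>2 + 2 / l\<^sup>2 * (cmod (osc_fc l g' n))\<^sup>2" if n: "n \<in> S l" for n
    proof -
      have "osc_fc l (\<lambda>x. of_real (sin x) * g x) n = of_real (- of_int n / l) * osc_fc l g n + (- \<i> / l) * osc_fc l g' n"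
      proof -
        have "of_real l * osc_fc l (\<lambda>x. of_real (sin x) * g x) n = \<i> * (osc_fc l g' n - \<i> * of_real l * osc_fc l (\<lambda>x. of_real (sin x) * g x) n) - \<i> * osc_fc l g' n"
          by (simp add: algebra_simps)
        also have "\<dots> = - of_int n * osc_fc l g n - \<i> * osc_fc l g' n" unfolding osc_fc_deriv[OF g'] by (simp flip: mult.assoc)
        finally have h: "of_real l * osc_fc l (\<lambda>x. of_real (sin x) * g x) n = - of_int n * osc_fc l g n - \<i> * osc_fc l g' n" .
        have "osc_fc l (\<lambda>x. of_real (sin x) * g x) n = (of_real l * osc_fc l (\<lambda>x. of_real (sin x) * g x) n) / of_real l"
          using l by simp
        then show ?thesis unfolding h by (simp add: diff_divide_distrib)
      qed
      then have "(cmod (osc_fc l (\<lambda>x. of_real (sin x) * g x) n))\<^sup>2 \<le> 2 * (cmod (of_real (- of_int n / l) * osc_fc l g n))\<^sup>2 + 2 * (cmod ((- \<i> / l) * osc_fc l g' n))\<^sup>2"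
        by (metis norm_add_squared_le)
      also have "(cmod (of_real (- of_int n / l) * osc_fc l g n))\<^sup>2 \<le> L\<^sup>2 * (cmod (osc_fc l g n))\<^sup>2"
      proof -
        have "\<bar>of_int n\<bar> / l \<le> L" using bd[OF n] l by (simp add: field_simps)
        then have "(\<bar>of_int n\<bar> / l)\<^sup>2 \<le> L\<^sup>2" using l by (intro power_mono) auto
        then have "(\<bar>of_int n\<bar> / l)\<^sup>2 * (cmod (osc_fc l g n))\<^sup>2 \<le> L\<^sup>2 * (cmod (osc_fc l g n))\<^sup>2"
          by (rule mult_right_mono) simp
        then show ?thesis by (simp add: norm_mult norm_divide power_mult_distrib power_divide)
      qed
      also have "(cmod ((- \<i> / l) * osc_fc l g' n))\<^sup>2 = 1 / l\<^sup>2 * (cmod (osc_fc l g' n))\<^sup>2"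
        by (simp add: norm_mult norm_divide power_mult_distrib power_divide)
      finally show ?thesis by simp
    qed
    then have "(\<Sum>n\<in>S l. (cmod (osc_fc l (\<lambda>x. of_real (sin x) * g x) n))\<^sup>2) \<le> (\<Sum>n\<in>S l. 2 * L\<^sup>2 * (cmod (osc_fc l g n))\<^sup>2 + 2 / l\<^sup>2 * (cmod (osc_fc l g' n))\<^sup>2)"
      by (intro sum_mono)
    also have "\<dots> \<le> 2 * L\<^sup>2 * (C / l\<^sup>2) + 2 / l\<^sup>2 * K"
      unfolding sum.distrib sum_distrib_left[symmetric] K_def
      by (intro add_mono mult_left_mono C l osc_fc_bessel C1perD[OF g'] fin) auto
    finally show ?thesis by (simp add: add_divide_distrib)
  qed
  moreover have "\<exists>h. C1per (\<lambda>x. of_real (sin x) * g x) h" using C1per_mult C1per_sin g' by blast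
  ultimately show ?thesis unfolding negl_def by blast
qed

text \<open>These express the powers of \<open>cis (-x)\<close>, a root of \<open>t\<^sup>2 + 2 \<i> (sin x) t - 1\<close>, as linear polynomials in \<open>cis (-x)\<close>.\<close>

fun cis_poly :: "nat \<Rightarrow> real \<Rightarrow> complex" where
  "cis_poly 0 x = 0"
| "cis_poly (Suc 0) x = 1"
| "cis_poly (Suc (Suc m)) x = cis_poly m x - 2 * \<i> * of_real (sin x) * cis_poly (Suc m) x"

lemma cis_sub: "cis (- x) - cis x = - 2 * \<i> * of_real (sin x)"
  by (simp add: complex_eq_iff)

lemma cis_eq_cis_poly: "cis (- (of_nat (Suc m) * x)) = cis_poly (Suc m) x * cis (- x) + cis_poly m x"
proof (induction m)
  case (Suc m)
  have "cis (- (of_nat (Suc (Suc m)) * x)) = cis (- (of_nat (Suc m) * x)) * cis (- x)"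
    by (simp add: cis_mult ring_distribs add_ac)
  also have "\<dots> = cis_poly (Suc m) x * (cis (- x) * cis (- x)) + cis_poly m x * cis (- x)"
    unfolding Suc by (simp add: algebra_simps)
  also have "cis (- x) * cis (- x) = (cis (- x) - cis x) * cis (- x) + 1"
    by (simp add: left_diff_distrib cis_mult)
  finally show ?case unfolding cis_sub by (simp add: algebra_simps)
qed auto

text \<open>The roots of the quadratic are \<open>t = cis (- x)\<close> and \<open>- cis x\<close>,
  so \<open>cis_poly m x\<close> is the difference of their \<open>m\<close>-th powers divided by
  the difference of the roots. A zero makes the powers equal, and squaring removes the sign.\<close>

lemma cis_poly_zero:
  assumes "cis_poly m x = 0" "m > 0"
  shows "cis (4 * of_nat m * x) = 1"
proof -
  \<comment> \<open>Multiplying by the difference of the roots, which is \<open>2 * cos x\<close>,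
    keeps the formula valid where the two roots coincide.\<close>
  have *: "cis_poly m x * (cis (- x) + cis x) = cis (- (of_nat m * x)) - (-1) ^ m * cis (of_nat m * x)" for m
  proof (induction m rule: less_induct)
    case (less m)
    show ?case
    proof (cases "m < 2")
      case True
      then have "m = 0 \<or> m = 1" by auto
      then show ?thesis by auto
    next
      case False
      then obtain k where k: "m = Suc (Suc k)" by (metis add_2_eq_Suc le_Suc_ex not_less)
      have "cis_poly m x * (cis (- x) + cis x) = cis_poly k x * (cis (- x) + cis x) + (cis (- x) - cis x) * (cis_poly (Suc k) x * (cis (- x) + cis x))"
        unfolding cis_sub by (simp add: k algebra_simps)
      also have "\<dots> = cis (- (of_nat m * x)) - (-1) ^ m * cis (of_nat m * x)"
      proof -
        define u v c where "u = cis (- (of_nat k * x))" and "v = cis (of_nat k * x)" and "c = ((-1) ^ k :: complex)"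
        define s where "s = cis x"
        define t where "t = cis (- x)"
        have st: "s * t = 1" by (simp add: s_def t_def cis_mult)
        have e: "cis (- (of_nat (Suc k) * x)) = u * t" "cis (of_nat (Suc k) * x) = v * s"
          "cis (- (of_nat m * x)) = u * t * t" "cis (of_nat m * x) = v * s * s"
          by (auto simp: u_def v_def s_def t_def cis_mult k algebra_simps intro!: arg_cong[where f = cis])
        have p: "(-1) ^ Suc k = - c" "(-1) ^ m = c" by (simp_all add: k c_def)
        have "cis_poly k x * (t + s) + (t - s) * (cis_poly (Suc k) x * (t + s)) = (u - c * v) + (t - s) * (u * t - (- c) * (v * s))"
          using less[of k] less[of "Suc k"] unfolding e p by (simp add: k u_def v_def c_def s_def t_def)
        also have "\<dots> = u * t * t - c * (v * s * s)" using st by algebra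
        finally show ?thesis unfolding e p by (simp add: s_def t_def)
      qed
      finally show ?thesis .
    qed
  qed
  have e: "cis (- (of_nat m * x)) = (-1) ^ m * cis (of_nat m * x)" using *[of m] assms by simp
  have "cis (2 * of_nat m * x) * (cis (- (of_nat m * x)))\<^sup>2 = 1"
    by (simp add: power2_eq_square cis_mult)
  moreover have "((-1) ^ m * cis (of_nat m * x))\<^sup>2 = cis (2 * of_nat m * x)"
    by (simp add: power2_eq_square cis_mult algebra_simps)
  ultimately have "cis (2 * of_nat m * x) * cis (2 * of_nat m * x) = 1" unfolding e by simp
  then show ?thesis by (simp add: cis_mult mult_ac)
qed

lemma negl_cis_poly:
  assumes "negl S g" and fin: "\<And>l. finite (S l)" and bd: "\<And>l n. n \<in> S l \<Longrightarrow> \<bar>of_int n\<bar> \<le> L * l"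
  shows "negl S (\<lambda>x. cis_poly m x * g x)"
proof (induction m rule: less_induct)
  case (less m)
  have "m = 0 \<or> m = 1 \<or> (\<exists>k. m = Suc (Suc k))" by (cases m; cases "m - 1") auto
  then consider "m = 0" | "m = 1" | k where "m = Suc (Suc k)" by auto
  then show ?case
  proof cases
    case 1
    then show ?thesis using negl_cmult[OF assms(1), of 0] by simp
  next
    case 2
    then show ?thesis using assms by simp
  next
    case 3
    then have "negl S (\<lambda>x. cis_poly k x * g x + (- 2 * \<i>) * (of_real (sin x) * (cis_poly (Suc k) x * g x)))"
      by (intro negl_add negl_cmult negl_sin[where L = L] less fin bd) (auto simp: 3)
    then show ?thesis by (simp add: 3 algebra_simps)
  qed
qed

lemma negl_prod_cis_poly:
  assumes "negl S g" and fin: "\<And>l. finite (S l)" and bd: "\<And>l n. n \<in> S l \<Longrightarrow> \<bar>of_int n\<bar> \<le> L * l"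
    and A: "finite A"
  shows "negl S (\<lambda>x. (\<Prod>m\<in>A. cis_poly m x) * g x)"
  using A by (induction A) (auto simp: mult.assoc assms intro!: negl_cis_poly[where L = L] fin bd)

text \<open>The multiplier \<open>W\<close>. Among six consecutive indices there is always a zero,
  so neighbouring zeros are between 1 and 6 apart; one factor per distance makes a single
  \<open>W\<close> serve all of them.\<close>

definition cis_poly_prod :: "real \<Rightarrow> complex" where
  "cis_poly_prod x = (\<Prod>m\<in>{1..6}. cis_poly m x)"

lemma cis_poly_prod_zero: "cis_poly_prod x = 0 \<Longrightarrow> cis (240 * x) = 1"
proof -
  assume "cis_poly_prod x = 0"
  then obtain m where m: "m \<in> {1..6::nat}" "cis_poly m x = 0" by (auto simp: cis_poly_prod_def)
  then have c: "cis (4 * of_nat m * x) = 1" by (intro cis_poly_zero) auto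
  have "m \<in> {1,2,3,4,5,6}" using m by auto
  \<comment> \<open>60 is the least common multiple of 1, ..., 6, and 240 is four times
    that.\<close>
  then have "240 * x = of_nat (60 div m) * (4 * of_nat m * x)"
    by auto
  also have "cis \<dots> = cis (4 * of_nat m * x) ^ (60 div m)" by (simp only: Complex.DeMoivre)
  finally show ?thesis by (simp add: c)
qed

text \<open>Zeros at \<open>n\<close> and \<open>n + m\<close> make \<open>\<phi>\<close> and
  \<open>\<phi>\<close> times the \<open>m\<close>-th power of \<open>cis (- x)\<close> negligible.
  That power is linear in \<open>cis (- x)\<close>, so
  \<open>cis_poly m x * \<phi> x * cis (- x)\<close> is negligible too. After multiplication by the
  other factors of \<open>W\<close>, every power of \<open>cis (- x)\<close> can be recombined, and
  these powers shift the index by \<open>j\<close>.\<close>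

lemma negl_window:
  assumes \<phi>: "C1per \<phi> \<phi>'" and m: "m \<in> {1..6::nat}" and L: "L > 0"
  defines "S \<equiv> \<lambda>l. {n. \<bar>of_int n\<bar> \<le> L * l \<and> osc_fc l \<phi> n = 0 \<and> osc_fc l \<phi> (n + int m) = 0}"
  shows "\<exists>C. \<forall>l\<ge>1. (\<Sum>n\<in>S l. (cmod (osc_fc l (\<lambda>x. cis_poly_prod x * \<phi> x) (n + int j)))\<^sup>2) \<le> C / l\<^sup>2"
proof -
  have bd: "\<bar>of_int n\<bar> \<le> L * l" if "n \<in> S l" for n l using that by (simp add: S_def)
  have fin: "finite (S l)" for l
  proof (rule finite_subset)
    show "S l \<subseteq> {-\<lceil>L * l\<rceil>..\<lceil>L * l\<rceil>}" 
    proof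
      fix n assume "n \<in> S l"
      then have "\<bar>of_int n\<bar> \<le> L * l" by (rule bd)
      then show "n \<in> {-\<lceil>L * l\<rceil>..\<lceil>L * l\<rceil>}" by (simp add: abs_le_iff) linarith
    qed
  qed auto
  obtain k where k: "m = Suc k" using m by (cases m) auto
  \<comment> \<open>On \<open>S l\<close> the coefficients vanish exactly, so the constant 0 works;
    the same holds for the version shifted by \<open>m\<close>.\<close>
  have 1: "negl S \<phi>" unfolding negl_def using \<phi> by (auto simp: S_def intro!: exI[of _ 0])
  have "C1per (\<lambda>x. \<phi> x * cis (- (of_int (int m) * x))) (\<lambda>x. \<phi> x * (- \<i> * of_int (int m) * cis (- (of_int (int m) * x))) + \<phi>' x * cis (- (of_int (int m) * x)))"
    by (intro C1per_mult \<phi> C1per_cis_minus)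
  then have 2: "negl S (\<lambda>x. \<phi> x * cis (- (of_int (int m) * x)))"
    unfolding negl_def osc_fc_cis by (auto simp: S_def intro!: exI[of _ 0])
  have "negl S (\<lambda>x. \<phi> x * cis (- (of_int (int m) * x)) + (-1) * (cis_poly k x * \<phi> x))"
    by (intro negl_add 2 negl_cmult negl_cis_poly[where L = L] 1 fin bd)
  also have "(\<lambda>x. \<phi> x * cis (- (of_int (int m) * x)) + (-1) * (cis_poly k x * \<phi> x)) = (\<lambda>x. cis_poly m x * (\<phi> x * cis (- x)))"
  proof
    fix x
    have e: "cis (- (of_int (int m) * x)) = cis_poly m x * cis (- x) + cis_poly k x" using cis_eq_cis_poly[of k x] by (simp only: k of_int_of_nat_eq)
    show "\<phi> x * cis (- (of_int (int m) * x)) + (-1) * (cis_poly k x * \<phi> x) = cis_poly m x * (\<phi> x * cis (- x))"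
      unfolding e by (simp add: algebra_simps)
  qed
  finally have 3: "negl S (\<lambda>x. cis_poly m x * (\<phi> x * cis (- x)))" .
  \<comment> \<open>Supplying the missing factors replaces \<open>cis_poly m x\<close> by the full
    product, which no longer depends on \<open>m\<close>.\<close>
  have "negl S (\<lambda>x. (\<Prod>i\<in>{1..6}-{m}. cis_poly i x) * (cis_poly m x * (\<phi> x * cis (- x))))"
    by (intro negl_prod_cis_poly[where L = L] 3 fin bd) auto
  also have "(\<lambda>x. (\<Prod>i\<in>{1..6}-{m}. cis_poly i x) * (cis_poly m x * (\<phi> x * cis (- x)))) = (\<lambda>x. cis_poly_prod x * \<phi> x * cis (- x))"
  proof
    fix x
    have "cis_poly_prod x = cis_poly m x * (\<Prod>i\<in>{1..6}-{m}. cis_poly i x)"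
      unfolding cis_poly_prod_def by (rule prod.remove) (use m in auto)
    then show "(\<Prod>i\<in>{1..6}-{m}. cis_poly i x) * (cis_poly m x * (\<phi> x * cis (- x))) = cis_poly_prod x * \<phi> x * cis (- x)" by simp
  qed
  finally have 4: "negl S (\<lambda>x. cis_poly_prod x * \<phi> x * cis (- x))" .
  have 5: "negl S (\<lambda>x. cis_poly_prod x * \<phi> x)"
    unfolding cis_poly_prod_def by (intro negl_prod_cis_poly[where L = L] 1 fin bd) auto
  have 6: "negl S (\<lambda>x. cis_poly_prod x * \<phi> x * cis (- (of_int (int j) * x)))"
  proof (cases j)
    case 0
    then show ?thesis using 5 by simp
  next
    case (Suc i)
    have "negl S (\<lambda>x. cis_poly j x * (cis_poly_prod x * \<phi> x * cis (- x)) + cis_poly i x * (cis_poly_prod x * \<phi> x))"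
      by (intro negl_add negl_cis_poly[where L = L] 4 5 fin bd)
    also have "(\<lambda>x. cis_poly j x * (cis_poly_prod x * \<phi> x * cis (- x)) + cis_poly i x * (cis_poly_prod x * \<phi> x)) = (\<lambda>x. cis_poly_prod x * \<phi> x * cis (- (of_int (int j) * x)))"
    proof
      fix x
      have e: "cis (- (of_int (int j) * x)) = cis_poly j x * cis (- x) + cis_poly i x" using cis_eq_cis_poly[of i x] by (simp only: Suc of_int_of_nat_eq)
      show "cis_poly j x * (cis_poly_prod x * \<phi> x * cis (- x)) + cis_poly i x * (cis_poly_prod x * \<phi> x) = cis_poly_prod x * \<phi> x * cis (- (of_int (int j) * x))"
        unfolding e by (simp add: algebra_simps)
    qed
    finally show ?thesis .
  qed
  then show ?thesis unfolding negl_def osc_fc_cis by blast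
qed

section \<open>The high-frequency limit\<close>

text \<open>The phase oscillates with frequencies at most \<open>l\<close>, so indices beyond
  \<open>M * l\<close> contribute little: solve \<open>osc_fc_deriv\<close> for \<open>n\<close>
  times the coefficient, divide by \<open>M * l\<close>, and sum with Bessel's inequality. The bound
  does not involve \<open>l\<close>.\<close>

lemma osc_fc_tail:
  assumes g: "C1per g g'"
  shows "\<exists>K. \<forall>l\<ge>1. \<forall>M>0. \<forall>A. finite A \<and> (\<forall>n\<in>A. \<bar>of_int n\<bar> > M * l) \<longrightarrow> (\<Sum>n\<in>A. (cmod (osc_fc l g n))\<^sup>2) \<le> K / M\<^sup>2"
proof -
  define K1 where "K1 = 2 * pi * integral {-pi..pi} (\<lambda>x. (cmod (g' x))\<^sup>2)"
  define K2 where "K2 = 2 * pi * integral {-pi..pi} (\<lambda>x. (cmod (of_real (sin x) * g x))\<^sup>2)"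
  have "(\<Sum>n\<in>A. (cmod (osc_fc l g n))\<^sup>2) \<le> (2 * K1 + 2 * K2) / M\<^sup>2" if l: "l \<ge> 1" and M: "M > 0" and A: "finite A" and An: "\<forall>n\<in>A. \<bar>of_int n\<bar> > M * l" for l M A
  proof -
    have "(cmod (osc_fc l g n))\<^sup>2 \<le> (1 / M\<^sup>2) * (2 * (cmod (osc_fc l g' n))\<^sup>2 + 2 * (cmod (osc_fc l (\<lambda>x. of_real (sin x) * g x) n))\<^sup>2)" if n: "n \<in> A" for n
    proof -
      let ?s = "osc_fc l (\<lambda>x. of_real (sin x) * g x) n"
      have "(M * l)\<^sup>2 * (cmod (osc_fc l g n))\<^sup>2 \<le> \<bar>of_int n\<bar>\<^sup>2 * (cmod (osc_fc l g n))\<^sup>2"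
        using An n M l by (intro mult_right_mono power_mono) (auto simp: less_imp_le)
      also have "\<dots> = (cmod (\<i> * of_int n * osc_fc l g n))\<^sup>2" by (simp add: norm_mult power_mult_distrib)
      also have "\<dots> = (cmod (osc_fc l g' n + (- \<i> * of_real l * ?s)))\<^sup>2" unfolding osc_fc_deriv[OF g, symmetric] by simp
      also have "\<dots> \<le> 2 * (cmod (osc_fc l g' n))\<^sup>2 + 2 * (cmod (- \<i> * of_real l * ?s))\<^sup>2" by (rule norm_add_squared_le)
      also have "\<dots> = 2 * (cmod (osc_fc l g' n))\<^sup>2 + 2 * l\<^sup>2 * (cmod ?s)\<^sup>2" by (simp add: norm_mult power_mult_distrib)
      also have "\<dots> \<le> l\<^sup>2 * (2 * (cmod (osc_fc l g' n))\<^sup>2 + 2 * (cmod ?s)\<^sup>2)"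
        using mult_right_mono[of 1 "l\<^sup>2" "2 * (cmod (osc_fc l g' n))\<^sup>2"] l by (simp add: algebra_simps)
      finally have "l\<^sup>2 * (M\<^sup>2 * (cmod (osc_fc l g n))\<^sup>2) \<le> l\<^sup>2 * (2 * (cmod (osc_fc l g' n))\<^sup>2 + 2 * (cmod ?s)\<^sup>2)"
        by (simp add: power_mult_distrib mult_ac)
      then have "M\<^sup>2 * (cmod (osc_fc l g n))\<^sup>2 \<le> 2 * (cmod (osc_fc l g' n))\<^sup>2 + 2 * (cmod ?s)\<^sup>2" using l by simp
      then show ?thesis using M by (simp add: field_simps)
    qed
    then have "(\<Sum>n\<in>A. (cmod (osc_fc l g n))\<^sup>2) \<le> (\<Sum>n\<in>A. (1 / M\<^sup>2) * (2 * (cmod (osc_fc l g' n))\<^sup>2 + 2 * (cmod (osc_fc l (\<lambda>x. of_real (sin x) * g x) n))\<^sup>2))"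
      by (intro sum_mono)
    also have "\<dots> \<le> (1 / M\<^sup>2) * (2 * K1 + 2 * K2)"
      unfolding sum_distrib_left[symmetric] sum.distrib K1_def K2_def
      by (intro mult_left_mono add_mono osc_fc_bessel A cper_intros C1perD[OF g]) auto
    finally show ?thesis by simp
  qed
  then show ?thesis by blast
qed

text \<open>The exceptional points are isolated: were \<open>f x\<close> nonzero,
  \<open>cis (of_nat N * y)\<close> would be constant for \<open>y\<close> near \<open>x\<close>,
  against its nonzero derivative.\<close>

lemma cis_zero_off:
  assumes f: "cper f" and "N > 0" and z: "\<And>x. f x = 0 \<or> cis (of_nat N * x) = 1"
  shows "f x = 0"
proof (rule ccontr)
  assume "f x \<noteq> 0"
  moreover have "isCont f x" using cper_cont[OF f, of UNIV] by (simp add: continuous_on_eq_continuous_at)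
  ultimately obtain d where d: "d > 0" "\<And>y. dist x y < d \<Longrightarrow> f y \<noteq> 0"
    using continuous_at_avoid[of x f 0] by auto
  then have 1: "cis (of_nat N * y) = 1" if "y \<in> ball x d" for y using z[of y] d(2)[of y] that by (auto simp: dist_commute)
  have "((\<lambda>y. cis (of_nat N * y)) has_vector_derivative (of_nat N * \<i> * cis (of_nat N * x))) (at x)"
    unfolding has_vector_derivative_def by (auto intro!: derivative_eq_intros ext simp: scaleR_conv_of_real)
  moreover have "((\<lambda>y. cis (of_nat N * y)) has_vector_derivative 0) (at x)"
    using d 1 by (intro has_vector_derivative_transform_within_open[OF has_vector_derivative_const[of 1], of "ball x d"]) auto
  ultimately have "of_nat N * \<i> * cis (of_nat N * x) = 0" using vector_derivative_unique_at by blast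
  then show False using \<open>N > 0\<close> by simp
qed

text \<open>For \<open>G\<close>, the product of \<open>W\<close> and \<open>\<phi>\<close>, split
  the coefficients at \<open>\<bar>n\<bar> = M * l\<close>. The inner ones are small by
  \<open>negl_window\<close>, as each index lies near two neighbouring zeros; the outer ones by
  \<open>osc_fc_tail\<close>. Letting \<open>l\<close> and then \<open>M\<close> tend to infinity
  gives \<open>G = 0\<close>.\<close>

lemma gaps_imp_zero:
  assumes \<phi>: "C1per \<phi> \<phi>'"
    and gaps: "\<And>B. \<exists>l\<ge>B. \<forall>n. \<exists>j\<in>{0..5::nat}. osc_fc l \<phi> (n + int j) = 0"
  shows "\<phi> x = 0"
proof -
  define G where "G = (\<lambda>x. cis_poly_prod x * \<phi> x)"
  \<comment> \<open>With empty index sets \<open>negl\<close> expresses only differentiability; this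
    supplies a derivative of \<open>G\<close>.\<close>
  have "negl (\<lambda>_. {}) \<phi>" unfolding negl_def using \<phi> by (auto intro!: exI[of _ 0])
  then have "negl (\<lambda>_. {}) G" unfolding G_def cis_poly_prod_def by (intro negl_prod_cis_poly[where L = 0]) auto
  then obtain G' where G: "C1per G G'" using negl_C1per by blast
  obtain K where K0: "\<forall>l\<ge>1. \<forall>M>0. \<forall>A. finite A \<and> (\<forall>n\<in>A. \<bar>of_int n\<bar> > M * l) \<longrightarrow> (\<Sum>n\<in>A. (cmod (osc_fc l G n))\<^sup>2) \<le> K / M\<^sup>2"
    using osc_fc_tail[OF G] by (rule exE)
  have K: "(\<Sum>n\<in>A. (cmod (osc_fc l G n))\<^sup>2) \<le> K / M\<^sup>2" if "l \<ge> 1" "M > 0" "finite A" "\<forall>n\<in>A. \<bar>of_int n\<bar> > M * l" for l M A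
    using K0[rule_format, OF that(1,2)] that(3,4) by simp
  define I where "I = 2 * pi * integral {-pi..pi} (\<lambda>x. (cmod (G x))\<^sup>2)"
  have main: "I \<le> K / M\<^sup>2" if M: "M > 0" for M
  proof -
    \<comment> \<open>The left zero assigned to \<open>n\<close> may lie up to 5 places below
      \<open>n\<close>, and \<open>M * l + 5 \<le> (M + 5) * l\<close> for
      \<open>l \<ge> 1\<close>.\<close>
    define S where "S = (\<lambda>m l. {n. \<bar>of_int n\<bar> \<le> (M + 5) * l \<and> osc_fc l \<phi> n = 0 \<and> osc_fc l \<phi> (n + int m) = 0})"
    have ex: "\<exists>C. \<forall>l\<ge>1. (\<Sum>n\<in>S m l. (cmod (osc_fc l G (n + int j)))\<^sup>2) \<le> C / l\<^sup>2" if "m \<in> {1..6}" for m j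
      using negl_window[OF \<phi> that, of "M + 5" j] M unfolding S_def G_def by simp
    define C where "C m j = (SOME C. \<forall>l\<ge>1. (\<Sum>n\<in>S m l. (cmod (osc_fc l G (n + int j)))\<^sup>2) \<le> C / l\<^sup>2)" for m j
    have C: "(\<Sum>n\<in>S m l. (cmod (osc_fc l G (n + int j)))\<^sup>2) \<le> C m j / l\<^sup>2" if "m \<in> {1..6}" "l \<ge> 1" for m j l
      using someI_ex[OF ex[OF that(1), of j]] that(2) unfolding C_def by blast
    have finS: "finite (S m l)" for m l
    proof (rule finite_subset)
      show "S m l \<subseteq> {-\<lceil>(M+5) * l\<rceil>..\<lceil>(M+5) * l\<rceil>}" 
      proof
        fix n assume "n \<in> S m l"
        then have "\<bar>of_int n\<bar> \<le> (M + 5) * l" by (simp add: S_def)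
        then show "n \<in> {-\<lceil>(M+5) * l\<rceil>..\<lceil>(M+5) * l\<rceil>}" by (simp add: abs_le_iff) linarith
      qed
    qed auto
    define CC where "CC = (\<Sum>m\<in>{1..6}. \<Sum>j\<in>{0..5::nat}. C m j)"
    have bound: "I \<le> CC / l\<^sup>2 + K / M\<^sup>2" if l: "l \<ge> 1" and gap: "\<forall>n. \<exists>j\<in>{0..5::nat}. osc_fc l \<phi> (n + int j) = 0" for l
      unfolding I_def
    proof (rule osc_fc_parseval_le[where l = l])
      show "cper G" by (rule C1perD[OF G])
      fix N :: nat
      let ?A = "{n\<in>{-int N..int N}. \<bar>of_int n\<bar> \<le> M * l}" and ?B = "{n\<in>{-int N..int N}. \<not> \<bar>of_int n\<bar> \<le> M * l}"
      let ?T = "(SIGMA m:{1..6}. SIGMA j:{0..5::nat}. S m l)"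
      have finA: "finite ?A" and finB: "finite ?B" by (rule finite_subset[of _ "{-int N..int N}"]; auto)+
      \<comment> \<open>Every inner index is reached by some triple of distance \<open>m\<close>,
        shift \<open>j\<close> and left zero; counting an index repeatedly only enlarges the right
        side.\<close>
      have "(\<Sum>n\<in>?A. (cmod (osc_fc l G n))\<^sup>2) \<le> (\<Sum>(m,j,n)\<in>?T. (cmod (osc_fc l G (n + int j)))\<^sup>2)"
      proof (rule sum_le_included[where i = "\<lambda>(m,j,n). n + int j"])
        show "finite ?A" by (rule finA)
        show "finite ?T" by (intro finite_SigmaI finS) auto
        show "\<forall>n\<in>?A. \<exists>t\<in>?T. (case t of (m, j, n) \<Rightarrow> n + int j) = n \<and> (cmod (osc_fc l G n))\<^sup>2 \<le> (case t of (m, j, n) \<Rightarrow> (cmod (osc_fc l G (n + int j)))\<^sup>2)"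
        proof
          fix n assume n: "n \<in> ?A"
          \<comment> \<open>The first zero is sought in the window from \<open>n - 5\<close> to
            \<open>n\<close>, the second among the six indices after it. Hence the distance is
            \<open>Suc k\<close> and the shift back to \<open>n\<close> is
            \<open>5 - i\<close>.\<close>
          obtain i where i: "i \<in> {0..5::nat}" "osc_fc l \<phi> (n - 5 + int i) = 0" using gap by blast
          obtain k where k: "k \<in> {0..5::nat}" "osc_fc l \<phi> (n - 5 + int i + 1 + int k) = 0" using gap by blast
          have "\<bar>real_of_int (n - 5 + int i)\<bar> \<le> M * l + 5" using n i(1) by auto
          also have "\<dots> \<le> (M + 5) * l" using l by (simp add: algebra_simps)
          finally have "n - 5 + int i \<in> S (Suc k) l" using i k unfolding S_def by (simp add: algebra_simps)
          then show "\<exists>t\<in>?T. (case t of (m, j, n) \<Rightarrow> n + int j) = n \<and> (cmod (osc_fc l G n))\<^sup>2 \<le> (case t of (m, j, n) \<Rightarrow> (cmod (osc_fc l G (n + int j)))\<^sup>2)"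
            using i k by (intro bexI[of _ "(Suc k, 5 - i, n - 5 + int i)"]) (auto simp: of_nat_diff)
        qed
      qed auto
      also have "\<dots> = (\<Sum>m\<in>{1..6}. \<Sum>j\<in>{0..5::nat}. \<Sum>n\<in>S m l. (cmod (osc_fc l G (n + int j)))\<^sup>2)"
        by (simp only: sum.Sigma[OF finite_atLeastAtMost ballI, OF finS] sum.Sigma[OF finite_atLeastAtMost ballI] finite_SigmaI finite_atLeastAtMost finS split_def fst_conv snd_conv)
      also have "\<dots> \<le> (\<Sum>m\<in>{1..6}. \<Sum>j\<in>{0..5::nat}. C m j / l\<^sup>2)"
        by (intro sum_mono C l)
      also have "\<dots> = CC / l\<^sup>2" by (simp only: CC_def sum_divide_distrib)
      finally have A: "(\<Sum>n\<in>?A. (cmod (osc_fc l G n))\<^sup>2) \<le> CC / l\<^sup>2" .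
      have B: "(\<Sum>n\<in>?B. (cmod (osc_fc l G n))\<^sup>2) \<le> K / M\<^sup>2" by (rule K) (use l M finB in auto)
      have "(\<Sum>n\<in>{-int N..int N}. (cmod (osc_fc l G n))\<^sup>2) = (\<Sum>n\<in>?A. (cmod (osc_fc l G n))\<^sup>2) + (\<Sum>n\<in>?B. (cmod (osc_fc l G n))\<^sup>2)"
      proof -
        have "{-int N..int N} = ?A \<union> ?B" by blast
        then have "(\<Sum>n\<in>{-int N..int N}. (cmod (osc_fc l G n))\<^sup>2) = (\<Sum>n\<in>?A \<union> ?B. (cmod (osc_fc l G n))\<^sup>2)" by (rule arg_cong)
        also have "\<dots> = (\<Sum>n\<in>?A. (cmod (osc_fc l G n))\<^sup>2) + (\<Sum>n\<in>?B. (cmod (osc_fc l G n))\<^sup>2)"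
          by (rule sum.union_disjoint[OF finA finB]) auto
        finally show ?thesis .
      qed
      then show "(\<Sum>n\<in>{-int N..int N}. (cmod (osc_fc l G n))\<^sup>2) \<le> CC / l\<^sup>2 + K / M\<^sup>2" using A B by linarith
    qed
    show ?thesis
    proof (rule field_le_epsilon)
      fix e :: real assume e: "e > 0"
      \<comment> \<open>For fixed \<open>M\<close> the gap hypothesis provides \<open>l\<close> so
        large that \<open>CC / l\<^sup>2 \<le> e\<close>.\<close>
      obtain l where l: "l \<ge> max 1 (\<bar>CC\<bar> / e)" and gap: "\<forall>n. \<exists>j\<in>{0..5::nat}. osc_fc l \<phi> (n + int j) = 0" using gaps by blast
      have "\<bar>CC\<bar> \<le> e * l" using l e by (simp add: field_simps)
      then have "CC \<le> e * l" by linarith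
      also have "\<dots> \<le> e * l\<^sup>2" using l e by (simp add: power2_eq_square)
      finally have "CC / l\<^sup>2 \<le> e" using l by (simp add: field_simps)
      then show "I \<le> K / M\<^sup>2 + e" using bound[OF _ gap] l by linarith
    qed
  qed
  have "I \<le> 0"
  proof (rule field_le_epsilon)
    fix e :: real assume e: "e > 0"
    define M where "M = max 1 (\<bar>K\<bar> / e)"
    have M: "M \<ge> 1" "\<bar>K\<bar> / e \<le> M" by (auto simp: M_def)
    have "\<bar>K\<bar> \<le> e * M" using M(2) e by (simp add: field_simps)
    then have "K \<le> e * M" by linarith
    also have "\<dots> \<le> e * M\<^sup>2" using M(1) e by (simp add: power2_eq_square)
    finally have "K / M\<^sup>2 \<le> e" using M(1) by (simp add: field_simps)
    then show "I \<le> 0 + e" using main[of M] M(1) by linarith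
  qed
  then have "integral {-pi..pi} (\<lambda>x. (cmod (G x))\<^sup>2) \<le> 0" using pi_gt_zero by (simp add: I_def mult_le_0_iff del: pi_gt_zero)
  then have "G x = 0" for x by (rule integral_norm2_zero[OF C1perD(1)[OF G]])
  then have z: "\<phi> y = 0 \<or> cis (of_nat 240 * y) = 1" for y using cis_poly_prod_zero[of y] by (auto simp: G_def)
  show ?thesis by (rule cis_zero_off[OF C1perD(1)[OF \<phi>] _ z]) simp
qed

section \<open>Bessel determinants\<close>

text \<open>By the Jacobi-Anger integral this is 2 pi times the \<open>n\<close>-th power of
  \<open>\<i>\<close> times the Bessel function J_n(z).\<close>

definition bes :: "real \<Rightarrow> int \<Rightarrow> complex" where
  "bes z n = fc (\<lambda>\<theta>. cis (z * cos \<theta>)) n"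

text \<open>The derivative of \<open>bes\<close> in \<open>z\<close>, with the differentiation
  carried out under the integral.\<close>

definition bes' :: "real \<Rightarrow> int \<Rightarrow> complex" where
  "bes' z n = fc (\<lambda>\<theta>. \<i> * of_real (cos \<theta>) * cis (z * cos \<theta>)) n"

lemma fc_cos:
  assumes "cper g"
  shows "fc (\<lambda>\<theta>. of_real (cos \<theta>) * g \<theta>) n = (fc g (n - 1) + fc g (n + 1)) / 2"
proof -
  have eq: "(\<lambda>\<theta>. of_real (cos \<theta>) * g \<theta>) = (\<lambda>\<theta>. (1/2) * (g \<theta> * cis (- (of_int (-1) * \<theta>))) + (1/2) * (g \<theta> * cis (- (of_int 1 * \<theta>))))"
  proof
    fix \<theta>
    have e: "complex_of_real (cos \<theta>) = (cis \<theta> + cis (- \<theta>)) / 2" by (simp add: complex_eq_iff)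
    show "of_real (cos \<theta>) * g \<theta> = (1/2) * (g \<theta> * cis (- (of_int (-1) * \<theta>))) + (1/2) * (g \<theta> * cis (- (of_int 1 * \<theta>)))"
      unfolding e by (simp add: field_simps)
  qed
  have c: "cper (\<lambda>\<theta>. c * (g \<theta> * cis (- (of_int m * \<theta>))))" for c m
    by (intro cper_intros assms)
  show ?thesis
    unfolding eq fc_add[OF c c] fc_cmult fc_cis by (simp add: field_simps)
qed

lemma fc_sin:
  assumes "cper g"
  shows "fc (\<lambda>\<theta>. of_real (sin \<theta>) * g \<theta>) n = (fc g (n - 1) - fc g (n + 1)) / (2 * \<i>)"
proof -
  have eq: "(\<lambda>\<theta>. of_real (sin \<theta>) * g \<theta>) = (\<lambda>\<theta>. (1/(2*\<i>)) * (g \<theta> * cis (- (of_int (-1) * \<theta>))) + (-1/(2*\<i>)) * (g \<theta> * cis (- (of_int 1 * \<theta>))))"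
  proof
    fix \<theta>
    have e: "complex_of_real (sin \<theta>) = (cis \<theta> - cis (- \<theta>)) / (2 * \<i>)" by (simp add: complex_eq_iff)
    show "of_real (sin \<theta>) * g \<theta> = (1/(2*\<i>)) * (g \<theta> * cis (- (of_int (-1) * \<theta>))) + (-1/(2*\<i>)) * (g \<theta> * cis (- (of_int 1 * \<theta>)))"
      unfolding e by (simp add: field_simps)
  qed
  have c: "cper (\<lambda>\<theta>. c * (g \<theta> * cis (- (of_int m * \<theta>))))" for c m
    by (intro cper_intros assms)
  show ?thesis
    unfolding eq fc_add[OF c c] fc_cmult fc_cis by (simp add: field_simps)
qed

text \<open>Integration by parts of the phase gives the classical three-term recurrence; the powers
  of \<open>\<i>\<close> in \<open>bes\<close> account for the signs.\<close>

lemma bes_rec: "of_real z * bes z (n + 1) = of_real z * bes z (n - 1) + 2 * \<i> * of_int n * bes z n"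
proof -
  have "\<i> * of_int n * bes z n = fc (\<lambda>\<theta>. (- \<i> * of_real z) * (of_real (sin \<theta>) * cis (z * cos \<theta>))) n"
    using fc_deriv[OF C1per_cis_cos, of z n] by (simp add: bes_def mult_ac)
  also have "\<dots> = (- \<i> * of_real z) * ((bes z (n - 1) - bes z (n + 1)) / (2 * \<i>))"
    unfolding fc_cmult by (subst fc_sin) (auto intro: cper_intros simp: bes_def)
  also have "\<dots> = - (of_real z * (bes z (n - 1) - bes z (n + 1))) / 2"
  proof -
    define y where "y = (bes z (n - 1) - bes z (n + 1)) / (2 * \<i>)"
    have "bes z (n - 1) - bes z (n + 1) = y * (2 * \<i>)"
      by (rule iffD1[OF nonzero_divide_eq_eq]) (simp_all add: y_def)
    then show ?thesis unfolding y_def[symmetric] by simp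
  qed
  finally have "2 * (\<i> * of_int n * bes z n) = - (of_real z * (bes z (n - 1) - bes z (n + 1)))" by simp
  then show ?thesis by (simp add: algebra_simps)
qed

lemma bes'_eq: "bes' z n = \<i> * (bes z (n - 1) + bes z (n + 1)) / 2"
proof -
  have "bes' z n = \<i> * fc (\<lambda>\<theta>. of_real (cos \<theta>) * cis (z * cos \<theta>)) n"
    unfolding bes'_def mult.assoc fc_cmult ..
  then show ?thesis by (simp add: fc_cos cper_intros bes_def)
qed

text \<open>Two neighbouring zeros spread through the recurrence in both directions, so all Fourier
  coefficients of \<open>cis (z * cos \<theta>)\<close> would vanish, although this function has
  modulus 1.\<close>

lemma bes_not_both_zero:
  assumes z: "z \<noteq> 0"
  shows "bes z n \<noteq> 0 \<or> bes z (n + 1) \<noteq> 0"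
proof (rule ccontr)
  assume "\<not> ?thesis"
  then have b: "bes z n = 0" "bes z (n + 1) = 0" by auto
  have "bes z m = 0 \<and> bes z (m + 1) = 0" for m
  proof (induction m rule: int_induct[where k = n])
    case (step1 i)
    then show ?case using bes_rec[of z "i + 1"] z by simp
  next
    case (step2 i)
    then show ?case using bes_rec[of z i] z by simp
  qed (use b in auto)
  then have "fc (\<lambda>\<theta>. cis (z * cos \<theta>)) m = 0" for m by (simp add: bes_def)
  from fc_all_zero[OF cper_cis_cos this, of 0] have "cis (z * cos 0) = 0" .
  then show False by simp
qed

section \<open>Gaps between zeros of the determinants\<close>

text \<open>The determinant \<open>D\<^sub>n\<close>, up to the nonzero factor contained in
  \<open>bes\<close>.\<close>

definition besW :: "real \<Rightarrow> real \<Rightarrow> int \<Rightarrow> complex" where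
  "besW a b n = a * bes' a n * bes b n - b * bes a n * bes' b n"

text \<open>The recurrence eliminates the lower neighbour from \<open>bes'_eq\<close>;
  \<open>bes'_down\<close> eliminates the upper one. In the determinant the terms with factor
  \<open>n\<close> then cancel.\<close>

lemma bes'_up: "of_real z * bes' z n = \<i> * z * bes z (n + 1) + of_int n * bes z n"
proof -
  have "2 * (of_real z * bes' z n) = \<i> * (of_real z * bes z (n - 1)) + \<i> * (of_real z * bes z (n + 1))"
    by (simp add: bes'_eq algebra_simps)
  also have r: "of_real z * bes z (n - 1) = of_real z * bes z (n + 1) - 2 * \<i> * of_int n * bes z n"
    using bes_rec[of z n] by simp
  finally have "2 * (of_real z * bes' z n) = \<i> * (of_real z * bes z (n + 1) - 2 * \<i> * of_int n * bes z n) + \<i> * (of_real z * bes z (n + 1))" .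
  also have "\<dots> = 2 * (\<i> * z * bes z (n + 1)) + 2 * (of_int n * bes z n)"
    by (simp add: algebra_simps)
  finally show ?thesis
    by (simp only: distrib_left[symmetric] right_diff_distrib[symmetric] mult_cancel_left) simp
qed

lemma bes'_down: "of_real z * bes' z n = \<i> * z * bes z (n - 1) - of_int n * bes z n"
proof -
  have "2 * (of_real z * bes' z n) = \<i> * (of_real z * bes z (n - 1)) + \<i> * (of_real z * bes z (n + 1))"
    by (simp add: bes'_eq algebra_simps)
  also have r: "of_real z * bes z (n + 1) = of_real z * bes z (n - 1) + 2 * \<i> * of_int n * bes z n"
    using bes_rec[of z n] by simp
  finally have "2 * (of_real z * bes' z n) = \<i> * (of_real z * bes z (n - 1)) + \<i> * (of_real z * bes z (n - 1) + 2 * \<i> * of_int n * bes z n)" .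
  also have "\<dots> = 2 * (\<i> * z * bes z (n - 1)) - 2 * (of_int n * bes z n)"
    by (simp add: algebra_simps)
  finally show ?thesis
    by (simp only: distrib_left[symmetric] right_diff_distrib[symmetric] mult_cancel_left) simp
qed

lemma besW_up: "besW a b n = \<i> * (a * bes a (n + 1) * bes b n - b * bes a n * bes b (n + 1))"
proof -
  have "besW a b n = (a * bes' a n) * bes b n - bes a n * (b * bes' b n)" by (simp add: besW_def)
  then show ?thesis unfolding bes'_up by (simp add: algebra_simps)
qed

lemma besW_down: "besW a b n = \<i> * (a * bes a (n - 1) * bes b n - b * bes a n * bes b (n - 1))"
proof -
  have "besW a b n = (a * bes' a n) * bes b n - bes a n * (b * bes' b n)" by (simp add: besW_def)
  then show ?thesis unfolding bes'_down by (simp add: algebra_simps)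
qed

text \<open>Written with \<open>besW_up\<close> at \<open>n\<close> and \<open>besW_down\<close> at
  \<open>n + 1\<close>, the two equations are linear in the same two products, with determinant
  \<open>a\<^sup>2 - b\<^sup>2\<close> up to sign. Both products vanish, and since neither sequence
  has adjacent zeros the vanishing factors sit at the same index.\<close>

lemma besW_two_zeros:
  assumes ab: "a > 0" "b > 0" "a \<noteq> b" and "besW a b n = 0" "besW a b (n + 1) = 0"
  shows "bes a n = 0 \<and> bes b n = 0 \<or> bes a (n + 1) = 0 \<and> bes b (n + 1) = 0"
proof -
  let ?p = "bes a n" and ?p' = "bes a (n + 1)" and ?r = "bes b n" and ?r' = "bes b (n + 1)"
  have 1: "of_real a * ?p' * ?r = of_real b * ?p * ?r'" using assms(4) unfolding besW_up by simp
  have 2: "of_real a * ?p * ?r' = of_real b * ?p' * ?r" using assms(5) unfolding besW_down by simp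
  have "of_real (a\<^sup>2 - b\<^sup>2) * (?p * ?r') = a * (of_real a * ?p * ?r') - b * (of_real b * ?p * ?r')"
    by (simp add: algebra_simps power2_eq_square)
  also have "\<dots> = 0" unfolding 2 1[symmetric] by (simp add: algebra_simps)
  finally have "of_real (a\<^sup>2 - b\<^sup>2) * (?p * ?r') = 0" .
  moreover have "a\<^sup>2 - b\<^sup>2 \<noteq> 0" using ab by (simp add: power2_eq_iff)
  ultimately have "?p * ?r' = 0" by (metis mult_eq_0_iff of_real_eq_0_iff)
  moreover from this have "?p' * ?r = 0" using 2 ab by auto
  ultimately show ?thesis using bes_not_both_zero[of a n] bes_not_both_zero[of b n] ab by auto
qed

text \<open>Two consecutive zeros of \<open>besW\<close> force a common zero of the two Bessel sequences at one of the
  two indices; common zeros cannot be adjacent, and by the three term recurrence they cannot be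
  two apart except around the index 0.\<close>

lemma besW_four_zeros:
  assumes ab: "a > 0" "b > 0" "a \<noteq> b" and z: "\<And>i. i \<in> {0..3} \<Longrightarrow> besW a b (n + i) = 0"
    and n: "n + 1 \<noteq> 0" "n + 2 \<noteq> 0"
  shows False
proof -
  have "bes a (n + i) = 0 \<and> bes b (n + i) = 0 \<or> bes a (n + i + 1) = 0 \<and> bes b (n + i + 1) = 0" if "i \<in> {0..2}" for i
    using besW_two_zeros[OF ab, of "n + i"] z[of i] z[of "i + 1"] that by (simp add: algebra_simps)
  then have "bes a (n + i) = 0 \<or> bes a (n + i + 1) = 0" if "i \<in> {0..2}" for i using that by blast
  from this[of 0] this[of 1] this[of 2]
  have *: "bes a n = 0 \<or> bes a (n + 1) = 0" "bes a (n + 1) = 0 \<or> bes a (n + 2) = 0" "bes a (n + 2) = 0 \<or> bes a (n + 3) = 0"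
    by (simp_all add: add.assoc)
  have nz: "bes a n \<noteq> 0 \<or> bes a (n + 1) \<noteq> 0" "bes a (n + 1) \<noteq> 0 \<or> bes a (n + 2) \<noteq> 0" "bes a (n + 2) \<noteq> 0 \<or> bes a (n + 3) \<noteq> 0"
    using bes_not_both_zero[of a n] bes_not_both_zero[of a "n+1"] bes_not_both_zero[of a "n+2"] ab(1) by (simp_all add: add.assoc)
  have r: "of_real a * bes a (n + 2) = of_real a * bes a n + 2 * \<i> * of_int (n + 1) * bes a (n + 1)"
     "of_real a * bes a (n + 3) = of_real a * bes a (n + 1) + 2 * \<i> * of_int (n + 2) * bes a (n + 2)"
    using bes_rec[of a "n + 1"] bes_rec[of a "n + 2"] by (simp_all add: add.assoc) (simp add: add.commute)
  have nonzero: "complex_of_int (n + 1) \<noteq> 0" "complex_of_int (n + 2) \<noteq> 0" using n by (metis of_int_eq_0_iff)+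
  show False
  \<comment> \<open>The zeros of \<open>bes a\<close> alternate along \<open>n, ..., n + 3\<close>,
    so the recurrence centred at \<open>n + 2\<close> or at \<open>n + 1\<close> reduces to a
    nonzero multiple of a nonzero term.\<close>
  proof (cases "bes a (n + 1) = 0")
    case True
    then have "bes a (n + 2) \<noteq> 0" "bes a (n + 3) = 0" using * nz by auto
    then show False using r(2) True nonzero(2) by simp
  next
    case False
    then have "bes a (n + 2) = 0" "bes a n = 0" using * by auto
    then show False using r(1) False nonzero(1) by simp
  qed
qed

lemma besW_gap:
  assumes ab: "a > 0" "b > 0" "a \<noteq> b"
  shows "\<exists>j\<in>{0..5::nat}. besW a b (n + int j) \<noteq> 0"
proof (rule ccontr)
  assume "\<not> ?thesis"
  then have z: "besW a b (n + int j) = 0" if "j \<le> 5" for j using that by auto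
  have z': "besW a b (n + j) = 0" if "0 \<le> j" "j \<le> 5" for j using z[of "nat j"] that by simp
  show False
  proof (cases "n + 1 \<noteq> 0 \<and> n + 2 \<noteq> 0")
    case True
    show ?thesis by (rule besW_four_zeros[OF ab, of n]) (use True z' in simp_all)
  next
    \<comment> \<open>Here \<open>n\<close> is -1 or -2, so the window from \<open>n + 2\<close> has
      its two middle indices positive. This shift is why six indices are taken rather than
      four.\<close>
    case False
    have "besW a b (n + 2 + i) = 0" if "i \<in> {0..3}" for i
      using z'[of "2 + i"] that by (simp add: add.assoc)
    then show ?thesis by (rule besW_four_zeros[OF ab, of "n + 2"]) (use False in auto)
  qed
qed

section \<open>Herglotz waves and Green's formula on the disk\<close>

lemma cis_taylor: "cmod (cis y - 1 - \<i> * of_real y) \<le> y\<^sup>2"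
  using Taylor_exp[of "\<i> * of_real y" 1] by (simp add: cis_conv_exp norm_mult numeral_2_eq_2 diff_diff_eq)

lemma herglotz_cis: "herglotz k f x = integral {-pi..pi} (\<lambda>\<theta>. f \<theta> * cis (k * (unitvec \<theta> \<bullet> x)))"
  by (simp add: herglotz_def cis_conv_exp)

lemma continuous_on_unitvec [continuous_intros]:
  fixes f :: "'a::t2_space \<Rightarrow> real"
  shows "continuous_on S f \<Longrightarrow> continuous_on S (\<lambda>x. unitvec (f x))"
  unfolding unitvec_def by (intro continuous_intros)

lemma norm_unitvec [simp]: "norm (unitvec t) = 1"
  by (simp add: unitvec_def norm_Pair)

lemma inner_unitvec: "unitvec s \<bullet> unitvec t = cos (t - s)"
  by (simp add: unitvec_def cos_diff mult.commute)

lemma C1_with_partialsD: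
  assumes "C1_with_partials f d1 d2"
  shows "(f has_derivative (\<lambda>h. of_real (fst h) * d1 x + of_real (snd h) * d2 x)) (at x)"
    "continuous_on S f" "continuous_on S d1" "continuous_on S d2"
proof -
  show d: "(f has_derivative (\<lambda>h. of_real (fst h) * d1 x + of_real (snd h) * d2 x)) (at x)" for x
    using assms unfolding C1_with_partials_def by blast
  show "continuous_on S f"
    by (rule continuous_at_imp_continuous_on) (use d has_derivative_continuous in blast)
  show "continuous_on S d1" "continuous_on S d2"
    using assms continuous_on_subset unfolding C1_with_partials_def by blast+
qed

text \<open>The first-order Taylor remainder of the exponential is at most
  \<open>k\<^sup>2 * (norm h)\<^sup>2\<close> uniformly in the angle, so it can be integrated. The
  partial derivatives are again Herglotz waves, which lets the lemma be iterated.\<close>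

lemma herglotz_has_derivative:
  fixes k :: real
  assumes f: "continuous_on {-pi..pi} f"
  shows "(herglotz k f has_derivative (\<lambda>h. of_real (fst h) * herglotz k (\<lambda>\<theta>. \<i> * of_real k * of_real (cos \<theta>) * f \<theta>) x
     + of_real (snd h) * herglotz k (\<lambda>\<theta>. \<i> * of_real k * of_real (sin \<theta>) * f \<theta>) x)) (at x)"
    (is "(_ has_derivative ?D) _")
proof -
  obtain M where M: "\<And>\<theta>. \<theta> \<in> {-pi..pi} \<Longrightarrow> cmod (f \<theta>) \<le> M"
    using compact_imp_bounded[OF compact_continuous_image[OF f compact_Icc]] unfolding bounded_iff by (metis imageI)
  have "cmod (f 0) \<le> M" by (rule M) simp
  then have M0: "M \<ge> 0" using norm_ge_zero order_trans by blast
  have bl: "bounded_linear ?D"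
    by (intro bounded_linear_add bounded_linear_compose[OF bounded_linear_mult_left]
        bounded_linear_compose[OF bounded_linear_of_real] bounded_linear_fst bounded_linear_snd)
  have est: "cmod (herglotz k f y - herglotz k f x - ?D (y - x)) \<le> (2 * pi * (M * k\<^sup>2)) * (norm (y - x))\<^sup>2" for y
  proof -
    define h where "h = y - x"
    have y: "y = x + h" by (simp add: h_def)
    let ?E = "\<lambda>\<theta>. f \<theta> * cis (k * (unitvec \<theta> \<bullet> x)) * (cis (k * (unitvec \<theta> \<bullet> h)) - 1 - \<i> * of_real (k * (unitvec \<theta> \<bullet> h)))"
    have "herglotz k f y - herglotz k f x - ?D h = integral {-pi..pi} ?E"
    proof -
      define A where "A = (\<lambda>\<theta>. f \<theta> * cis (k * (unitvec \<theta> \<bullet> (x + h))))"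
      define B where "B = (\<lambda>\<theta>. f \<theta> * cis (k * (unitvec \<theta> \<bullet> x)))"
      define C where "C = (\<lambda>\<theta>. \<i> * of_real k * of_real (cos \<theta>) * f \<theta> * cis (k * (unitvec \<theta> \<bullet> x)))"
      define D where "D = (\<lambda>\<theta>. \<i> * of_real k * of_real (sin \<theta>) * f \<theta> * cis (k * (unitvec \<theta> \<bullet> x)))"
      have I: "A integrable_on {-pi..pi}" "B integrable_on {-pi..pi}" "C integrable_on {-pi..pi}" "D integrable_on {-pi..pi}"
        unfolding A_def B_def C_def D_def by (intro integrable_continuous_real continuous_intros f)+
      have I2: "(\<lambda>\<theta>. of_real (fst h) * C \<theta>) integrable_on {-pi..pi}" "(\<lambda>\<theta>. of_real (snd h) * D \<theta>) integrable_on {-pi..pi}"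
        unfolding C_def D_def by (intro integrable_continuous_real continuous_intros f)+
      have "?E = (\<lambda>\<theta>. (A \<theta> - B \<theta>) - (of_real (fst h) * C \<theta> + of_real (snd h) * D \<theta>))"
        by (auto simp: A_def B_def C_def D_def unitvec_def inner_prod_def algebra_simps simp flip: cis_mult)
      then have "integral {-pi..pi} ?E = (integral {-pi..pi} A - integral {-pi..pi} B)
        - (of_real (fst h) * integral {-pi..pi} C + of_real (snd h) * integral {-pi..pi} D)"
        using I I2 by (simp add: Henstock_Kurzweil_Integration.integral_diff Henstock_Kurzweil_Integration.integral_add integrable_diff integrable_add)
      then show ?thesis unfolding herglotz_cis y A_def B_def C_def D_def by simp
    qed
    also have "cmod \<dots> \<le> integral {-pi..pi} (\<lambda>\<theta>. M * k\<^sup>2 * (norm h)\<^sup>2)"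
    proof (rule integral_norm_bound_integral)
      show "?E integrable_on {-pi..pi}" by (intro integrable_continuous_real continuous_intros f)
      fix \<theta> assume \<theta>: "\<theta> \<in> {-pi..pi}"
      have "cmod (?E \<theta>) = cmod (f \<theta>) * cmod (cis (k * (unitvec \<theta> \<bullet> h)) - 1 - \<i> * of_real (k * (unitvec \<theta> \<bullet> h)))"
        by (simp add: norm_mult)
      also have "\<dots> \<le> M * (k * (unitvec \<theta> \<bullet> h))\<^sup>2" by (intro mult_mono M \<theta> cis_taylor M0) auto
      also have "\<dots> \<le> M * (k\<^sup>2 * (norm h)\<^sup>2)"
      proof -
        have "\<bar>unitvec \<theta> \<bullet> h\<bar> \<le> norm h" using Cauchy_Schwarz_ineq2[of "unitvec \<theta>" h] by simp
        then have "(unitvec \<theta> \<bullet> h)\<^sup>2 \<le> (norm h)\<^sup>2"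
          using power_mono[of "\<bar>unitvec \<theta> \<bullet> h\<bar>" "norm h" 2] by simp
        then show ?thesis by (auto simp: power_mult_distrib intro!: mult_left_mono M0)
      qed
      finally show "cmod (?E \<theta>) \<le> M * k\<^sup>2 * (norm h)\<^sup>2" by (simp add: mult.assoc)
    qed auto
    also have "\<dots> = (2 * pi * (M * k\<^sup>2)) * (norm h)\<^sup>2" by simp
    finally show ?thesis unfolding h_def .
  qed
  show ?thesis
  proof (rule has_derivativeI_sandwich[of 1 _ _ _ _ "\<lambda>y. (2 * pi * (M * k\<^sup>2)) * norm (y - x)"])
    show "norm (herglotz k f y - herglotz k f x - ?D (y - x)) / norm (y - x) \<le> (2 * pi * (M * k\<^sup>2)) * norm (y - x)"
      if "y \<noteq> x" for y
      using est[of y] that by (simp add: pos_divide_le_eq power2_eq_square mult.assoc)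
    show "((\<lambda>y. 2 * pi * (M * k\<^sup>2) * norm (y - x)) \<longlongrightarrow> 0) (at x)"
      by (rule tendsto_eq_intros refl | simp)+
  qed (use bl in auto)
qed

lemma herglotz_C1:
  fixes k :: real
  assumes f: "continuous_on {-pi..pi} f"
  shows "C1_with_partials (herglotz k f) (herglotz k (\<lambda>\<theta>. \<i> * of_real k * of_real (cos \<theta>) * f \<theta>)) (herglotz k (\<lambda>\<theta>. \<i> * of_real k * of_real (sin \<theta>) * f \<theta>))"
proof -
  have "continuous_on UNIV (herglotz k g)" if "continuous_on {-pi..pi} g" for g
    by (rule continuous_at_imp_continuous_on) (use herglotz_has_derivative[OF that] has_derivative_continuous in blast)
  then show ?thesis unfolding C1_with_partials_def
    by (intro conjI allI herglotz_has_derivative f) (simp_all add: continuous_intros f)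
qed

text \<open>The Helmholtz equation: two derivatives multiply the density by the squares of
  \<open>\<i> k cos\<close> and \<open>\<i> k sin\<close>, and the squares of cosine and sine sum to
  1.\<close>

lemma herglotz_laplace:
  fixes k :: real
  assumes f: "continuous_on {-pi..pi} f"
  shows "herglotz k (\<lambda>\<theta>. \<i> * of_real k * of_real (cos \<theta>) * (\<i> * of_real k * of_real (cos \<theta>) * f \<theta>)) x + herglotz k (\<lambda>\<theta>. \<i> * of_real k * of_real (sin \<theta>) * (\<i> * of_real k * of_real (sin \<theta>) * f \<theta>)) x
    = - of_real (k\<^sup>2) * herglotz k f x"
proof -
  have sc: "complex_of_real (cos \<theta>) * complex_of_real (cos \<theta>) + complex_of_real (sin \<theta>) * complex_of_real (sin \<theta>) = 1" for \<theta>
    using sin_cos_squared_add3[of \<theta>] by (metis of_real_1 of_real_add of_real_mult)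
  have "herglotz k (\<lambda>\<theta>. \<i> * of_real k * of_real (cos \<theta>) * (\<i> * of_real k * of_real (cos \<theta>) * f \<theta>)) x + herglotz k (\<lambda>\<theta>. \<i> * of_real k * of_real (sin \<theta>) * (\<i> * of_real k * of_real (sin \<theta>) * f \<theta>)) x =
    integral {-pi..pi} (\<lambda>\<theta>. \<i> * of_real k * of_real (cos \<theta>) * (\<i> * of_real k * of_real (cos \<theta>) * f \<theta>) * cis (k * (unitvec \<theta> \<bullet> x)) + \<i> * of_real k * of_real (sin \<theta>) * (\<i> * of_real k * of_real (sin \<theta>) * f \<theta>) * cis (k * (unitvec \<theta> \<bullet> x)))"
    unfolding herglotz_cis
    by (subst Henstock_Kurzweil_Integration.integral_add) (rule refl integrable_continuous_real continuous_intros f)+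
  also have "\<dots> = integral {-pi..pi} (\<lambda>\<theta>. - of_real (k\<^sup>2) * (f \<theta> * cis (k * (unitvec \<theta> \<bullet> x))))"
  proof (rule integral_cong)
    fix \<theta>
    define c s where "c = complex_of_real (cos \<theta>)" and "s = complex_of_real (sin \<theta>)"
    have "\<i> * of_real k * c * (\<i> * of_real k * c * f \<theta>) * cis (k * (unitvec \<theta> \<bullet> x)) + \<i> * of_real k * s * (\<i> * of_real k * s * f \<theta>) * cis (k * (unitvec \<theta> \<bullet> x))
      = (\<i> * \<i>) * (of_real k * of_real k) * (c * c + s * s) * (f \<theta> * cis (k * (unitvec \<theta> \<bullet> x)))" by (simp only: ring_distribs mult_ac)
    also have "\<dots> = - of_real (k\<^sup>2) * (f \<theta> * cis (k * (unitvec \<theta> \<bullet> x)))" using sc[of \<theta>] by (simp add: c_def s_def power2_eq_square)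
    finally show "\<i> * of_real k * of_real (cos \<theta>) * (\<i> * of_real k * of_real (cos \<theta>) * f \<theta>) * cis (k * (unitvec \<theta> \<bullet> x)) + \<i> * of_real k * of_real (sin \<theta>) * (\<i> * of_real k * of_real (sin \<theta>) * f \<theta>) * cis (k * (unitvec \<theta> \<bullet> x)) =
         - of_real (k\<^sup>2) * (f \<theta> * cis (k * (unitvec \<theta> \<bullet> x)))" by (simp add: c_def s_def)
  qed
  finally show ?thesis unfolding herglotz_cis integral_mult_right .
qed

lemma dirderiv_C1:
  assumes "C1_with_partials f d1 d2"
  shows "dirderiv f x e = of_real (fst e) * d1 x + of_real (snd e) * d2 x"
proof -
  have 1: "((\<lambda>s::real. x + s *\<^sub>R e) has_derivative (\<lambda>s. s *\<^sub>R e)) (at 0)"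
    by (auto intro!: derivative_eq_intros)
  have "((\<lambda>s::real. f (x + s *\<^sub>R e)) has_derivative (\<lambda>s. of_real (fst (s *\<^sub>R e)) * d1 x + of_real (snd (s *\<^sub>R e)) * d2 x)) (at 0)"
    using has_derivative_compose[OF 1, of f] C1_with_partialsD(1)[OF assms, of x] by fastforce
  then have "((\<lambda>s::real. f (x + s *\<^sub>R e)) has_vector_derivative (of_real (fst e) * d1 x + of_real (snd e) * d2 x)) (at 0)"
    unfolding has_vector_derivative_def by (rule has_derivative_eq_rhs) (auto simp: scaleR_conv_of_real algebra_simps)
  then show ?thesis unfolding dirderiv_def by (rule vector_derivative_at)
qed

lemma C1_with_partials_mult:
  assumes f: "C1_with_partials f f1 f2" and g: "C1_with_partials g g1 g2"
  shows "C1_with_partials (\<lambda>x. f x * g x) (\<lambda>x. f x * g1 x + f1 x * g x) (\<lambda>x. f x * g2 x + f2 x * g x)"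
proof -
  note F = C1_with_partialsD[OF f] and G = C1_with_partialsD[OF g]
  show ?thesis unfolding C1_with_partials_def
    by (intro conjI allI continuous_intros F G has_derivative_eq_rhs[OF has_derivative_mult[OF F(1) G(1)]])
      (auto simp: algebra_simps)
qed

lemma continuous_compose_UNIV:
  "continuous_on UNIV g \<Longrightarrow> continuous_on S f \<Longrightarrow> continuous_on S (\<lambda>x. g (f x))"
  by (rule continuous_on_compose2) auto

section \<open>The divergence theorem on a disk\<close>

lemma chord_integral:
  fixes g g' :: "real \<Rightarrow> complex"
  assumes d: "\<And>x. (g has_vector_derivative g' x) (at x)" and c: "continuous_on UNIV g'"
  shows "(LINT x|lborel. indicator {a - s<..<a + s} x *\<^sub>R g' x) = (if 0 \<le> s then g (a + s) - g (a - s) else 0)"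
proof (cases "0 \<le> s")
  case True
  have "set_integrable lborel {a - s..a + s} g'"
    unfolding set_integrable_def by (intro borel_integrable_compact continuous_on_subset[OF c]) auto
  then have i: "set_integrable lborel {a - s<..<a + s} g'"
    by (rule set_integrable_subset) auto
  have "(LINT x|lborel. indicator {a - s<..<a + s} x *\<^sub>R g' x) = integral {a - s<..<a + s} g'"
    using set_borel_integral_eq_integral(2)[OF i] by (simp add: set_lebesgue_integral_def)
  also have "\<dots> = integral {a - s..a + s} g'" by (rule integral_open_interval_real[symmetric])
  also have "\<dots> = g (a + s) - g (a - s)"
    by (intro integral_unique fundamental_theorem_of_calculus has_vector_derivative_at_within[OF d]) (use True in auto)
  finally show ?thesis using True by simp
qed auto

text \<open>Integrate along horizontal chords, then put \<open>y = b + R * sin t\<close>. The right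
  ends of the chords run through the right half circle, the left ends through the left half, where
  the negative cosine supplies the minus sign.\<close>

lemma slices_to_circle:
  fixes g g' :: "real \<Rightarrow> real \<Rightarrow> complex"
  assumes d: "\<And>x y. ((\<lambda>x. g x y) has_vector_derivative g' x y) (at x)"
    and c: "continuous_on UNIV (\<lambda>(x, y). g x y)" and c': "continuous_on UNIV (\<lambda>(x, y). g' x y)"
    and R: "R > 0"
  shows "(LINT y|lborel. LINT x|lborel. indicator {(x, y). (x - a)\<^sup>2 + (y - b)\<^sup>2 < R\<^sup>2} (x, y) *\<^sub>R g' x y)
    = integral {-pi..pi} (\<lambda>t. g (a + R * cos t) (b + R * sin t) * of_real (R * cos t))"
proof -
  \<comment> \<open>\<open>sqrt\<close> of a negative number is negative, so \<open>s y < 0\<close>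
    exactly when the line misses the closed disk; the chord interval is then empty.\<close>
  define s where "s y = sqrt (R\<^sup>2 - (y - b)\<^sup>2)" for y
  define G where "G y = g (a + s y) y - g (a - s y) y" for y
  have cg: "continuous_on S (\<lambda>x. g (u x) (v x))" if "continuous_on S u" "continuous_on S v" for u v :: "real \<Rightarrow> real" and S
    using continuous_compose_UNIV[OF c continuous_on_Pair[OF that]] by simp
  have cg': "continuous_on S (\<lambda>x. g' (u x) (v x))" if "continuous_on S u" "continuous_on S v" for u v :: "real \<Rightarrow> real" and S
    using continuous_compose_UNIV[OF c' continuous_on_Pair[OF that]] by simp
  have inner: "(LINT x|lborel. indicator {(x, y). (x - a)\<^sup>2 + (y - b)\<^sup>2 < R\<^sup>2} (x, y) *\<^sub>R g' x y)
     = indicator {b - R..b + R} y *\<^sub>R G y" for y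
  proof -
    have "((x - a)\<^sup>2 + (y - b)\<^sup>2 < R\<^sup>2) \<longleftrightarrow> x \<in> {a - s y<..<a + s y}" for x
    proof -
      have "(x - a)\<^sup>2 + (y - b)\<^sup>2 < R\<^sup>2 \<longleftrightarrow> (x - a)\<^sup>2 < R\<^sup>2 - (y - b)\<^sup>2" by linarith
      also have "\<dots> \<longleftrightarrow> sqrt ((x - a)\<^sup>2) < s y" unfolding s_def by (simp only: real_sqrt_less_iff)
      also have "\<dots> \<longleftrightarrow> x \<in> {a - s y<..<a + s y}" by auto
      finally show ?thesis .
    qed
    then have "(LINT x|lborel. indicator {(x, y). (x - a)\<^sup>2 + (y - b)\<^sup>2 < R\<^sup>2} (x, y) *\<^sub>R g' x y)
       = (LINT x|lborel. indicator {a - s y<..<a + s y} x *\<^sub>R g' x y)"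
      by (intro Bochner_Integration.integral_cong refl) (simp add: indicator_def)
    also have "\<dots> = (if 0 \<le> s y then G y else 0)"
      unfolding G_def by (rule chord_integral[OF d cg']) (intro continuous_intros)+
    also have "0 \<le> s y \<longleftrightarrow> y \<in> {b - R..b + R}"
      using R abs_le_square_iff[of "y - b" R] by (auto simp: s_def)
    finally show ?thesis by (simp add: indicator_def)
  qed
  have cG: "continuous_on {b - R..b + R} G"
    unfolding G_def s_def by (intro continuous_intros cg)
  define h where "h t = g (a + R * cos t) (b + R * sin t) * of_real (R * cos t)" for t
  have h: "cper h" unfolding h_def cper_def by (auto intro!: continuous_intros cg)
  have hr: "continuous_on S (\<lambda>t. h (pi - t))" for S
    by (rule continuous_compose_UNIV[OF cper_cont[OF h]]) (intro continuous_intros)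
  have "(LINT y|lborel. LINT x|lborel. indicator {(x, y). (x - a)\<^sup>2 + (y - b)\<^sup>2 < R\<^sup>2} (x, y) *\<^sub>R g' x y)
     = (LINT y : {b - R..b + R} | lborel. G y)"
    unfolding inner set_lebesgue_integral_def ..
  also have "\<dots> = integral {b - R..b + R} G"
    by (rule set_borel_integral_eq_integral(2)) (auto simp: set_integrable_def intro!: borel_integrable_compact cG)
  also have "\<dots> = integral {-pi/2..pi/2} (\<lambda>t. (R * cos t) *\<^sub>R G (b + R * sin t))"
  proof -
    have "((\<lambda>t. (R * cos t) *\<^sub>R G (b + R * sin t)) has_integral (integral {b + R * sin (-pi/2)..b + R * sin (pi/2)} G)) {-pi/2..pi/2}"
    proof (rule has_integral_substitution[where c = "b - R" and d = "b + R"])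
      show "(\<lambda>x. b + R * sin x) ` {-pi/2..pi/2} \<subseteq> {b - R..b + R}"
        using R mult_left_mono[of _ 1 R] mult_left_mono[of "-1" _ R] by (auto simp: sin_le_one sin_ge_minus_one)
    qed (use R cG in \<open>auto intro!: derivative_eq_intros\<close>)
    then show ?thesis by (simp add: integral_unique)
  qed
  also have "\<dots> = integral {-pi/2..pi/2} (\<lambda>t. h t + h (pi - t))"
  proof (rule integral_cong)
    fix t assume t: "t \<in> {-pi/2..pi/2}"
    have ct: "0 \<le> cos t" using t by (intro cos_ge_zero) auto
    have "R\<^sup>2 - (R * sin t)\<^sup>2 = (R * cos t)\<^sup>2"
      by (simp add: power_mult_distrib cos_squared_eq algebra_simps)
    then have "s (b + R * sin t) = R * cos t" using R ct by (simp add: s_def)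
    then show "(R * cos t) *\<^sub>R G (b + R * sin t) = h t + h (pi - t)"
      by (simp add: G_def h_def scaleR_conv_of_real algebra_simps)
  qed
  also have "\<dots> = integral {-pi/2..pi/2} h + integral {-pi/2..pi/2} (\<lambda>t. h (pi - t))"
    by (rule Henstock_Kurzweil_Integration.integral_add) (intro integrable_continuous_real hr cper_cont[OF h])+
  \<comment> \<open>Reflection and a shift by \<open>pi\<close> carry the left half circle to
    \<open>{pi/2..3*pi/2}\<close>; the joined interval is one full period, which is then moved to
    \<open>{-pi..pi}\<close>.\<close>
  also have "integral {-pi/2..pi/2} (\<lambda>t. h (pi - t)) = integral {pi/2..3*pi/2} h"
  proof -
    have "integral {-pi/2..pi/2} (\<lambda>t. h (pi - t)) = integral {-pi/2..pi/2} (\<lambda>t. h (t + pi))"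
      using Henstock_Kurzweil_Integration.integral_reflect_real[of "pi/2" "-pi/2" "\<lambda>t. h (t + pi)"] by (simp add: algebra_simps)
    also have "\<dots> = integral {-pi/2 + pi..pi/2 + pi} h"
      using integral_shift[of "-pi/2" pi "pi/2" h] cper_cont[OF h] by (simp add: o_def)
    finally show ?thesis by (simp add: field_simps)
  qed
  also have "integral {-pi/2..pi/2} h + integral {pi/2..3*pi/2} h = integral {-pi/2..3*pi/2} h"
    by (rule Henstock_Kurzweil_Integration.integral_combine) (auto intro: cper_integrable h)
  also have "\<dots> = integral {-pi..pi} (\<lambda>t. h (t + pi/2))"
    using integral_shift[of "-pi" "pi/2" pi h] cper_cont[OF h] by (simp add: o_def field_simps)
  also have "\<dots> = integral {-pi..pi} h" by (rule integral_cper_shift[OF h])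
  finally show ?thesis unfolding h_def .
qed

lemma set_integrable_ball:
  fixes g :: "pt \<Rightarrow> complex"
  assumes "continuous_on UNIV g"
  shows "integrable lborel (\<lambda>x. indicator (ball x0 R) x *\<^sub>R g x)"
proof -
  have "set_integrable lborel (cball x0 R) g"
    unfolding set_integrable_def by (intro borel_integrable_compact continuous_on_subset[OF assms]) auto
  then have "set_integrable lborel (ball x0 R) g" by (rule set_integrable_subset) auto
  then show ?thesis by (simp add: set_integrable_def)
qed

lemma set_integrable_lebesgue_ball:
  fixes g :: "pt \<Rightarrow> complex"
  assumes "continuous_on UNIV g"
  shows "set_integrable lebesgue (ball x0 R) g"
  unfolding set_integrable_def using set_integrable_ball[OF assms] by (rule integrable_completion[THEN iffD2, rotated]) (use set_integrable_ball[OF assms] in auto)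

lemma set_integral_ball_lborel:
  fixes g :: "pt \<Rightarrow> complex"
  assumes "continuous_on UNIV g"
  shows "set_lebesgue_integral lebesgue (ball x0 R) g = (LINT x|lborel. indicator (ball x0 R) x *\<^sub>R g x)"
  unfolding set_lebesgue_integral_def
  by (rule integral_completion) (use set_integrable_ball[OF assms] in auto)

lemma mem_ball_pt: "R > 0 \<Longrightarrow> (x, y) \<in> ball (a, b) R \<longleftrightarrow> (x - a)\<^sup>2 + (y - b)\<^sup>2 < R\<^sup>2" for a b x y :: real
proof -
  assume R: "R > 0"
  have "(x, y) \<in> ball (a, b) R \<longleftrightarrow> sqrt ((x - a)\<^sup>2 + (y - b)\<^sup>2) < R"
    by (simp add: dist_Pair_Pair dist_real_def power2_commute)
  also have "\<dots> \<longleftrightarrow> (x - a)\<^sup>2 + (y - b)\<^sup>2 < R\<^sup>2" using R by (metis abs_of_pos real_sqrt_abs real_sqrt_less_iff)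
  finally show ?thesis .
qed

lemma partial_derivatives:
  assumes f: "C1_with_partials f d1 d2"
  shows "((\<lambda>x. f (x, y)) has_vector_derivative d1 (x, y)) (at x)"
    "((\<lambda>y. f (x, y)) has_vector_derivative d2 (x, y)) (at y)"
proof -
  have "((\<lambda>x. (x, y)) has_derivative (\<lambda>h. (h, 0))) (at x)" by (auto intro!: derivative_eq_intros)
  from has_derivative_compose[OF this C1_with_partialsD(1)[OF f]]
  show "((\<lambda>x. f (x, y)) has_vector_derivative d1 (x, y)) (at x)"
    by (simp add: has_vector_derivative_def scaleR_conv_of_real)
  have "((\<lambda>y. (x, y)) has_derivative (\<lambda>h. (0, h))) (at y)" by (auto intro!: derivative_eq_intros)
  from has_derivative_compose[OF this C1_with_partialsD(1)[OF f]]
  show "((\<lambda>y. f (x, y)) has_vector_derivative d2 (x, y)) (at y)"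
    by (simp add: has_vector_derivative_def scaleR_conv_of_real)
qed

lemma divergence_disk_1:
  assumes f: "C1_with_partials f d1 d2" and R: "R > 0"
  shows "set_lebesgue_integral lebesgue (ball x0 R) d1 =
    integral {-pi..pi} (\<lambda>t. f (x0 + R *\<^sub>R unitvec t) * of_real (R * cos t))"
proof -
  obtain a b where x0: "x0 = (a, b)" by (cases x0)
  note F = C1_with_partialsD[OF f]
  have "set_lebesgue_integral lebesgue (ball x0 R) d1 = (LINT x|lborel. indicator (ball x0 R) x *\<^sub>R d1 x)"
    by (rule set_integral_ball_lborel[OF F(3)])
  also have "\<dots> = integral\<^sup>L (pair_measure lborel lborel) (\<lambda>(x, y). indicator (ball x0 R) (x, y) *\<^sub>R d1 (x, y))"
    unfolding lborel_prod by (simp add: split_def)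
  also have "\<dots> = (LINT y|lborel. LINT x|lborel. indicator (ball x0 R) (x, y) *\<^sub>R d1 (x, y))"
    by (rule lborel_pair.integral_snd[symmetric]) (use set_integrable_ball[OF F(3)] in \<open>simp add: lborel_prod split_def\<close>)
  also have "\<dots> = (LINT y|lborel. LINT x|lborel. indicator {(x, y). (x - a)\<^sup>2 + (y - b)\<^sup>2 < R\<^sup>2} (x, y) *\<^sub>R d1 (x, y))"
    unfolding x0 indicator_def mem_ball_pt[OF R] by simp
  also have "\<dots> = integral {-pi..pi} (\<lambda>t. f (a + R * cos t, b + R * sin t) * of_real (R * cos t))"
    by (rule slices_to_circle) (use partial_derivatives[OF f] F R in \<open>auto\<close>)
  finally show ?thesis by (simp add: x0 unitvec_def)
qed

lemma divergence_disk_2: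
  assumes f: "C1_with_partials f d1 d2" and R: "R > 0"
  shows "set_lebesgue_integral lebesgue (ball x0 R) d2 =
    integral {-pi..pi} (\<lambda>t. f (x0 + R *\<^sub>R unitvec t) * of_real (R * sin t))"
proof -
  obtain a b where x0: "x0 = (a, b)" by (cases x0)
  note F = C1_with_partialsD[OF f]
  have sw: "continuous_on UNIV (\<lambda>(y, x). g (x, y))" if "continuous_on UNIV g" for g :: "pt \<Rightarrow> complex"
    unfolding split_def by (intro continuous_compose_UNIV[OF that] continuous_intros)
  have "set_lebesgue_integral lebesgue (ball x0 R) d2 = (LINT x|lborel. indicator (ball x0 R) x *\<^sub>R d2 x)"
    by (rule set_integral_ball_lborel[OF F(4)])
  also have "\<dots> = integral\<^sup>L (pair_measure lborel lborel) (\<lambda>(x, y). indicator (ball x0 R) (x, y) *\<^sub>R d2 (x, y))"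
    unfolding lborel_prod by (simp add: split_def)
  also have "\<dots> = (LINT x|lborel. LINT y|lborel. indicator (ball x0 R) (x, y) *\<^sub>R d2 (x, y))"
    by (rule lborel_pair.integral_fst[symmetric]) (use set_integrable_ball[OF F(4)] in \<open>simp add: lborel_prod split_def\<close>)
  also have "\<dots> = (LINT x|lborel. LINT y|lborel. indicator {(y, x). (y - b)\<^sup>2 + (x - a)\<^sup>2 < R\<^sup>2} (y, x) *\<^sub>R d2 (x, y))"
    unfolding x0 indicator_def mem_ball_pt[OF R] by (simp add: add.commute)
  \<comment> \<open>The slicing lemma is applied with the coordinates exchanged, so the circle
    appears with sine and cosine exchanged; \<open>t \<mapsto> pi/2 - t\<close> restores the usual
    parametrisation.\<close>
  also have "\<dots> = integral {-pi..pi} (\<lambda>t. f (a + R * sin t, b + R * cos t) * of_real (R * cos t))"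
    by (rule slices_to_circle) (use partial_derivatives[OF f] sw[OF F(2)] sw[OF F(4)] R in auto)
  also have "\<dots> = integral {-pi..pi} (\<lambda>t. f (a + R * cos t, b + R * sin t) * of_real (R * sin t))"
  proof -
    define h where "h t = f (a + R * cos t, b + R * sin t) * of_real (R * sin t)" for t
    have h: "cper h" unfolding h_def cper_def by (auto intro!: continuous_intros continuous_compose_UNIV[OF F(2)])
    have "integral {-pi..pi} (\<lambda>t. f (a + R * sin t, b + R * cos t) * of_real (R * cos t)) = integral {-pi..pi} (\<lambda>t. h (- t + pi/2))"
      by (simp add: h_def sin_diff cos_diff)
    also have "\<dots> = integral {-pi..pi} (\<lambda>t. h (t + pi/2))"
      by (rule integral_reflect_pi)
    also have "\<dots> = integral {-pi..pi} h" by (rule integral_cper_shift[OF h])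
    finally show ?thesis unfolding h_def .
  qed
  finally show ?thesis by (simp add: x0 unitvec_def)
qed

section \<open>Non-scattering disks\<close>

text \<open>Divergence theorem for the field with components \<open>v * p1\<close> and
  \<open>v * p2\<close>; by \<open>helm\<close> its divergence is the integrand on the left.\<close>

lemma green_disk:
  assumes v: "C1_with_partials v v1 v2" and p1: "C1_with_partials p1 p11 p12" and p2: "C1_with_partials p2 p21 p22"
    and p: "continuous_on UNIV p"
    and helm: "\<And>x. p11 x + p22 x = - c * p x" and R: "R > 0"
  shows "set_lebesgue_integral lebesgue (ball x0 R) (\<lambda>x. v1 x * p1 x + v2 x * p2 x - c * v x * p x) =
    integral {-pi..pi} (\<lambda>t. v (x0 + R *\<^sub>R unitvec t) * (of_real (cos t) * p1 (x0 + R *\<^sub>R unitvec t) + of_real (sin t) * p2 (x0 + R *\<^sub>R unitvec t)) * of_real R)"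
proof -
  note V = C1_with_partialsD[OF v] and P1 = C1_with_partialsD[OF p1] and P2 = C1_with_partialsD[OF p2]
  have cc: "continuous_on {-pi..pi} (\<lambda>t. g (x0 + R *\<^sub>R unitvec t))" if "continuous_on UNIV g" for g :: "pt \<Rightarrow> complex"
    by (intro continuous_compose_UNIV[OF that] continuous_intros)
  have "(\<lambda>x. v1 x * p1 x + v2 x * p2 x - c * v x * p x) = (\<lambda>x. (v x * p11 x + v1 x * p1 x) + (v x * p22 x + v2 x * p2 x))"
  proof
    fix x
    have "(v x * p11 x + v1 x * p1 x) + (v x * p22 x + v2 x * p2 x) = v1 x * p1 x + v2 x * p2 x + v x * (p11 x + p22 x)"
      by (simp add: algebra_simps)
    then show "v1 x * p1 x + v2 x * p2 x - c * v x * p x = (v x * p11 x + v1 x * p1 x) + (v x * p22 x + v2 x * p2 x)"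
      unfolding helm by simp
  qed
  then have "set_lebesgue_integral lebesgue (ball x0 R) (\<lambda>x. v1 x * p1 x + v2 x * p2 x - c * v x * p x) =
     set_lebesgue_integral lebesgue (ball x0 R) (\<lambda>x. v x * p11 x + v1 x * p1 x) + set_lebesgue_integral lebesgue (ball x0 R) (\<lambda>x. v x * p22 x + v2 x * p2 x)"
    by (simp only:) (intro set_integral_add set_integrable_lebesgue_ball continuous_intros V P1 P2)
  also have "\<dots> = integral {-pi..pi} (\<lambda>t. v (x0 + R *\<^sub>R unitvec t) * p1 (x0 + R *\<^sub>R unitvec t) * of_real (R * cos t))
     + integral {-pi..pi} (\<lambda>t. v (x0 + R *\<^sub>R unitvec t) * p2 (x0 + R *\<^sub>R unitvec t) * of_real (R * sin t))"
    by (simp only: divergence_disk_1[OF C1_with_partials_mult[OF v p1] R] divergence_disk_2[OF C1_with_partials_mult[OF v p2] R])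
  also have "\<dots> = integral {-pi..pi} (\<lambda>t. v (x0 + R *\<^sub>R unitvec t) * p1 (x0 + R *\<^sub>R unitvec t) * of_real (R * cos t) + v (x0 + R *\<^sub>R unitvec t) * p2 (x0 + R *\<^sub>R unitvec t) * of_real (R * sin t))"
    by (rule Henstock_Kurzweil_Integration.integral_add[symmetric])
      (intro integrable_continuous_real continuous_intros cc V P1 P2)+
  finally show ?thesis by (simp add: algebra_simps)
qed

section \<open>Square-integrable functions paired with continuous ones\<close>

lemma indicator_norm_square:
  "(\<lambda>x. (cmod (indicator S x *\<^sub>R f x))\<^sup>2) = (\<lambda>x. indicator S x *\<^sub>R (cmod (f x))\<^sup>2)"
  by (auto simp: indicator_def fun_eq_iff)

lemma L2_on_integrable: "L2_on S f \<Longrightarrow> integrable lebesgue (\<lambda>x. (cmod (indicator S x *\<^sub>R f x))\<^sup>2)"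
  unfolding L2_on_def set_integrable_def indicator_norm_square by blast

lemma L2_onI:
  assumes "(\<lambda>x. indicator S x *\<^sub>R f x) \<in> borel_measurable lebesgue"
    "integrable lebesgue (\<lambda>x. (cmod (indicator S x *\<^sub>R f x))\<^sup>2)"
  shows "L2_on S f"
  using assms unfolding L2_on_def set_integrable_def set_borel_measurable_def indicator_norm_square by blast

lemma L2_on_measurable: "L2_on S f \<Longrightarrow> (\<lambda>x. indicator S x *\<^sub>R f x) \<in> borel_measurable lebesgue"
  unfolding L2_on_def set_borel_measurable_def by blast

lemma L2_on_diff:
  assumes f: "L2_on S f" and g: "L2_on S g"
  shows "L2_on S (\<lambda>x. f x - g x)"
proof (rule L2_onI)
  have e: "(\<lambda>x. indicator S x *\<^sub>R (f x - g x)) = (\<lambda>x. indicator S x *\<^sub>R f x - indicator S x *\<^sub>R g x)"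
    by (simp add: scaleR_diff_right)
  show m: "(\<lambda>x. indicator S x *\<^sub>R (f x - g x)) \<in> borel_measurable lebesgue"
    unfolding e by (intro borel_measurable_diff L2_on_measurable f g)
  show "integrable lebesgue (\<lambda>x. (cmod (indicator S x *\<^sub>R (f x - g x)))\<^sup>2)"
  proof (rule Bochner_Integration.integrable_bound)
    show "integrable lebesgue (\<lambda>x. 2 * (cmod (indicator S x *\<^sub>R f x))\<^sup>2 + 2 * (cmod (indicator S x *\<^sub>R g x))\<^sup>2)"
      by (intro Bochner_Integration.integrable_add integrable_mult_right L2_on_integrable f g)
    show "(\<lambda>x. (cmod (indicator S x *\<^sub>R (f x - g x)))\<^sup>2) \<in> borel_measurable lebesgue"
      using m by measurable
    show "AE x in lebesgue. norm ((cmod (indicator S x *\<^sub>R (f x - g x)))\<^sup>2) \<le> norm (2 * (cmod (indicator S x *\<^sub>R f x))\<^sup>2 + 2 * (cmod (indicator S x *\<^sub>R g x))\<^sup>2)"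
    proof (rule AE_I2)
      fix x
      show "norm ((cmod (indicator S x *\<^sub>R (f x - g x)))\<^sup>2) \<le> norm (2 * (cmod (indicator S x *\<^sub>R f x))\<^sup>2 + 2 * (cmod (indicator S x *\<^sub>R g x))\<^sup>2)"
        using norm_add_squared_le[of "f x" "- g x"] by (auto simp: indicator_def)
    qed
  qed
qed

lemma L2_on_continuous:
  assumes "continuous_on UNIV (g :: pt \<Rightarrow> complex)"
  shows "L2_on (ball x0 R) g"
proof (rule L2_onI)
  show "(\<lambda>x. indicator (ball x0 R) x *\<^sub>R g x) \<in> borel_measurable lebesgue"
    using set_integrable_lebesgue_ball[OF assms] unfolding set_integrable_def by (rule borel_measurable_integrable)
  have "set_integrable lebesgue (ball x0 R) (\<lambda>x. of_real ((cmod (g x))\<^sup>2) :: complex)"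
    by (intro set_integrable_lebesgue_ball continuous_intros assms)
  then have "integrable lebesgue (\<lambda>x. norm (indicator (ball x0 R) x *\<^sub>R (of_real ((cmod (g x))\<^sup>2) :: complex)))"
    unfolding set_integrable_def by (rule integrable_norm)
  then show "integrable lebesgue (\<lambda>x. (cmod (indicator (ball x0 R) x *\<^sub>R g x))\<^sup>2)"
    unfolding indicator_norm_square by (simp add: indicator_def norm_power if_distrib cong: if_cong)
qed

text \<open>The bound \<open>t \<le> d + t\<^sup>2 / d\<close> replaces Cauchy-Schwarz. The free
  \<open>d\<close> is later matched to the size of \<open>h\<close>, which makes the pairing small
  when the square norm is small.\<close>

lemma L2_pairing:
  assumes h: "L2_on (ball x0 R) h" and c: "continuous_on UNIV (c :: pt \<Rightarrow> complex)"
    and M: "\<And>x. x \<in> ball x0 R \<Longrightarrow> cmod (c x) \<le> M" and M0: "M \<ge> 0" and d: "d > 0"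
  shows "set_integrable lebesgue (ball x0 R) (\<lambda>x. h x * c x)"
    and "cmod (set_lebesgue_integral lebesgue (ball x0 R) (\<lambda>x. h x * c x)) \<le>
      M * (d * measure lebesgue (ball x0 R) + set_lebesgue_integral lebesgue (ball x0 R) (\<lambda>x. (cmod (h x))\<^sup>2) / d)"
proof -
  let ?B = "ball x0 R"
  have i1: "integrable lebesgue (indicator ?B :: pt \<Rightarrow> real)" 
    by (rule integrable_real_indicator) (use emeasure_bounded_finite[OF bounded_ball[of x0 R]] in auto)
  have i2: "integrable lebesgue (\<lambda>x. indicator ?B x *\<^sub>R (cmod (h x))\<^sup>2)"
    using h unfolding L2_on_def set_integrable_def by blast
  have ib: "integrable lebesgue (\<lambda>x. M * (d * indicator ?B x + (indicator ?B x *\<^sub>R (cmod (h x))\<^sup>2) / d))"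
    by (intro integrable_mult_right Bochner_Integration.integrable_add integrable_divide i1 i2)
  have am: "t \<le> d + t\<^sup>2 / d" for t :: real
  proof -
    have "d * t \<le> d\<^sup>2 + t\<^sup>2" using sum_squares_bound[of d t] zero_le_power2[of d] zero_le_power2[of t] by linarith
    then show ?thesis using d by (simp add: field_simps power2_eq_square)
  qed
  have bd: "norm (indicator ?B x *\<^sub>R (h x * c x)) \<le> M * (d * indicator ?B x + (indicator ?B x *\<^sub>R (cmod (h x))\<^sup>2) / d)" for x
  proof (cases "x \<in> ?B")
    case True
    have "cmod (h x) * cmod (c x) \<le> (d + (cmod (h x))\<^sup>2 / d) * M"
      using d by (intro mult_mono am M[OF True]) (auto intro!: add_nonneg_nonneg)
    then show ?thesis using True by (simp add: norm_mult mult.commute)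
  qed (auto simp: indicator_def)
  have m: "(\<lambda>x. indicator ?B x *\<^sub>R (h x * c x)) \<in> borel_measurable lebesgue"
  proof -
    have "(\<lambda>x. (indicator ?B x *\<^sub>R h x) * (indicator ?B x *\<^sub>R c x)) \<in> borel_measurable lebesgue"
      by (intro borel_measurable_times L2_on_measurable[OF h] L2_on_measurable[OF L2_on_continuous[OF c]])
    also have "(\<lambda>x. (indicator ?B x *\<^sub>R h x) * (indicator ?B x *\<^sub>R c x)) = (\<lambda>x. indicator ?B x *\<^sub>R (h x * c x))"
      by (auto simp: indicator_def)
    finally show ?thesis .
  qed
  have nb: "norm (indicator ?B x *\<^sub>R (h x * c x)) \<le> norm (M * (d * indicator ?B x + (indicator ?B x *\<^sub>R (cmod (h x))\<^sup>2) / d))" for x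
    using order_trans[OF bd abs_ge_self] by simp
  show i: "set_integrable lebesgue ?B (\<lambda>x. h x * c x)"
    unfolding set_integrable_def by (rule Bochner_Integration.integrable_bound[OF ib m AE_I2]) (rule nb)
  have "cmod (set_lebesgue_integral lebesgue ?B (\<lambda>x. h x * c x)) \<le> (LINT x|lebesgue. M * (d * indicator ?B x + (indicator ?B x *\<^sub>R (cmod (h x))\<^sup>2) / d))"
    unfolding set_lebesgue_integral_def
    by (rule Bochner_Integration.integral_norm_bound_integral[OF i[unfolded set_integrable_def] ib bd])
  also have "\<dots> = M * (d * measure lebesgue ?B + set_lebesgue_integral lebesgue ?B (\<lambda>x. (cmod (h x))\<^sup>2) / d)"
  proof -
    have "(LINT x|lebesgue. d * indicator ?B x + (indicator ?B x *\<^sub>R (cmod (h x))\<^sup>2) / d) = (LINT x|lebesgue. d * indicator ?B x) + (LINT x|lebesgue. (indicator ?B x *\<^sub>R (cmod (h x))\<^sup>2) / d)"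
      by (intro Bochner_Integration.integral_add integrable_mult_right integrable_divide i1 i2)
    then show ?thesis by (simp add: set_lebesgue_integral_def)
  qed
  finally show "cmod (set_lebesgue_integral lebesgue ?B (\<lambda>x. h x * c x)) \<le>
      M * (d * measure lebesgue ?B + set_lebesgue_integral lebesgue ?B (\<lambda>x. (cmod (h x))\<^sup>2) / d)" .
qed

lemma continuous_bounded_ball:
  assumes "continuous_on UNIV (c :: pt \<Rightarrow> complex)"
  shows "\<exists>M\<ge>0. \<forall>x\<in>ball x0 R. cmod (c x) \<le> M"
proof -
  have "bounded (c ` cball x0 R)"
    by (intro compact_imp_bounded compact_continuous_image continuous_on_subset[OF assms]) auto
  then obtain M where M: "\<And>x. x \<in> cball x0 R \<Longrightarrow> cmod (c x) \<le> M" unfolding bounded_iff by (metis imageI)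
  then have "\<forall>x\<in>ball x0 R. cmod (c x) \<le> \<bar>M\<bar>" by (auto intro: order_trans[OF M] simp: less_imp_le)
  then show ?thesis by (intro exI[of _ "\<bar>M\<bar>"]) auto
qed

lemma test_fun_boundary:
  assumes "test_fun (ball x0 R) w d1 d2" and "R > 0"
  shows "w (x0 + R *\<^sub>R unitvec t) = 0"
proof (rule ccontr)
  assume "w (x0 + R *\<^sub>R unitvec t) \<noteq> 0"
  then have "x0 + R *\<^sub>R unitvec t \<in> closure {x. w x \<noteq> 0}" by (intro subsetD[OF closure_subset]) simp
  moreover have "closure {x. w x \<noteq> 0} \<subseteq> ball x0 R" using assms(1) by (simp add: test_fun_def)
  ultimately have "x0 + R *\<^sub>R unitvec t \<in> ball x0 R" by (rule subsetD[rotated])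
  then show False using assms(2) by (simp add: dist_norm)
qed

lemma weak_limit_pairing:
  assumes u: "L2_on (ball x0 R) u" and v: "continuous_on UNIV v" and w: "\<And>n. continuous_on UNIV (w n)"
    and c: "continuous_on UNIV c"
    and lim: "(\<lambda>n. L2_dist2 (ball x0 R) (w n) (\<lambda>x. u x - v x)) \<longlonglongrightarrow> 0"
  shows "(\<lambda>n. set_lebesgue_integral lebesgue (ball x0 R) (\<lambda>x. w n x * c x)) \<longlonglongrightarrow>
     set_lebesgue_integral lebesgue (ball x0 R) (\<lambda>x. u x * c x) - set_lebesgue_integral lebesgue (ball x0 R) (\<lambda>x. v x * c x)"
    (is "?W \<longlonglongrightarrow> ?L")
proof -
  let ?B = "ball x0 R"
  obtain M where M: "M \<ge> 0" "\<And>x. x \<in> ?B \<Longrightarrow> cmod (c x) \<le> M" using continuous_bounded_ball[OF c] by blast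
  have h: "L2_on ?B (\<lambda>x. w n x - (u x - v x))" for n
    by (intro L2_on_diff u L2_on_continuous v w)
  have iu: "set_integrable lebesgue ?B (\<lambda>x. u x * c x)" by (rule L2_pairing(1)[OF u c M(2) M(1), of 1]) auto
  have iv: "set_integrable lebesgue ?B (\<lambda>x. v x * c x)" by (intro set_integrable_lebesgue_ball continuous_intros v c)
  have iw: "set_integrable lebesgue ?B (\<lambda>x. w n x * c x)" for n by (intro set_integrable_lebesgue_ball continuous_intros w c)
  have eq: "set_lebesgue_integral lebesgue ?B (\<lambda>x. (w n x - (u x - v x)) * c x) = ?W n - ?L" for n
  proof -
    have "set_lebesgue_integral lebesgue ?B (\<lambda>x. (w n x - (u x - v x)) * c x) = set_lebesgue_integral lebesgue ?B (\<lambda>x. w n x * c x - (u x * c x - v x * c x))"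
      by (simp add: left_diff_distrib)
    also have "\<dots> = ?W n - ?L"
      using iu iv iw by (simp add: set_integral_diff)
    finally show ?thesis .
  qed
  have est: "cmod (?W n - ?L) \<le> M * (d * measure lebesgue ?B + L2_dist2 ?B (w n) (\<lambda>x. u x - v x) / d)" if "d > 0" for d n
    using L2_pairing(2)[OF h[of n] c M(2) M(1) that] unfolding eq L2_dist2_def by simp
  show ?thesis
  proof (rule LIMSEQ_I)
    fix e :: real assume e: "e > 0"
    \<comment> \<open>With the squared distance below \<open>d * d\<close>,
      \<open>L2_pairing\<close> gives at most \<open>d * (M * measure lebesgue ?B + M)\<close>,
      which is less than \<open>d * K = e / 2\<close>.\<close>
    define K where "K = M * measure lebesgue ?B + M + 1"
    have K: "K > 0" using M(1) by (simp add: K_def add_nonneg_pos)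
    define d where "d = e / (2 * K)"
    have d: "d > 0" using e K by (simp add: d_def)
    obtain N where N: "\<And>n. n \<ge> N \<Longrightarrow> \<bar>L2_dist2 ?B (w n) (\<lambda>x. u x - v x)\<bar> < d * d"
      using LIMSEQ_D[OF lim, of "d * d"] d by auto
    have "cmod (?W n - ?L) < e" if "n \<ge> N" for n
    proof -
      have "L2_dist2 ?B (w n) (\<lambda>x. u x - v x) / d \<le> d" using N[OF that] d by (simp add: divide_le_eq)
      then have "cmod (?W n - ?L) \<le> M * (d * measure lebesgue ?B + d)"
        using est[OF d, of n] M(1) by (meson add_left_mono mult_left_mono order_trans)
      also have "\<dots> = d * (M * measure lebesgue ?B + M)" by (simp add: algebra_simps)
      also have "\<dots> < d * K" using d by (simp add: K_def)
      also have "\<dots> < e" using e K by (simp add: d_def)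
      finally show ?thesis .
    qed
    then show "\<exists>N. \<forall>n\<ge>N. norm (?W n - ?L) < e" by blast
  qed
qed

text \<open>Green's second formula between \<open>u\<close> and \<open>p\<close>, with the Cauchy
  data of \<open>u\<close> replaced by those of the incident wave. The Neumann data enter through
  the weak form tested with \<open>p\<close>, the Dirichlet data through the approximation of
  \<open>u - v\<close> by test functions.\<close>

lemma nonscattering_boundary_identity:
  assumes ns: "nonscattering_disk x0 R q k \<phi>" and \<phi>: "continuous_on {-pi..pi} \<phi>" and R: "R > 0"
    and p: "C1_with_partials p p1 p2" and p1: "C1_with_partials p1 p11 p12" and p2: "C1_with_partials p2 p21 p22"
    and helm: "\<And>x. p11 x + p22 x = - of_real (k\<^sup>2 * q) * p x"
  shows "integral {-pi..pi} (\<lambda>t. dirderiv (herglotz k \<phi>) (x0 + R *\<^sub>R unitvec t) (unitvec t) * p (x0 + R *\<^sub>R unitvec t) * of_real R)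
    = integral {-pi..pi} (\<lambda>t. herglotz k \<phi> (x0 + R *\<^sub>R unitvec t) * dirderiv p (x0 + R *\<^sub>R unitvec t) (unitvec t) * of_real R)"
proof -
  let ?B = "ball x0 R"
  define v v1 v2 where "v = herglotz k \<phi>" and "v1 = herglotz k (\<lambda>\<theta>. \<i> * of_real k * of_real (cos \<theta>) * \<phi> \<theta>)"
    and "v2 = herglotz k (\<lambda>\<theta>. \<i> * of_real k * of_real (sin \<theta>) * \<phi> \<theta>)"
  have v: "C1_with_partials v v1 v2" unfolding v_def v1_def v2_def by (rule herglotz_C1[OF \<phi>])
  note V = C1_with_partialsD[OF v] and P = C1_with_partialsD[OF p]
  have dv: "dirderiv v x (1, 0) = v1 x" "dirderiv v x (0, 1) = v2 x" for x
    by (simp_all add: dirderiv_C1[OF v])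
  let ?I = "set_lebesgue_integral lebesgue ?B"
  let ?c = "complex_of_real (k\<^sup>2 * q)"
  obtain u g1 g2 w d1 d2 where H: "H1_with_grad ?B u g1 g2"
    and w: "\<And>n. test_fun ?B (w n) (d1 n) (d2 n)"
    and lim: "(\<lambda>n. L2_dist2 ?B (w n) (\<lambda>x. u x - v x) + L2_dist2 ?B (d1 n) (\<lambda>x. g1 x - v1 x) + L2_dist2 ?B (d2 n) (\<lambda>x. g2 x - v2 x)) \<longlonglongrightarrow> 0"
    and weak: "\<And>\<psi> e1 e2. C1_with_partials \<psi> e1 e2 \<Longrightarrow> ?I (\<lambda>x. g1 x * e1 x + g2 x * e2 x - ?c * u x * \<psi> x)
       = integral {-pi..pi} (\<lambda>t. dirderiv v (x0 + R *\<^sub>R unitvec t) (unitvec t) * \<psi> (x0 + R *\<^sub>R unitvec t) * of_real R)"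
    using ns unfolding nonscattering_disk_def Let_def v_def[symmetric] dv by blast
  have L2: "L2_on ?B u" "L2_on ?B g1" "L2_on ?B g2" using H unfolding H1_with_grad_def by blast+
  have W: "C1_with_partials (w n) (d1 n) (d2 n)" for n using w unfolding test_fun_def by blast
  note Wc = C1_with_partialsD[OF W]
  have nonneg: "L2_dist2 S f g \<ge> 0" for S f g
    unfolding L2_dist2_def set_lebesgue_integral_def by (intro Bochner_Integration.integral_nonneg) simp
  have lims: "(\<lambda>n. L2_dist2 ?B (w n) (\<lambda>x. u x - v x)) \<longlonglongrightarrow> 0" "(\<lambda>n. L2_dist2 ?B (d1 n) (\<lambda>x. g1 x - v1 x)) \<longlonglongrightarrow> 0"
    "(\<lambda>n. L2_dist2 ?B (d2 n) (\<lambda>x. g2 x - v2 x)) \<longlonglongrightarrow> 0"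
    by (rule tendsto_sandwich[OF _ _ tendsto_const lim]; intro always_eventually allI nonneg; simp add: nonneg)+
  note lw = weak_limit_pairing[OF L2(1) V(2) Wc(2) P(2) lims(1)]
    and ld1 = weak_limit_pairing[OF L2(2) V(3) Wc(3) P(3) lims(2)]
    and ld2 = weak_limit_pairing[OF L2(3) V(4) Wc(4) P(4) lims(3)]
  have split: "?I (\<lambda>x. f1 x * p1 x + f2 x * p2 x - ?c * f x * p x) = ?I (\<lambda>x. f1 x * p1 x) + ?I (\<lambda>x. f2 x * p2 x) - ?c * ?I (\<lambda>x. f x * p x)"
    if f: "L2_on ?B f" "L2_on ?B f1" "L2_on ?B f2" for f f1 f2
  proof -
    have ii: "set_integrable lebesgue ?B (\<lambda>x. h x * c x)" if hc: "L2_on ?B h" "continuous_on UNIV c" for h c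
    proof -
      obtain M where M: "M \<ge> 0" "\<And>x. x \<in> ?B \<Longrightarrow> cmod (c x) \<le> M"
        using continuous_bounded_ball[OF hc(2)] by blast
      show ?thesis by (rule L2_pairing(1)[OF hc M(2) M(1), of 1]) auto
    qed
    note I = ii[OF f(1) P(2)] ii[OF f(2) P(3)] ii[OF f(3) P(4)]
    have I4: "set_integrable lebesgue ?B (\<lambda>x. ?c * (f x * p x))" using I(1) by (intro set_integrable_mult_right) auto
    show ?thesis
      using I I4 by (simp only: mult.assoc set_integral_diff set_integral_add set_integral_mult_right)
  qed
  \<comment> \<open>Test functions vanish on the circle, so Green's formula against \<open>p\<close>
    leaves no boundary term. The limit of this identity says that \<open>u\<close> and
    \<open>v\<close> have the same bilinear form with \<open>p\<close>.\<close>
  have zero: "?I (\<lambda>x. d1 n x * p1 x) + ?I (\<lambda>x. d2 n x * p2 x) - ?c * ?I (\<lambda>x. w n x * p x) = 0" for n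
  proof -
    have "?I (\<lambda>x. d1 n x * p1 x + d2 n x * p2 x - ?c * w n x * p x) = 0"
      unfolding green_disk[OF W p1 p2 P(2) helm R] by (simp add: test_fun_boundary[OF w R])
    then show ?thesis using split[OF L2_on_continuous[OF Wc(2)] L2_on_continuous[OF Wc(3)] L2_on_continuous[OF Wc(4)]] by simp
  qed
  have "(\<lambda>n. ?I (\<lambda>x. d1 n x * p1 x) + ?I (\<lambda>x. d2 n x * p2 x) - ?c * ?I (\<lambda>x. w n x * p x)) \<longlonglongrightarrow>
    (?I (\<lambda>x. g1 x * p1 x) - ?I (\<lambda>x. v1 x * p1 x)) + (?I (\<lambda>x. g2 x * p2 x) - ?I (\<lambda>x. v2 x * p2 x)) - ?c * (?I (\<lambda>x. u x * p x) - ?I (\<lambda>x. v x * p x))"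
    by (intro tendsto_intros lw ld1 ld2)
  then have "(?I (\<lambda>x. g1 x * p1 x) - ?I (\<lambda>x. v1 x * p1 x)) + (?I (\<lambda>x. g2 x * p2 x) - ?I (\<lambda>x. v2 x * p2 x)) - ?c * (?I (\<lambda>x. u x * p x) - ?I (\<lambda>x. v x * p x)) = 0"
    unfolding zero by (simp add: LIMSEQ_const_iff)
  then have "?I (\<lambda>x. g1 x * p1 x + g2 x * p2 x - ?c * u x * p x) = ?I (\<lambda>x. v1 x * p1 x + v2 x * p2 x - ?c * v x * p x)"
    unfolding split[OF L2] split[OF L2_on_continuous[OF V(2)] L2_on_continuous[OF V(3)] L2_on_continuous[OF V(4)]]
    by (simp add: algebra_simps)
  \<comment> \<open>The form of \<open>u\<close> is evaluated by the weak equation, that of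
    \<open>v\<close> by Green's formula with the derivatives moved onto \<open>p\<close>.\<close>
  then show ?thesis
    unfolding weak[OF p] green_disk[OF v p1 p2 P(2) helm R] unfolding v_def
    by (simp add: dirderiv_C1[OF p] unitvec_def)
qed

section \<open>Separation of variables on the boundary circle\<close>

lemma fc_convolution:
  assumes K: "cper K" and even: "\<And>s. K (- s) = K s"
  shows "integral {-pi..pi} (\<lambda>\<eta>. cis (- (of_int n * \<eta>)) * K (t - \<eta>)) = cis (- (of_int n * t)) * fc K n"
proof -
  have "integral {-pi..pi} (\<lambda>\<eta>. cis (- (of_int n * \<eta>)) * K (t - \<eta>)) =
     integral {-pi..pi} (\<lambda>\<eta>. cis (- (of_int n * t)) * (K (\<eta> + - t) * cis (- (of_int n * (\<eta> + - t)))))"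
  proof (rule integral_cong)
    fix \<eta>
    have "K (t - \<eta>) = K (\<eta> + - t)" using even[of "t - \<eta>"] by simp
    moreover have "cis (- (of_int n * \<eta>)) = cis (- (of_int n * t)) * cis (- (of_int n * (\<eta> + - t)))"
      by (simp add: cis_mult algebra_simps)
    ultimately show "cis (- (of_int n * \<eta>)) * K (t - \<eta>) = cis (- (of_int n * t)) * (K (\<eta> + - t) * cis (- (of_int n * (\<eta> + - t))))"
      by simp
  qed
  also have "\<dots> = cis (- (of_int n * t)) * fc K n"
    unfolding integral_mult_right fc_def
    by (subst integral_cper_shift[of "\<lambda>x. K x * cis (- (of_int n * x))"]) (auto intro: cper_intros K)
  finally show ?thesis .
qed

text \<open>Test the boundary identity with the interior solution of angular mode \<open>n\<close>
  about \<open>x0\<close>. On the circle the incident wave is a convolution of the recentred density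
  \<open>\<Phi>\<close> with an even kernel, so each side is \<open>fc \<Phi> n\<close> times a
  product of Bessel terms, and their difference is the determinant.\<close>

lemma nonscattering_imp:
  assumes ns: "nonscattering_disk x0 R q k \<phi>" and \<phi>: "cper \<phi>" and R: "R > 0" and q: "q > 0" and k: "k > 0"
  shows "fc (\<lambda>\<theta>. \<phi> \<theta> * cis (k * (unitvec \<theta> \<bullet> x0))) n * besW (k * R) (k * sqrt q * R) n = 0"
proof -
  define \<kappa> where "\<kappa> = k * sqrt q"
  \<comment> \<open>The second factor cancels the phase at \<open>x0\<close>, so on the circle the
    wave \<open>p\<close> becomes
    \<open>cis (- (of_int n * t)) * bes (\<kappa> * R) n\<close>.\<close>
  define f where "f \<eta> = cis (- (of_int n * \<eta>)) * cis (- (\<kappa> * (unitvec \<eta> \<bullet> x0)))" for \<eta>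
  define \<Phi> where "\<Phi> \<theta> = \<phi> \<theta> * cis (k * (unitvec \<theta> \<bullet> x0))" for \<theta>
  have fc: "continuous_on S f" for S unfolding f_def by (intro continuous_intros)
  have \<phi>c: "continuous_on S \<phi>" for S by (rule cper_cont[OF \<phi>])
  have \<Phi>c: "continuous_on S \<Phi>" for S unfolding \<Phi>_def by (intro continuous_intros \<phi>c)
  let ?cf = "\<lambda>g \<theta>. \<i> * of_real \<kappa> * of_real (cos \<theta>) * g \<theta>" and ?sf = "\<lambda>g \<theta>. \<i> * of_real \<kappa> * of_real (sin \<theta>) * g \<theta>"
  have cc: "continuous_on {-pi..pi} (?cf f)" "continuous_on {-pi..pi} (?sf f)" by (intro continuous_intros fc)+
  define p where "p = herglotz \<kappa> f"
  have p: "C1_with_partials p (herglotz \<kappa> (?cf f)) (herglotz \<kappa> (?sf f))" unfolding p_def by (rule herglotz_C1[OF fc])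
  have \<kappa>2: "k\<^sup>2 * q = \<kappa>\<^sup>2" using q by (simp add: \<kappa>_def power_mult_distrib)
  let ?x = "\<lambda>t. x0 + R *\<^sub>R unitvec t"
  have id: "integral {-pi..pi} (\<lambda>t. dirderiv (herglotz k \<phi>) (?x t) (unitvec t) * p (?x t) * of_real R)
    = integral {-pi..pi} (\<lambda>t. herglotz k \<phi> (?x t) * dirderiv p (?x t) (unitvec t) * of_real R)"
    by (rule nonscattering_boundary_identity[OF ns \<phi>c R p herglotz_C1[OF cc(1)] herglotz_C1[OF cc(2)]])
      (simp only: \<kappa>2 herglotz_laplace[OF fc] p_def)
  define K where "K = (\<lambda>z s. cis (z * cos s))"
  define K' where "K' = (\<lambda>z s. \<i> * of_real (cos s) * cis (z * cos s))"
  have K: "cper (K z)" "cper (K' z)" "K z (- s) = K z s" "K' z (- s) = K' z s" for z s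
    unfolding K_def K'_def by (auto intro!: cper_intros)
  have dd: "dirderiv (herglotz l g) x (unitvec t) = integral {-pi..pi} (\<lambda>\<theta>. of_real l * (g \<theta> * (\<i> * of_real (cos (t - \<theta>)) * cis (l * (unitvec \<theta> \<bullet> x)))))"
    if g: "\<And>S. continuous_on S g" for l g x t
  proof -
    have "dirderiv (herglotz l g) x (unitvec t) = of_real (cos t) * herglotz l (\<lambda>\<theta>. \<i> * of_real l * of_real (cos \<theta>) * g \<theta>) x + of_real (sin t) * herglotz l (\<lambda>\<theta>. \<i> * of_real l * of_real (sin \<theta>) * g \<theta>) x"
      unfolding dirderiv_C1[OF herglotz_C1[OF g]] by (simp add: unitvec_def)
    also have "\<dots> = integral {-pi..pi} (\<lambda>\<theta>. of_real (cos t) * (\<i> * of_real l * of_real (cos \<theta>) * g \<theta> * cis (l * (unitvec \<theta> \<bullet> x))) + of_real (sin t) * (\<i> * of_real l * of_real (sin \<theta>) * g \<theta> * cis (l * (unitvec \<theta> \<bullet> x))))"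
      unfolding herglotz_cis integral_mult_right[symmetric]
      by (rule Henstock_Kurzweil_Integration.integral_add[symmetric]) (intro integrable_continuous_real continuous_intros g)+
    also have "\<dots> = integral {-pi..pi} (\<lambda>\<theta>. of_real l * (g \<theta> * (\<i> * of_real (cos (t - \<theta>)) * cis (l * (unitvec \<theta> \<bullet> x)))))"
      by (rule integral_cong) (simp add: cos_diff algebra_simps)
    finally show ?thesis .
  qed
  \<comment> \<open>The phase splits into its value at the centre and
    \<open>l * R * cos (t - \<theta>)\<close>; this is the source of the convolution.\<close>
  have ux: "cis (l * (unitvec \<theta> \<bullet> ?x t)) = cis (l * (unitvec \<theta> \<bullet> x0)) * K (l * R) (t - \<theta>)" for l \<theta> t
    by (simp add: K_def inner_add_right inner_unitvec cis_mult algebra_simps)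
  have v: "herglotz k \<phi> (?x t) = integral {-pi..pi} (\<lambda>\<theta>. \<Phi> \<theta> * K (k * R) (t - \<theta>))" for t
    unfolding herglotz_cis ux \<Phi>_def by (simp add: mult.assoc)
  have dv: "dirderiv (herglotz k \<phi>) (?x t) (unitvec t) = of_real k * integral {-pi..pi} (\<lambda>\<theta>. \<Phi> \<theta> * K' (k * R) (t - \<theta>))" for t
    unfolding dd[OF \<phi>c] ux integral_mult_right[symmetric] by (simp add: \<Phi>_def K_def K'_def mult_ac)
  have fK: "f \<theta> * cis (\<kappa> * (unitvec \<theta> \<bullet> x0)) = cis (- (of_int n * \<theta>))" for \<theta>
    by (simp add: f_def mult.assoc cis_mult)
  have pb: "p (?x t) = cis (- (of_int n * t)) * bes (\<kappa> * R) n" for t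
  proof -
    have "p (?x t) = integral {-pi..pi} (\<lambda>\<theta>. cis (- (of_int n * \<theta>)) * K (\<kappa> * R) (t - \<theta>))"
      unfolding p_def herglotz_cis ux mult.assoc[symmetric] fK ..
    then show ?thesis unfolding fc_convolution[OF K(1) K(3)] by (simp add: bes_def K_def)
  qed
  have dp: "dirderiv p (?x t) (unitvec t) = of_real \<kappa> * (cis (- (of_int n * t)) * bes' (\<kappa> * R) n)" for t
  proof -
    have "dirderiv p (?x t) (unitvec t) = of_real \<kappa> * integral {-pi..pi} (\<lambda>\<theta>. (f \<theta> * cis (\<kappa> * (unitvec \<theta> \<bullet> x0))) * K' (\<kappa> * R) (t - \<theta>))"
      unfolding p_def dd[OF fc] ux integral_mult_right[symmetric] by (simp add: K_def K'_def mult_ac)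
    then show ?thesis unfolding fK fc_convolution[OF K(2) K(4)] by (simp add: bes'_def K'_def)
  qed
  have conv: "integral {-pi..pi} (\<lambda>t. cis (- (of_int n * t)) * integral {-pi..pi} (\<lambda>\<theta>. \<Phi> \<theta> * L (t - \<theta>))) = fc \<Phi> n * fc L n"
    if L: "cper L" "\<And>s. L (- s) = L s" for L
  proof -
    have "integral {-pi..pi} (\<lambda>t. cis (- (of_int n * t)) * integral {-pi..pi} (\<lambda>\<theta>. \<Phi> \<theta> * L (t - \<theta>))) =
       integral {-pi..pi} (\<lambda>t. integral {-pi..pi} (\<lambda>\<theta>. cis (- (of_int n * t)) * (\<Phi> \<theta> * L (t - \<theta>))))"
      by (simp only: integral_mult_right)
    \<comment> \<open>Exchange the integrals, then let the even kernel act on the exponential by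
      \<open>fc_convolution\<close>.\<close>
    also have "\<dots> = integral {-pi..pi} (\<lambda>\<theta>. integral {-pi..pi} (\<lambda>t. cis (- (of_int n * t)) * (\<Phi> \<theta> * L (t - \<theta>))))"
      using integral_swap_continuous[of "-pi" "-pi" pi pi "\<lambda>t \<theta>. cis (- (of_int n * t)) * (\<Phi> \<theta> * L (t - \<theta>))"]
      by (simp add: split_def continuous_compose_UNIV[OF \<Phi>c] continuous_compose_UNIV[OF cper_cont[OF L(1)]] continuous_intros)
    also have "\<dots> = integral {-pi..pi} (\<lambda>\<theta>. \<Phi> \<theta> * integral {-pi..pi} (\<lambda>t. cis (- (of_int n * t)) * L (\<theta> - t)))"
    proof (rule integral_cong)
      fix \<theta>
      have "L (t - \<theta>) = L (\<theta> - t)" for t using L(2)[of "t - \<theta>"] by simp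
      then show "integral {-pi..pi} (\<lambda>t. cis (- (of_int n * t)) * (\<Phi> \<theta> * L (t - \<theta>))) = \<Phi> \<theta> * integral {-pi..pi} (\<lambda>t. cis (- (of_int n * t)) * L (\<theta> - t))"
        by (simp add: mult.left_commute flip: integral_mult_right)
    qed
    also have "\<dots> = integral {-pi..pi} (\<lambda>\<theta>. fc L n * (\<Phi> \<theta> * cis (- (of_int n * \<theta>))))"
      unfolding fc_convolution[OF L] by (simp add: mult_ac)
    finally show ?thesis by (simp add: fc_def integral_mult_right mult.commute)
  qed
  have fK': "fc (K (k * R)) n = bes (k * R) n" "fc (K' (k * R)) n = bes' (k * R) n"
    by (simp_all add: bes_def bes'_def K_def K'_def)
  have "integral {-pi..pi} (\<lambda>t. dirderiv (herglotz k \<phi>) (?x t) (unitvec t) * p (?x t) * of_real R) =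
     integral {-pi..pi} (\<lambda>t. (of_real R * of_real k * bes (\<kappa> * R) n) * (cis (- (of_int n * t)) * integral {-pi..pi} (\<lambda>\<theta>. \<Phi> \<theta> * K' (k * R) (t - \<theta>))))"
    unfolding dv pb by (simp only: mult_ac)
  also have "\<dots> = of_real R * of_real k * bes (\<kappa> * R) n * (fc \<Phi> n * bes' (k * R) n)"
    unfolding integral_mult_right conv[OF K(2) K(4)] fK' ..
  finally have 1: "integral {-pi..pi} (\<lambda>t. dirderiv (herglotz k \<phi>) (?x t) (unitvec t) * p (?x t) * of_real R) = of_real R * of_real k * bes (\<kappa> * R) n * (fc \<Phi> n * bes' (k * R) n)" .
  have "integral {-pi..pi} (\<lambda>t. herglotz k \<phi> (?x t) * dirderiv p (?x t) (unitvec t) * of_real R) =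
     integral {-pi..pi} (\<lambda>t. (of_real R * of_real \<kappa> * bes' (\<kappa> * R) n) * (cis (- (of_int n * t)) * integral {-pi..pi} (\<lambda>\<theta>. \<Phi> \<theta> * K (k * R) (t - \<theta>))))"
    unfolding v dp by (simp only: mult_ac)
  also have "\<dots> = of_real R * of_real \<kappa> * bes' (\<kappa> * R) n * (fc \<Phi> n * bes (k * R) n)"
    unfolding integral_mult_right conv[OF K(1) K(3)] fK' ..
  finally have 2: "integral {-pi..pi} (\<lambda>t. herglotz k \<phi> (?x t) * dirderiv p (?x t) (unitvec t) * of_real R) = of_real R * of_real \<kappa> * bes' (\<kappa> * R) n * (fc \<Phi> n * bes (k * R) n)" .
  have "fc \<Phi> n * besW (k * R) (\<kappa> * R) n = of_real R * of_real k * bes (\<kappa> * R) n * (fc \<Phi> n * bes' (k * R) n) - of_real R * of_real \<kappa> * bes' (\<kappa> * R) n * (fc \<Phi> n * bes (k * R) n)"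
    by (simp add: besW_def algebra_simps)
  also have "\<dots> = 0" using id unfolding 1 2 by simp
  finally show ?thesis by (simp add: \<Phi>_def[abs_def] \<kappa>_def)
qed

section \<open>Bounded wave numbers\<close>

text \<open>The extension of \<open>osc_fc\<close> to complex \<open>l\<close>, with the factor
  \<open>cis (- (n \<theta>))\<close> absorbed into \<open>h\<close>.\<close>

definition cos_transform :: "(real \<Rightarrow> complex) \<Rightarrow> complex \<Rightarrow> complex" where
  "cos_transform h z = integral {-pi..pi} (\<lambda>\<theta>. h \<theta> * exp (\<i> * z * of_real (cos \<theta>)))"

lemma cos_transform_has_field_derivative:
  assumes h: "cper h"
  shows "(cos_transform h has_field_derivative cos_transform (\<lambda>\<theta>. \<i> * (of_real (cos \<theta>) * h \<theta>)) z) (at z)"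
proof -
  have c: "continuous_on (UNIV \<times> cbox (-pi) pi) (\<lambda>(z, \<theta>). h \<theta> * (\<i> * of_real (cos \<theta>) * exp (\<i> * z * of_real (cos \<theta>))))"
    unfolding split_def
    by (intro continuous_intros continuous_compose_UNIV[OF cper_cont[OF h]])
  have "((\<lambda>z. integral (cbox (-pi) pi) (\<lambda>\<theta>. h \<theta> * exp (\<i> * z * of_real (cos \<theta>)))) has_field_derivative
      integral (cbox (-pi) pi) (\<lambda>\<theta>. h \<theta> * (\<i> * of_real (cos \<theta>) * exp (\<i> * z * of_real (cos \<theta>))))) (at z within UNIV)"
  proof (rule leibniz_rule_field_derivative[OF _ _ c])
    show "((\<lambda>z. h \<theta> * exp (\<i> * z * of_real (cos \<theta>))) has_field_derivative h \<theta> * (\<i> * of_real (cos \<theta>) * exp (\<i> * z * of_real (cos \<theta>)))) (at z within UNIV)" for z \<theta>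
      by (auto intro!: derivative_eq_intros)
    show "(\<lambda>\<theta>. h \<theta> * exp (\<i> * z * of_real (cos \<theta>))) integrable_on cbox (-pi) pi" for z
      by (intro integrable_continuous continuous_intros cper_cont[OF h])
  qed auto
  then show ?thesis unfolding cos_transform_def[abs_def] by (simp add: mult_ac)
qed

text \<open>An identically zero transform has zero derivative, and differentiating in
  \<open>z\<close> multiplies the density by \<open>\<i>\<close> times the cosine.\<close>

lemma cos_transform_zero_cos:
  assumes h: "cper h" and z: "\<And>z. cos_transform h z = 0"
  shows "cos_transform (\<lambda>\<theta>. of_real (cos \<theta>) * h \<theta>) z = 0"
proof -
  have "cos_transform h = (\<lambda>_. 0)" using z by auto
  then have "(cos_transform h has_field_derivative 0) (at z)" by simp
  then have "cos_transform (\<lambda>\<theta>. \<i> * (of_real (cos \<theta>) * h \<theta>)) z = 0"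
    using DERIV_unique[OF cos_transform_has_field_derivative[OF h]] by blast
  moreover have "cos_transform (\<lambda>\<theta>. \<i> * (of_real (cos \<theta>) * h \<theta>)) z = \<i> * cos_transform (\<lambda>\<theta>. of_real (cos \<theta>) * h \<theta>) z"
    unfolding cos_transform_def integral_mult_right[symmetric] by (simp add: mult.assoc)
  ultimately show ?thesis by simp
qed

lemma cper_cos_multiple [cper_intros]: "cper (\<lambda>\<theta>. of_real (cos (of_nat j * \<theta>)))"
proof -
  have "(\<lambda>\<theta>. complex_of_real (cos (of_nat j * \<theta>))) = (\<lambda>\<theta>. (cis (of_int (int j) * \<theta>) + cis (- (of_int (int j) * \<theta>))) * (1/2))"
    by (auto simp: complex_eq_iff)
  then show ?thesis by (simp only:) (intro cper_intros)
qed

text \<open>Chebyshev's recurrence expresses \<open>cos (j \<theta>)\<close> through multiplication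
  by \<open>cos \<theta>\<close> and the two preceding cases.\<close>

lemma cos_transform_zero_cos_multiple:
  assumes h: "cper h" and z: "\<And>z. cos_transform h z = 0"
  shows "cos_transform (\<lambda>\<theta>. of_real (cos (of_nat j * \<theta>)) * h \<theta>) z = 0"
proof (induction j arbitrary: z rule: less_induct)
  case (less j)
  consider "j = 0" | "j = 1" | k where "j = Suc (Suc k)" by (cases j; cases "j - 1") auto
  then show ?case
  proof cases
    case 1
    then show ?thesis using z by simp
  next
    case 2
    then show ?thesis using cos_transform_zero_cos[OF h z] by simp
  next
    case 3
    let ?c = "\<lambda>j \<theta>. complex_of_real (cos (of_nat j * \<theta>)) * h \<theta>"
    let ?e = "\<lambda>\<theta>. exp (\<i> * z * of_real (cos \<theta>))"
    have cp: "cper (?c j)" for j by (intro cper_intros h)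
    have e: "cos (of_nat j * \<theta>) = 2 * (cos \<theta> * cos (of_nat (Suc k) * \<theta>)) - cos (of_nat k * \<theta>)" for \<theta> :: real
    proof -
      have "of_nat j * \<theta> = of_nat (Suc k) * \<theta> + \<theta>" "of_nat k * \<theta> = of_nat (Suc k) * \<theta> - \<theta>"
        by (simp_all add: 3 algebra_simps)
      then show ?thesis by (simp only: cos_add cos_diff) simp
    qed
    have "cos_transform (?c j) z = integral {-pi..pi} (\<lambda>\<theta>. 2 * (of_real (cos \<theta>) * ?c (Suc k) \<theta> * ?e \<theta>) - ?c k \<theta> * ?e \<theta>)"
      unfolding cos_transform_def e by (rule integral_cong) (simp add: algebra_simps)
    also have "\<dots> = integral {-pi..pi} (\<lambda>\<theta>. 2 * (of_real (cos \<theta>) * ?c (Suc k) \<theta> * ?e \<theta>)) - integral {-pi..pi} (\<lambda>\<theta>. ?c k \<theta> * ?e \<theta>)"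
      by (rule Henstock_Kurzweil_Integration.integral_diff)
        (intro integrable_continuous_real continuous_intros cper_cont[OF h])+
    also have "\<dots> = 2 * cos_transform (\<lambda>\<theta>. of_real (cos \<theta>) * ?c (Suc k) \<theta>) z - cos_transform (?c k) z"
      by (simp only: cos_transform_def integral_mult_right)
    also have "\<dots> = 0"
      using cos_transform_zero_cos[OF cp[of "Suc k"] less(1)[of "Suc k"], of z] less(1)[of k z] 3 by simp
    finally show ?thesis .
  qed
qed

text \<open>At \<open>z = 0\<close> the preceding lemma makes \<open>h\<close> orthogonal to every
  \<open>cos (j \<theta>)\<close>; these integrals, doubled, are the Fourier coefficients of
  \<open>h \<theta> + h (- \<theta>)\<close>.\<close>

lemma cos_transform_zero_odd:
  assumes h: "cper h" and z: "\<And>z. cos_transform h z = 0"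
  shows "h \<theta> + h (- \<theta>) = 0"
proof (rule fc_all_zero[of "\<lambda>\<theta>. h \<theta> + h (- \<theta>)"])
  show "cper (\<lambda>\<theta>. h \<theta> + h (- \<theta>))" by (intro cper_intros h cper_reflect)
  fix n
  have "fc (\<lambda>\<theta>. h (- \<theta>)) n = integral {-pi..pi} (\<lambda>\<theta>. h \<theta> * cis (of_int n * \<theta>))"
    using integral_reflect_pi[of "\<lambda>\<theta>. h \<theta> * cis (of_int n * \<theta>)"] by (simp add: fc_def)
  then have "fc (\<lambda>\<theta>. h \<theta> + h (- \<theta>)) n = integral {-pi..pi} (\<lambda>\<theta>. h \<theta> * cis (- (of_int n * \<theta>))) + integral {-pi..pi} (\<lambda>\<theta>. h \<theta> * cis (of_int n * \<theta>))"
    by (subst fc_add[OF h cper_reflect[OF h]]) (simp add: fc_def)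
  also have "\<dots> = integral {-pi..pi} (\<lambda>\<theta>. h \<theta> * cis (- (of_int n * \<theta>)) + h \<theta> * cis (of_int n * \<theta>))"
    by (rule Henstock_Kurzweil_Integration.integral_add[symmetric]) (intro cper_integrable cper_intros h)+
  also have "\<dots> = integral {-pi..pi} (\<lambda>\<theta>. 2 * (of_real (cos (of_nat (nat \<bar>n\<bar>) * \<theta>)) * h \<theta>))"
  proof (rule integral_cong)
    fix \<theta> :: real
    have "cos (of_nat (nat \<bar>n\<bar>) * \<theta>) = cos (of_int n * \<theta>)" by (cases "n \<ge> 0") auto
    moreover have "cis (- (of_int n * \<theta>)) + cis (of_int n * \<theta>) = 2 * of_real (cos (of_int n * \<theta>))" by (simp add: complex_eq_iff)
    ultimately show "h \<theta> * cis (- (of_int n * \<theta>)) + h \<theta> * cis (of_int n * \<theta>) = 2 * (of_real (cos (of_nat (nat \<bar>n\<bar>) * \<theta>)) * h \<theta>)"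
      by (simp only: distrib_left[symmetric] mult_ac)
  qed
  also have "\<dots> = 2 * cos_transform (\<lambda>\<theta>. of_real (cos (of_nat (nat \<bar>n\<bar>) * \<theta>)) * h \<theta>) 0"
    by (simp only: cos_transform_def integral_mult_right) simp
  also have "\<dots> = 0" by (simp only: cos_transform_zero_cos_multiple[OF h z] mult_zero_right)
  finally show "fc (\<lambda>\<theta>. h \<theta> + h (- \<theta>)) n = 0" .
qed

lemma osc_fc_eq_cos_transform: "osc_fc l g n = cos_transform (\<lambda>\<theta>. g \<theta> * cis (- (of_int n * \<theta>))) (of_real l)"
  unfolding osc_fc_def fc_def cos_transform_def by (rule integral_cong) (simp add: cis_conv_exp mult_ac)

section \<open>Accumulating zeros and the identity theorem\<close>

text \<open>A bounded infinite set has a limit point, so the entire transform vanishes identically;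
  the function \<open>g \<theta> * cis (- (of_int n * \<theta>))\<close> is therefore odd.\<close>

lemma osc_fc_zeros_accumulate:
  assumes g: "cper g" and T: "infinite T" "T \<subseteq> {0..B}" and z: "\<And>l. l \<in> T \<Longrightarrow> osc_fc l g n = 0"
  shows "g \<theta> * cis (- (of_int n * \<theta>)) + g (- \<theta>) * cis (of_int n * \<theta>) = 0"
proof -
  define h where "h = (\<lambda>\<theta>. g \<theta> * cis (- (of_int n * \<theta>)))"
  have h: "cper h" unfolding h_def by (intro cper_intros g)
  let ?U = "complex_of_real ` T"
  have "infinite ?U" using T(1) by (simp add: finite_image_iff inj_on_def)
  moreover have "?U \<subseteq> cball 0 B" using T(2) by auto
  ultimately obtain \<xi> where \<xi>: "\<xi> islimpt ?U"
    using compact_cball[of "0 :: complex" B] unfolding compact_eq_Bolzano_Weierstrass by blast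
  have "cos_transform h w = 0" for w
  proof (rule analytic_continuation[of "cos_transform h" UNIV ?U \<xi>])
    show "cos_transform h holomorphic_on UNIV"
      using cos_transform_has_field_derivative[OF h] by (auto simp: holomorphic_on_def field_differentiable_def intro: has_field_derivative_at_within)
    show "cos_transform h x = 0" if "x \<in> ?U" for x using that z by (auto simp: h_def osc_fc_eq_cos_transform)
  qed (use \<xi> in auto)
  from cos_transform_zero_odd[OF h this, of \<theta>] show ?thesis by (simp add: h_def)
qed

text \<open>By the pigeonhole principle, each window of six indices has one index that is a zero for
  infinitely many \<open>l\<close>. Two disjoint windows give two different oddness relations, which
  are compatible only where \<open>g\<close> vanishes or an exponential equals 1.\<close>

lemma bounded_gaps_imp_zero:
  assumes g: "cper g" and L: "infinite L" "L \<subseteq> {0..B}"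
    and gaps: "\<And>l n. l \<in> L \<Longrightarrow> \<exists>j\<in>{0..5::nat}. osc_fc l g (n + int j) = 0"
  shows "g x = 0"
proof -
  have antisym: "\<exists>m\<in>{n..n+5}. \<forall>\<theta>. g \<theta> * cis (- (of_int m * \<theta>)) + g (- \<theta>) * cis (of_int m * \<theta>) = 0" for n
  proof -
    have "\<exists>j\<in>{0..5::nat}. infinite {l \<in> L. osc_fc l g (n + int j) = 0}"
    proof (rule ccontr)
      assume "\<not> ?thesis"
      then have "finite (\<Union>j\<in>{0..5::nat}. {l \<in> L. osc_fc l g (n + int j) = 0})" by auto
      moreover have "L \<subseteq> (\<Union>j\<in>{0..5::nat}. {l \<in> L. osc_fc l g (n + int j) = 0})" using gaps by blast
      ultimately show False using L(1) finite_subset by blast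
    qed
    then obtain j where j: "j \<in> {0..5::nat}" "infinite {l \<in> L. osc_fc l g (n + int j) = 0}" by blast
    have "g \<theta> * cis (- (of_int (n + int j) * \<theta>)) + g (- \<theta>) * cis (of_int (n + int j) * \<theta>) = 0" for \<theta>
      by (rule osc_fc_zeros_accumulate[OF g j(2), of B]) (use L(2) in auto)
    then show ?thesis using j(1) by (intro bexI[of _ "n + int j"]) auto
  qed
  obtain m where m: "m \<in> {0..5}" "\<And>\<theta>. g \<theta> * cis (- (of_int m * \<theta>)) + g (- \<theta>) * cis (of_int m * \<theta>) = 0"
    using antisym[of 0] by auto
  obtain n where n: "n \<in> {6..11}" "\<And>\<theta>. g \<theta> * cis (- (of_int n * \<theta>)) + g (- \<theta>) * cis (of_int n * \<theta>) = 0"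
    using antisym[of 6] by auto
  \<comment> \<open>Each relation expresses \<open>g (- \<theta>)\<close> as
    \<open>- g \<theta>\<close> times an exponential with exponent \<open>2 * m\<close> or
    \<open>2 * n\<close>; equating the two leaves \<open>g \<theta> = 0\<close> or equal
    exponentials.\<close>
  have z: "g \<theta> = 0 \<or> cis (of_nat (nat (2 * (n - m))) * \<theta>) = 1" for \<theta>
  proof -
    have neg: "g (- \<theta>) = - (g \<theta> * cis (- (2 * of_int i * \<theta>)))" if "g \<theta> * cis (- (of_int i * \<theta>)) + g (- \<theta>) * cis (of_int i * \<theta>) = 0" for i
    proof -
      have "g (- \<theta>) = g (- \<theta>) * cis (of_int i * \<theta>) * cis (- (of_int i * \<theta>))" by (simp add: mult.assoc cis_mult)
      also have "g (- \<theta>) * cis (of_int i * \<theta>) = - (g \<theta> * cis (- (of_int i * \<theta>)))" using that by (simp add: add_eq_0_iff)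
      finally show ?thesis by (simp add: mult_ac cis_mult)
    qed
    have "g \<theta> * cis (- (2 * of_int m * \<theta>)) = g \<theta> * cis (- (2 * of_int n * \<theta>))"
      using neg[OF m(2)] neg[OF n(2)] by (metis neg_equal_iff_equal)
    then have "g \<theta> = 0 \<or> cis (- (2 * of_int m * \<theta>)) = cis (- (2 * of_int n * \<theta>))" by simp
    moreover have "cis (of_nat (nat (2 * (n - m))) * \<theta>) = cis (2 * of_int n * \<theta>) * cis (- (2 * of_int m * \<theta>))"
      using m(1) n(1) by (simp add: cis_mult algebra_simps)
    moreover have "cis (2 * of_int n * \<theta>) * cis (- (2 * of_int n * \<theta>)) = 1" by (simp add: cis_mult)
    ultimately show ?thesis by auto
  qed
  show ?thesis by (rule cis_zero_off[OF g _ z]) (use m(1) n(1) in auto)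
qed

section \<open>Rotation of the density and conclusion\<close>

lemma C1per_of_C1_differentiable:
  assumes per: "\<forall>\<theta>. \<phi> (\<theta> + 2 * pi) = \<phi> \<theta>" and C1: "\<phi> C1_differentiable_on UNIV"
  shows "\<exists>\<phi>'. C1per \<phi> \<phi>'"
proof -
  obtain D where D: "\<And>x. (\<phi> has_vector_derivative D x) (at x)" "continuous_on UNIV D"
    using C1 unfolding C1_differentiable_on_def by auto
  have "D (x + 2 * pi) = D x" for x
  proof -
    have "((\<lambda>x. x + 2 * pi) has_vector_derivative 1) (at x)" by (auto intro!: derivative_eq_intros)
    from vector_diff_chain_at[OF this D(1)]
    have "(\<phi> has_vector_derivative D (x + 2 * pi)) (at x)" using per by (simp add: o_def)
    then show ?thesis using D(1) vector_derivative_unique_at by blast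
  qed
  moreover have "continuous_on UNIV \<phi>"
    by (rule continuous_at_imp_continuous_on) (use D(1) has_vector_derivative_continuous in blast)
  ultimately have "C1per \<phi> D" unfolding C1per_def cper_def using D per by blast
  then show ?thesis by blast
qed

lemma C1per_shift:
  assumes "C1per g g'"
  shows "C1per (\<lambda>x. g (x + c)) (\<lambda>x. g' (x + c))"
proof -
  note g = C1perD[OF assms]
  have "((\<lambda>x. x + c) has_vector_derivative 1) (at x)" for x by (auto intro!: derivative_eq_intros)
  from vector_diff_chain_at[OF this g(3)]
  have "((\<lambda>x. g (x + c)) has_vector_derivative g' (x + c)) (at x)" for x by (simp add: o_def)
  then show ?thesis unfolding C1per_def using cper_shift[OF g(1)] cper_shift[OF g(2)] by blast
qed

text \<open>Rotating by the polar angle \<open>c\<close> of \<open>x0\<close> turns the phase into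
  \<open>k * r * cos \<theta>\<close> and changes the coefficients only by a factor of modulus 1, so
  their zeros are unchanged.\<close>

lemma fc_shift_osc_fc:
  assumes \<phi>: "cper \<phi>" and x0: "x0 = r *\<^sub>R unitvec c"
  shows "osc_fc (k * r) (\<lambda>\<theta>. \<phi> (\<theta> + c)) n = cis (of_int n * c) * fc (\<lambda>\<theta>. \<phi> \<theta> * cis (k * (unitvec \<theta> \<bullet> x0))) n"
proof -
  define h where "h \<theta> = \<phi> \<theta> * cis (k * (unitvec \<theta> \<bullet> x0)) * cis (- (of_int n * \<theta>))" for \<theta>
  have "cper (\<lambda>\<theta>. cis (k * (unitvec \<theta> \<bullet> x0)))"
    unfolding cper_def by (auto simp: unitvec_def intro!: continuous_intros)
  then have h: "cper h" unfolding h_def by (intro cper_intros \<phi>)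
  have "osc_fc (k * r) (\<lambda>\<theta>. \<phi> (\<theta> + c)) n = integral {-pi..pi} (\<lambda>\<theta>. cis (of_int n * c) * h (\<theta> + c))"
    unfolding osc_fc_def fc_def
  proof (rule integral_cong)
    fix \<theta>
    have "k * (unitvec (\<theta> + c) \<bullet> x0) = k * r * cos \<theta>"
      unfolding x0 by (simp add: inner_unitvec)
    moreover have "cis (- (of_int n * \<theta>)) = cis (of_int n * c) * cis (- (of_int n * (\<theta> + c)))"
      by (simp add: cis_mult algebra_simps)
    ultimately show "\<phi> (\<theta> + c) * cis (k * r * cos \<theta>) * cis (- (of_int n * \<theta>)) = cis (of_int n * c) * h (\<theta> + c)"
      unfolding h_def by (simp only: mult_ac)
  qed
  also have "\<dots> = cis (of_int n * c) * integral {-pi..pi} h"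
    unfolding integral_mult_right integral_cper_shift[OF h] ..
  finally show ?thesis unfolding h_def fc_def .
qed

theorem theorem2:
  fixes q R0 :: real and x0 :: pt and \<phi> :: "real \<Rightarrow> complex"
  assumes "q > 0" and "q \<noteq> 1" and "R0 > 0" and "x0 \<noteq> 0"
    and "norm x0 / R0 <
           (if sqrt q < 1 \<or> (1 < sqrt q \<and> sqrt q \<le> 1 / (sqrt 3 - 1))
            then sqrt q / (1 + sqrt q)
            else sqrt (1 - 2 * (1 + sqrt q) / (3 * sqrt (3 * q))))"
    and "\<forall>\<theta>. \<phi> (\<theta> + 2 * pi) = \<phi> \<theta>"
    and "\<phi> C1_differentiable_on UNIV"
    and "\<exists>\<theta>. \<phi> \<theta> \<noteq> 0"
  shows "finite {k::real. k > 0 \<and> nonscattering_disk x0 R0 q k \<phi>}"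
proof (rule ccontr)
  assume inf: "infinite {k::real. k > 0 \<and> nonscattering_disk x0 R0 q k \<phi>}" (is "infinite ?K")
  obtain \<phi>' where \<phi>: "C1per \<phi> \<phi>'" using C1per_of_C1_differentiable[OF assms(6,7)] by blast
  define r where "r = norm x0"
  have r: "r > 0" using assms(4) by (simp add: r_def)
  obtain c where x0: "x0 = r *\<^sub>R unitvec c"
  proof -
    obtain a b where ab: "x0 = (a, b)" by (cases x0)
    have "a\<^sup>2 + b\<^sup>2 = r\<^sup>2" by (simp add: r_def ab norm_Pair)
    moreover have "(a / r)\<^sup>2 + (b / r)\<^sup>2 = (a\<^sup>2 + b\<^sup>2) / r\<^sup>2" by (simp add: power_divide add_divide_distrib)
    ultimately have "(a / r)\<^sup>2 + (b / r)\<^sup>2 = 1" using r by simp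
    then obtain t where "a / r = cos t" "b / r = sin t" using sincos_total_2pi by metis
    then have "x0 = r *\<^sub>R unitvec t" using r by (simp add: ab unitvec_def field_simps)
    then show ?thesis using that by blast
  qed
  define g where "g = (\<lambda>\<theta>. \<phi> (\<theta> + c))"
  have g: "C1per g (\<lambda>\<theta>. \<phi>' (\<theta> + c))" unfolding g_def by (rule C1per_shift[OF \<phi>])
  have gap: "\<exists>j\<in>{0..5::nat}. osc_fc (k * r) g (n + int j) = 0" if "k \<in> ?K" for k n
  proof -
    from that have k: "k > 0" "nonscattering_disk x0 R0 q k \<phi>" by auto
    \<comment> \<open>\<open>q \<noteq> 1\<close> makes the two Bessel arguments distinct; where the
      determinant is nonzero, the Fourier coefficient must vanish.\<close>
    have "k * R0 > 0" "k * sqrt q * R0 > 0" "k * R0 \<noteq> k * sqrt q * R0" using k(1) assms(1-3) by auto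
    then obtain j where j: "j \<in> {0..5::nat}" "besW (k * R0) (k * sqrt q * R0) (n + int j) \<noteq> 0"
      using besW_gap by blast
    have "fc (\<lambda>\<theta>. \<phi> \<theta> * cis (k * (unitvec \<theta> \<bullet> x0))) (n + int j) = 0"
      using nonscattering_imp[OF k(2) C1perD(1)[OF \<phi>] assms(3,1) k(1), of "n + int j"] j(2) by simp
    then have "osc_fc (k * r) g (n + int j) = 0"
      unfolding g_def fc_shift_osc_fc[OF C1perD(1)[OF \<phi>] x0] by simp
    then show ?thesis using j(1) by blast
  qed
  let ?L = "(\<lambda>k. k * r) ` ?K"
  have infL: "infinite ?L" using inf r by (simp add: finite_image_iff inj_on_def)
  have "g x = 0" for x
  \<comment> \<open>Bounded parameters accumulate, so analyticity in \<open>l\<close> applies;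
    unbounded ones allow the limit \<open>l \<rightarrow> \<infinity>\<close>.\<close>
  proof (cases "\<exists>B. ?L \<subseteq> {0..B}")
    case True
    then obtain B where B: "?L \<subseteq> {0..B}" by blast
    show ?thesis by (rule bounded_gaps_imp_zero[OF C1perD(1)[OF g] infL B]) (use gap in blast)
  next
    case False
    show ?thesis
    proof (rule gaps_imp_zero[OF g])
      fix B :: real
      obtain l where l: "l \<in> ?L" "l \<notin> {0..B}" using False by blast
      then have "l \<ge> B" using r by auto
      then show "\<exists>l\<ge>B. \<forall>n. \<exists>j\<in>{0..5::nat}. osc_fc l g (n + int j) = 0" using l(1) gap by blast
    qed
  qed
  then have "\<phi> \<theta> = 0" for \<theta> using spec[of _ "\<theta> - c"] unfolding g_def by (metis diff_add_cancel)
  then show False using assms(8) by blast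
qed

end
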